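(* Let $n\geq 3$ and let $\mathcal{O}$ be the ring of integers of a number field. Let $R$ be a ring with $R\equiv\mathcal{O}$ and let $f_1,\ldots,f_{n-1}\in S^2(R^\times,R^\times)$ be symmetric 2-cocycles each of which is CoT. Then the group $\mathrm{T}_n(R,\bar f)$, $\bar f=(f_1,\ldots,f_{n-1})$, is elementarily equivalent to $\mathrm{T}_n(\mathcal{O})$.
   Context: Rings are commutative, associative and unital; $R^\times$ is the group of units of $R$; $\equiv$ denotes elementary equivalence (in the language of groups, respectively of unitary rings). $\mathrm{T}_n(R)$ is the group of all invertible upper triangular $n\times n$ matrices over $R$, and $\mathrm{UT}_n(R)$ is its subgroup of upper unitriangular matrices. Symmetric 2-cocycles: for abelian groups $A,B$ written multiplicatively, a symmetric 2-cocycle is a function $f:B\times B\to A$ with $f(xy,z)f(x,y)=f(x,yz)f(y,z)$, $f(1,x)=f(x,1)=1$ and $f(x,y)=f(y,x)$ for all $x,y,z\in B$. The group of these is $S^2(B,A)$. A 2-coboundary is a 2-cocycle $g$ such that $\psi(xy)=g(x,y)\psi(x)\psi(y)$ for all $x,y\in B$, for some function $\psi:B\to A$. Two 2-cocycles are cohomologous if they differ by a 2-coboundary. CoT: let $A=T\times F$ be an abelian group with $T$ torsion and $F$ torsion-free, and let $B$ be an abelian group. Since $\mathrm{Ext}(A,B)\cong \mathrm{Ext}(T,B)\oplus\mathrm{Ext}(F,B)$, any $f\in S^2(A,B)$ is cohomologous to a product $f_1\cdot f_2$ with $f_1\in S^2(F,B)$ and $f_2\in S^2(T,B)$ (pulled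 back to $A$ via the projections). $f$ is CoT (coboundary on torsion) if $f_2$ is a 2-coboundary. (For $R\equiv\mathcal{O}$ the torsion subgroup of $R^\times$ is finite, so $R^\times$ has such a decomposition.) Abelian deformation: given $f_1,\ldots,f_{n-1}\in S^2(R^\times,R^\times)$, let $E_n=D_n(R,\bar f)$ be the abelian group with underlying set $(R^\times)^{n-1}\times R^\times$ and multiplication $$\big((x_1,\ldots,x_{n-1}),z\big)\big((y_1,\ldots,y_{n-1}),w\big)=\Big((x_1y_1,\ldots,x_{n-1}y_{n-1}),\ zw\prod_{i=1}^{n-1}f_i(x_i,y_i)\Big).$$ $\mathrm{T}_n(R,\bar f)$ is the semidirect product $E_n\ltimes \mathrm{UT}_n(R)$, where $((x_1,\ldots,x_{n-1}),z)$ acts on $\mathrm{UT}_n(R)$ as conjugation by the diagonal matrix $\mathrm{diag}[x_1,\ldots,x_{n-1},1]$ (so the second factor $R^\times$ acts trivially and is central, playing the role of the scalar matrices). When all $f_i$ are trivial this is $\mathrm{T}_n(R)$. *)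

theory Defs
  imports
    "HOL-Algebra.Generated_Fields"
    "HOL-Algebra.Embedded_Algebras"
    "HOL-Algebra.Polynomials"
    "HOL-Algebra.Product_Groups"
    "Jordan_Normal_Form.Matrix"
begin

section \<open>Elementary equivalence of groups and of rings\<close>

text \<open>First-order formulas with equality over an arbitrary type \<open>'t\<close> of terms. The variables are
  natural numbers; the remaining connectives and the universal quantifier are definable.\<close>

datatype 't fo_formula =
    FEq 't 't
  | FNeg "'t fo_formula"
  | FConj "'t fo_formula" "'t fo_formula"
  | FEx nat "'t fo_formula"

primrec free_vars :: "('t \<Rightarrow> nat set) \<Rightarrow> 't fo_formula \<Rightarrow> nat set" where
  "free_vars tvars (FEq s t) = tvars s \<union> tvars t"
| "free_vars tvars (FNeg \<phi>) = free_vars tvars \<phi>"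
| "free_vars tvars (FConj \<phi> \<psi>) = free_vars tvars \<phi> \<union> free_vars tvars \<psi>"
| "free_vars tvars (FEx v \<phi>) = free_vars tvars \<phi> - {v}"

text \<open>\<open>holds M teval e \<phi>\<close>: the formula \<open>\<phi>\<close> is true under the assignment \<open>e\<close> in the structure with
  universe \<open>M\<close> in which terms are evaluated by \<open>teval\<close>.\<close>

primrec holds :: "'a set \<Rightarrow> ((nat \<Rightarrow> 'a) \<Rightarrow> 't \<Rightarrow> 'a) \<Rightarrow> (nat \<Rightarrow> 'a) \<Rightarrow> 't fo_formula \<Rightarrow> bool" where
  "holds M teval e (FEq s t) \<longleftrightarrow> teval e s = teval e t"
| "holds M teval e (FNeg \<phi>) \<longleftrightarrow> \<not> holds M teval e \<phi>"
| "holds M teval e (FConj \<phi> \<psi>) \<longleftrightarrow> holds M teval e \<phi> \<and> holds M teval e \<psi>"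
| "holds M teval e (FEx v \<phi>) \<longleftrightarrow> (\<exists>a\<in>M. holds M teval (e(v := a)) \<phi>)"

datatype group_term = GVar nat | GOne | GInv group_term | GMult group_term group_term

primrec group_term_vars :: "group_term \<Rightarrow> nat set" where
  "group_term_vars (GVar v) = {v}"
| "group_term_vars GOne = {}"
| "group_term_vars (GInv t) = group_term_vars t"
| "group_term_vars (GMult s t) = group_term_vars s \<union> group_term_vars t"

primrec group_term_eval :: "('a, 'm) monoid_scheme \<Rightarrow> (nat \<Rightarrow> 'a) \<Rightarrow> group_term \<Rightarrow> 'a" where
  "group_term_eval G e (GVar v) = e v"
| "group_term_eval G e GOne = \<one>\<^bsub>G\<^esub>"
| "group_term_eval G e (GInv t) = inv\<^bsub>G\<^esub> (group_term_eval G e t)"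
| "group_term_eval G e (GMult s t) = group_term_eval G e s \<otimes>\<^bsub>G\<^esub> group_term_eval G e t"

definition group_models :: "('a, 'm) monoid_scheme \<Rightarrow> group_term fo_formula \<Rightarrow> bool" where
  "group_models G \<phi> \<longleftrightarrow>
     (\<forall>e. range e \<subseteq> carrier G \<longrightarrow> holds (carrier G) (group_term_eval G) e \<phi>)"

definition group_elem_equiv :: "('a, 'm) monoid_scheme \<Rightarrow> ('b, 'n) monoid_scheme \<Rightarrow> bool" where
  "group_elem_equiv G H \<longleftrightarrow>
     (\<forall>\<phi>. free_vars group_term_vars \<phi> = {} \<longrightarrow> (group_models G \<phi> \<longleftrightarrow> group_models H \<phi>))"

datatype ring_term =
  RVar nat | RZero | ROne | RNeg ring_term | RAdd ring_term ring_term | RMult ring_term ring_term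

primrec ring_term_vars :: "ring_term \<Rightarrow> nat set" where
  "ring_term_vars (RVar v) = {v}"
| "ring_term_vars RZero = {}"
| "ring_term_vars ROne = {}"
| "ring_term_vars (RNeg t) = ring_term_vars t"
| "ring_term_vars (RAdd s t) = ring_term_vars s \<union> ring_term_vars t"
| "ring_term_vars (RMult s t) = ring_term_vars s \<union> ring_term_vars t"

primrec ring_term_eval :: "('a, 'm) ring_scheme \<Rightarrow> (nat \<Rightarrow> 'a) \<Rightarrow> ring_term \<Rightarrow> 'a" where
  "ring_term_eval R e (RVar v) = e v"
| "ring_term_eval R e RZero = \<zero>\<^bsub>R\<^esub>"
| "ring_term_eval R e ROne = \<one>\<^bsub>R\<^esub>"
| "ring_term_eval R e (RNeg t) = \<ominus>\<^bsub>R\<^esub> (ring_term_eval R e t)"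
| "ring_term_eval R e (RAdd s t) = ring_term_eval R e s \<oplus>\<^bsub>R\<^esub> ring_term_eval R e t"
| "ring_term_eval R e (RMult s t) = ring_term_eval R e s \<otimes>\<^bsub>R\<^esub> ring_term_eval R e t"

definition ring_models :: "('a, 'm) ring_scheme \<Rightarrow> ring_term fo_formula \<Rightarrow> bool" where
  "ring_models R \<phi> \<longleftrightarrow>
     (\<forall>e. range e \<subseteq> carrier R \<longrightarrow> holds (carrier R) (ring_term_eval R) e \<phi>)"

definition ring_elem_equiv :: "('a, 'm) ring_scheme \<Rightarrow> ('b, 'n) ring_scheme \<Rightarrow> bool" where
  "ring_elem_equiv R S \<longleftrightarrow>
     (\<forall>\<phi>. free_vars ring_term_vars \<phi> = {} \<longrightarrow> (ring_models R \<phi> \<longleftrightarrow> ring_models S \<phi>))"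


section \<open>Number fields and their rings of integers\<close>

text \<open>\<open>generate_field K {}\<close> is the prime subfield of \<open>K\<close>, which is a copy of the rationals in
  characteristic zero; \<open>generate_ring K {}\<close> is likewise the copy of the integers in \<open>K\<close>.\<close>

locale number_field = field K for K (structure) +
  assumes char_zero: "\<And>m :: nat. m > 0 \<Longrightarrow> [m] \<cdot> \<one> \<noteq> \<zero>"
    and finite_degree: "finite_dimension (generate_field K {}) (carrier K)"

definition ring_of_integers :: "('a, 'm) ring_scheme \<Rightarrow> ('a, 'm) ring_scheme" where
  "ring_of_integers K =
     K\<lparr>carrier := {x \<in> carrier K.
        \<exists>p \<in> carrier ((generate_ring K {})[X]\<^bsub>K\<^esub>).
          p \<noteq> [] \<and> Polynomials.lead_coeff p = \<one>\<^bsub>K\<^esub> \<and> ring.eval K p x = \<zero>\<^bsub>K\<^esub>}\<rparr>"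


section \<open>Symmetric cocycles\<close>

definition sym_cocycles ::
    "('b, 'm) monoid_scheme \<Rightarrow> ('a, 'n) monoid_scheme \<Rightarrow> ('b \<Rightarrow> 'b \<Rightarrow> 'a) set" where
  "sym_cocycles B A = {f.
     (\<forall>x\<in>carrier B. \<forall>y\<in>carrier B. f x y \<in> carrier A) \<and>
     (\<forall>x\<in>carrier B. \<forall>y\<in>carrier B. \<forall>z\<in>carrier B.
        f (x \<otimes>\<^bsub>B\<^esub> y) z \<otimes>\<^bsub>A\<^esub> f x y = f x (y \<otimes>\<^bsub>B\<^esub> z) \<otimes>\<^bsub>A\<^esub> f y z) \<and>
     (\<forall>x\<in>carrier B. f \<one>\<^bsub>B\<^esub> x = \<one>\<^bsub>A\<^esub> \<and> f x \<one>\<^bsub>B\<^esub> = \<one>\<^bsub>A\<^esub>) \<and>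
     (\<forall>x\<in>carrier B. \<forall>y\<in>carrier B. f x y = f y x)}"

text \<open>Over an abelian group every coboundary is symmetric, so nothing is lost by taking the
  cocycle in the following definition to be symmetric.\<close>

definition coboundary ::
    "('b, 'm) monoid_scheme \<Rightarrow> ('a, 'n) monoid_scheme \<Rightarrow> ('b \<Rightarrow> 'b \<Rightarrow> 'a) \<Rightarrow> bool" where
  "coboundary B A g \<longleftrightarrow> g \<in> sym_cocycles B A \<and>
     (\<exists>\<psi> \<in> carrier B \<rightarrow> carrier A. \<forall>x\<in>carrier B. \<forall>y\<in>carrier B.
        \<psi> (x \<otimes>\<^bsub>B\<^esub> y) = g x y \<otimes>\<^bsub>A\<^esub> \<psi> x \<otimes>\<^bsub>A\<^esub> \<psi> y)"

definition cohomologous ::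
    "('b, 'm) monoid_scheme \<Rightarrow> ('a, 'n) monoid_scheme \<Rightarrow>
     ('b \<Rightarrow> 'b \<Rightarrow> 'a) \<Rightarrow> ('b \<Rightarrow> 'b \<Rightarrow> 'a) \<Rightarrow> bool" where
  "cohomologous B A f f' \<longleftrightarrow>
     (\<exists>g. coboundary B A g \<and>
        (\<forall>x\<in>carrier B. \<forall>y\<in>carrier B. f x y = g x y \<otimes>\<^bsub>A\<^esub> f' x y))"

text \<open>\<open>A = T \<times> F\<close> as an internal direct product of a torsion subgroup \<open>T\<close> and a torsion-free
  subgroup \<open>F\<close>.\<close>

definition torsion_splitting :: "('a, 'm) monoid_scheme \<Rightarrow> 'a set \<Rightarrow> 'a set \<Rightarrow> bool" where
  "torsion_splitting A T F \<longleftrightarrow>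
     subgroup T A \<and> subgroup F A \<and>
     (\<forall>x\<in>T. \<exists>m::nat. m > 0 \<and> x [^]\<^bsub>A\<^esub> m = \<one>\<^bsub>A\<^esub>) \<and>
     (\<forall>x\<in>F. \<forall>m::nat. m > 0 \<and> x [^]\<^bsub>A\<^esub> m = \<one>\<^bsub>A\<^esub> \<longrightarrow> x = \<one>\<^bsub>A\<^esub>) \<and>
     (\<lambda>(t, u). t \<otimes>\<^bsub>A\<^esub> u) \<in> iso (A\<lparr>carrier := T\<rparr> \<times>\<times> A\<lparr>carrier := F\<rparr>) A"

definition proj_left :: "('a, 'm) monoid_scheme \<Rightarrow> 'a set \<Rightarrow> 'a set \<Rightarrow> 'a \<Rightarrow> 'a" where
  "proj_left A T F x = fst (inv_into (T \<times> F) (\<lambda>(t, u). t \<otimes>\<^bsub>A\<^esub> u) x)"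

definition proj_right :: "('a, 'm) monoid_scheme \<Rightarrow> 'a set \<Rightarrow> 'a set \<Rightarrow> 'a \<Rightarrow> 'a" where
  "proj_right A T F x = snd (inv_into (T \<times> F) (\<lambda>(t, u). t \<otimes>\<^bsub>A\<^esub> u) x)"

text \<open>The class of \<open>f2\<close> is that of the restriction of \<open>f\<close> to the torsion subgroup of \<open>A\<close>. Hence
  whether \<open>f\<close> is CoT does not depend on the splitting nor on the choice of \<open>f1\<close> and \<open>f2\<close>.\<close>

definition CoT ::
    "('a, 'm) monoid_scheme \<Rightarrow> ('b, 'n) monoid_scheme \<Rightarrow> ('a \<Rightarrow> 'a \<Rightarrow> 'b) \<Rightarrow> bool" where
  "CoT A B f \<longleftrightarrow>
     (\<exists>T F. torsion_splitting A T F \<and>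
       (\<exists>f1 \<in> sym_cocycles (A\<lparr>carrier := F\<rparr>) B. \<exists>f2 \<in> sym_cocycles (A\<lparr>carrier := T\<rparr>) B.
          cohomologous A B f
            (\<lambda>x y. f1 (proj_right A T F x) (proj_right A T F y) \<otimes>\<^bsub>B\<^esub>
                   f2 (proj_left A T F x) (proj_left A T F y)) \<and>
          coboundary (A\<lparr>carrier := T\<rparr>) B f2))"


section \<open>Groups of triangular matrices\<close>

text \<open>The matrices of \<^theory>\<open>Jordan_Normal_Form.Matrix\<close> are indexed from \<open>0\<close>. Their arithmetic
  is tied to type classes, so the product over a ring with explicit carrier is spelled out.\<close>

definition matrix_monoid :: "('a, 'm) ring_scheme \<Rightarrow> nat \<Rightarrow> 'a mat monoid" where
  "matrix_monoid R n =
     \<lparr>carrier = {M \<in> carrier_mat n n. elements_mat M \<subseteq> carrier R},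
      monoid.mult = (\<lambda>M N. mat n n (\<lambda>(i, j). \<Oplus>\<^bsub>R\<^esub>k\<in>{..<n}. M $$ (i, k) \<otimes>\<^bsub>R\<^esub> N $$ (k, j))),
      one = mat n n (\<lambda>(i, j). if i = j then \<one>\<^bsub>R\<^esub> else \<zero>\<^bsub>R\<^esub>)\<rparr>"

definition GL :: "('a, 'm) ring_scheme \<Rightarrow> nat \<Rightarrow> 'a mat monoid" where
  "GL R n = units_of (matrix_monoid R n)"

definition T_group :: "('a, 'm) ring_scheme \<Rightarrow> nat \<Rightarrow> 'a mat monoid" where
  "T_group R n = (GL R n)\<lparr>carrier :=
     {M \<in> carrier (GL R n). \<forall>i<n. \<forall>j<i. M $$ (i, j) = \<zero>\<^bsub>R\<^esub>}\<rparr>"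

definition UT_group :: "('a, 'm) ring_scheme \<Rightarrow> nat \<Rightarrow> 'a mat monoid" where
  "UT_group R n = (T_group R n)\<lparr>carrier :=
     {M \<in> carrier (T_group R n). \<forall>i<n. M $$ (i, i) = \<one>\<^bsub>R\<^esub>}\<rparr>"


section \<open>Abelian deformations\<close>

text \<open>The indices \<open>1, \<dots>, n - 1\<close> of the cocycles and of the coordinates are shifted to
  \<open>0, \<dots>, n - 2\<close>, in agreement with the indexing of matrices.\<close>

definition D_group ::
    "('a, 'm) ring_scheme \<Rightarrow> nat \<Rightarrow> (nat \<Rightarrow> 'a \<Rightarrow> 'a \<Rightarrow> 'a) \<Rightarrow> ((nat \<Rightarrow> 'a) \<times> 'a) monoid" where
  "D_group R n f =
     (let U = units_of R; P = product_group {..<n - 1} (\<lambda>_. U) in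
      \<lparr>carrier = carrier P \<times> carrier U,
       monoid.mult = (\<lambda>(x, z) (y, w).
         (x \<otimes>\<^bsub>P\<^esub> y, z \<otimes>\<^bsub>U\<^esub> w \<otimes>\<^bsub>U\<^esub> (\<Otimes>\<^bsub>U\<^esub>i\<in>{..<n - 1}. f i (x i) (y i)))),
       one = (\<one>\<^bsub>P\<^esub>, \<one>\<^bsub>U\<^esub>)\<rparr>)"

text \<open>\<open>H \<ltimes> N\<close> for a left action of \<open>H\<close> on \<open>N\<close> by automorphisms; the pair \<open>(h, u)\<close> stands for the
  product \<open>u h\<close>, so that \<open>h u h\<^sup>-\<^sup>1\<close> is the result of \<open>h\<close> acting on \<open>u\<close>.\<close>

definition semidirect_product ::
    "('h, 'm) monoid_scheme \<Rightarrow> ('u, 'n) monoid_scheme \<Rightarrow> ('h \<Rightarrow> 'u \<Rightarrow> 'u) \<Rightarrow> ('h \<times> 'u) monoid" where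
  "semidirect_product H N act =
     \<lparr>carrier = carrier H \<times> carrier N,
      monoid.mult = (\<lambda>(h, u) (k, v). (h \<otimes>\<^bsub>H\<^esub> k, u \<otimes>\<^bsub>N\<^esub> act h v)),
      one = (\<one>\<^bsub>H\<^esub>, \<one>\<^bsub>N\<^esub>)\<rparr>"

definition diag_last_one :: "('a, 'm) ring_scheme \<Rightarrow> nat \<Rightarrow> (nat \<Rightarrow> 'a) \<Rightarrow> 'a mat" where
  "diag_last_one R n x =
     mat n n (\<lambda>(i, j). if i \<noteq> j then \<zero>\<^bsub>R\<^esub> else if i < n - 1 then x i else \<one>\<^bsub>R\<^esub>)"

definition T_deformed ::
    "('a, 'm) ring_scheme \<Rightarrow> nat \<Rightarrow> (nat \<Rightarrow> 'a \<Rightarrow> 'a \<Rightarrow> 'a) \<Rightarrow>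
     (((nat \<Rightarrow> 'a) \<times> 'a) \<times> 'a mat) monoid" where
  "T_deformed R n f =
     semidirect_product (D_group R n f) (UT_group R n)
       (\<lambda>(x, z) M. diag_last_one R n x \<otimes>\<^bsub>GL R n\<^esub> M \<otimes>\<^bsub>GL R n\<^esub> inv\<^bsub>GL R n\<^esub> (diag_last_one R n x))"

end

theory Submission
  imports
    Defs
    "HOL-Library.Countable"
    "Jordan_Normal_Form.Missing_Ring"
begin

text \<open>The ring \<open>R\<close> interprets \<open>T_group R n\<close> by formulas that do not depend on \<open>R\<close>, so \<open>T_group R n\<close>
  and \<open>T_group \<O> n\<close> are elementarily equivalent. It remains to compare \<open>T_deformed R n f\<close> with
  \<open>T_group R n\<close>.

  With \<open>A = R\<^sup>\<times>\<close> and \<open>B = A\<^bsup>n - 1\<^esup>\<close>, the group \<open>T_deformed R n f\<close> is \<open>T_group R n\<close> with the product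
  twisted by the cocycle \<open>F(x, y) = \<Prod>\<^sub>i f\<^sub>i(x\<^sub>i, y\<^sub>i)\<close> of \<open>B\<close> with values in the scalar matrices, and it is
  isomorphic to \<open>T_group R n\<close> if \<open>F\<close> is a coboundary. By CoT it is one on the torsion subgroup of \<open>B\<close>.
  The ultrapower \<open>A\<^sup>*\<close> along a nonprincipal ultrafilter on \<open>\<nat>\<close> is cotorsion, so that its
  extensions by torsion-free groups split; hence the ultrapower of \<open>F\<close> is a coboundary, the ultrapowers of the two groups are
  isomorphic, and the groups are elementarily equivalent by the theorem of Los.\<close>


text \<open>CoT leaves the class of \<open>F\<close> on the torsion-free part arbitrary, so no
  isomorphism between the two groups themselves is at hand. The reason that an ultrapower removes
  this class is that an extension by a torsion-free group of rank one is governed by one countable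
  system of equations, in which each unknown is determined by the next one. A finite part of the
  system is always solvable, and in a group of sequences each component has to satisfy only finitely
  many of the equations. An arbitrary torsion-free quotient is exhausted by Zorn's lemma, starting
  from the splitting given over the torsion subgroup. Each step adjoins the whole isolator of a new
  element and not just the cyclic group generated by it, since only then does the remaining quotient
  stay torsion-free. The quotient by eventual equality is never formed: the eventually trivial
  sequences are carried along as a subgroup \<open>N\<close>, and the isomorphism of ultrapowers
  appears as a relation between sequences.\<close>

section \<open>First-order truth and free variables\<close>

lemma holds_cong:
  assumes "\<And>e e' t. (\<forall>v\<in>tvars t. e v = e' v) \<Longrightarrow> teval e t = teval e' t"
    and "\<forall>v\<in>free_vars tvars \<phi>. e v = e' v"
  shows "holds M teval e \<phi> \<longleftrightarrow> holds M teval e' \<phi>"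
  using assms(2)
proof (induction \<phi> arbitrary: e e')
  case (FEq s t)
  then show ?case using assms(1)[of s e e'] assms(1)[of t e e'] by simp
next
  case (FEx v \<phi>)
  have "holds M teval (e(v := a)) \<phi> \<longleftrightarrow> holds M teval (e'(v := a)) \<phi>" for a
    by (rule FEx.IH) (use FEx.prems in auto)
  then show ?case by simp
next
  case (FConj \<phi> \<psi>)
  then show ?case by (simp add: FConj.IH[of e e'])
qed auto

definition FAll :: "nat \<Rightarrow> 't fo_formula \<Rightarrow> 't fo_formula" where
  "FAll v \<phi> = FNeg (FEx v (FNeg \<phi>))"

lemma holds_FAll [simp]: "holds M teval e (FAll v \<phi>) \<longleftrightarrow> (\<forall>a\<in>M. holds M teval (e(v := a)) \<phi>)"
  by (simp add: FAll_def)

lemma free_vars_FAll [simp]: "free_vars tvars (FAll v \<phi>) = free_vars tvars \<phi> - {v}"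
  by (simp add: FAll_def)

lemma finite_free_vars: "(\<And>t. finite (tvars t)) \<Longrightarrow> finite (free_vars tvars \<phi>)"
  by (induction \<phi>) auto

section \<open>Transfer of ring formulas and of the ring axioms\<close>

lemma finite_ring_term_vars: "finite (ring_term_vars t)"
  by (induction t) auto

lemma ring_term_eval_cong:
  "\<forall>v\<in>ring_term_vars t. e v = e' v \<Longrightarrow> ring_term_eval R e t = ring_term_eval R e' t"
  by (induction t) auto

lemma ring_models_FAll:
  fixes R :: "('a, 'm) ring_scheme"
  shows "ring_models R (FAll v \<phi>) \<longleftrightarrow> ring_models R \<phi>"
proof
  assume l: "ring_models R (FAll v \<phi>)"
  show "ring_models R \<phi>"
    unfolding ring_models_def
  proof (intro allI impI)
    fix e :: "nat \<Rightarrow> 'a" assume e: "range e \<subseteq> carrier R"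
    with l have "\<forall>a\<in>carrier R. holds (carrier R) (ring_term_eval R) (e(v := a)) \<phi>"
      by (auto simp: ring_models_def)
    with e have "holds (carrier R) (ring_term_eval R) (e(v := e v)) \<phi>" by blast
    then show "holds (carrier R) (ring_term_eval R) e \<phi>" by simp
  qed
next
  assume r: "ring_models R \<phi>"
  show "ring_models R (FAll v \<phi>)"
    unfolding ring_models_def holds_FAll
  proof (intro allI impI ballI)
    fix e :: "nat \<Rightarrow> 'a" and a assume "range e \<subseteq> carrier R" "a \<in> carrier R"
    then have "range (e(v := a)) \<subseteq> carrier R" by auto
    with r show "holds (carrier R) (ring_term_eval R) (e(v := a)) \<phi>"
      by (simp add: ring_models_def)
  qed
qed

text \<open>\<open>ring_elem_equiv\<close> compares sentences only, while \<open>ring_models\<close>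
  quantifies over all assignments; binding the free variables one after another therefore does not
  affect validity. Axioms can thus be transferred as open identities.\<close>

lemma ring_elem_equiv_models:
  assumes "ring_elem_equiv R S"
  shows "ring_models R \<phi> \<longleftrightarrow> ring_models S \<phi>"
proof (induction "card (free_vars ring_term_vars \<phi>)" arbitrary: \<phi>)
  case 0
  then have "free_vars ring_term_vars \<phi> = {}"
    using finite_free_vars[of ring_term_vars \<phi>] finite_ring_term_vars by simp
  with assms show ?case by (simp add: ring_elem_equiv_def)
next
  case (Suc k)
  then obtain v where v: "v \<in> free_vars ring_term_vars \<phi>"
    by (metis card.empty ex_in_conv nat.distinct(1))
  have "k = card (free_vars ring_term_vars (FAll v \<phi>))"
    using Suc.hyps(2) v finite_free_vars[of ring_term_vars \<phi>] finite_ring_term_vars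
    by simp
  from Suc.hyps(1)[OF this] show ?case by (simp add: ring_models_FAll)
qed

text \<open>Applied to \<open>ring_of_integers K\<close>, this takes the place of integrality
  arguments for sums and products of algebraic integers: the ring axioms are first-order and come
  from \<open>R\<close>. As \<open>S\<close> is a bare record, closure of its operations has to be
  transferred too.\<close>

lemma ring_elem_equiv_cring:
  fixes R :: "('a, 'm) ring_scheme" and S :: "('b, 'n) ring_scheme"
  assumes equiv: "ring_elem_equiv R S" and "cring R"
  shows "cring S"
proof -
  interpret R: cring R by fact
  note eq = ring_elem_equiv_models[OF equiv]
  \<comment> \<open>\<open>FEx\<close> ranges over the carrier, so \<open>?E t\<close> asserts that
    the value of \<open>t\<close> lies in it; variable \<open>3\<close> occurs in none of the terms
    used.\<close>
  let ?E = "\<lambda>t. FEx 3 (FEq (RVar 3) t) :: ring_term fo_formula"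
  \<comment> \<open>Over an empty carrier every formula is vacuously valid, so an element of
    \<open>S\<close> must be found before anything can be read off. A formula that is not valid
    provides an assignment, hence an element.\<close>
  have "\<not> ring_models R (FNeg (FEx 0 (FEq (RVar 0) (RVar 0))))"
    unfolding ring_models_def by (auto intro!: exI[of _ "\<lambda>_. \<zero>\<^bsub>R\<^esub>"])
  then have "\<not> ring_models S (FNeg (FEx 0 (FEq (RVar 0) (RVar 0))))"
    by (simp only: eq not_False_eq_True)
  then obtain a where a: "a \<in> carrier S" unfolding ring_models_def by auto
  have tr: "holds (carrier S) (ring_term_eval S) ((\<lambda>_. z)(0 := x, Suc 0 := y)) \<phi>"
    if "ring_models R \<phi>" "x \<in> carrier S" "y \<in> carrier S" "z \<in> carrier S" for x y z \<phi>
  proof -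
    from that(1) have "ring_models S \<phi>" by (simp only: eq)
    moreover have "range ((\<lambda>_::nat. z)(0 := x, Suc 0 := y)) \<subseteq> carrier S" using that by auto
    ultimately show ?thesis by (simp add: ring_models_def)
  qed
  let ?x = "RVar 0" and ?y = "RVar 1" and ?z = "RVar 2"
  have "ring_models R (?E RZero)" "ring_models R (?E ROne)"
      "ring_models R (?E (RAdd ?x ?y))" "ring_models R (?E (RMult ?x ?y))"
    by (auto simp: ring_models_def image_subset_iff)
  from this[THEN tr] have
      cl: "x \<oplus>\<^bsub>S\<^esub> y \<in> carrier S" "x \<otimes>\<^bsub>S\<^esub> y \<in> carrier S"
         "\<zero>\<^bsub>S\<^esub> \<in> carrier S" "\<one>\<^bsub>S\<^esub> \<in> carrier S"
    if "x \<in> carrier S" "y \<in> carrier S" for x y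
    using that by auto
  have m: "ring_models R (FEq (RAdd ?x ?y) (RAdd ?y ?x))"
      "ring_models R (FEq (RMult ?x ?y) (RMult ?y ?x))"
      "ring_models R (FEq (RAdd (RAdd ?x ?y) ?z) (RAdd ?x (RAdd ?y ?z)))"
      "ring_models R (FEq (RMult (RMult ?x ?y) ?z) (RMult ?x (RMult ?y ?z)))"
      "ring_models R (FEq (RMult (RAdd ?x ?y) ?z) (RAdd (RMult ?x ?z) (RMult ?y ?z)))"
      "ring_models R (FEq (RAdd RZero ?x) ?x)"
      "ring_models R (FEq (RMult ROne ?x) ?x)"
    unfolding ring_models_def image_subset_iff
    by (simp_all add: R.a_assoc R.m_assoc R.l_distr, simp_all add: R.a_comm R.m_comm)
  have m8: "ring_models R (FEx 3 (FEq (RAdd (RVar 3) ?x) RZero))"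
    unfolding ring_models_def image_subset_iff by (auto intro: R.l_neg)
  have ax: "x \<oplus>\<^bsub>S\<^esub> y = y \<oplus>\<^bsub>S\<^esub> x"
      "(x \<oplus>\<^bsub>S\<^esub> y) \<oplus>\<^bsub>S\<^esub> z = x \<oplus>\<^bsub>S\<^esub> (y \<oplus>\<^bsub>S\<^esub> z)"
      "\<zero>\<^bsub>S\<^esub> \<oplus>\<^bsub>S\<^esub> x = x" "\<exists>u\<in>carrier S. u \<oplus>\<^bsub>S\<^esub> x = \<zero>\<^bsub>S\<^esub>"
    if "x \<in> carrier S" "y \<in> carrier S" "z \<in> carrier S" for x y z
    subgoal using tr[OF m(1) that] by simp
    subgoal using tr[OF m(3) that] by simp
    subgoal using tr[OF m(6) that] by simp
    subgoal using tr[OF m8 that] by simp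
    done
  have mx: "x \<otimes>\<^bsub>S\<^esub> y = y \<otimes>\<^bsub>S\<^esub> x"
      "(x \<otimes>\<^bsub>S\<^esub> y) \<otimes>\<^bsub>S\<^esub> z = x \<otimes>\<^bsub>S\<^esub> (y \<otimes>\<^bsub>S\<^esub> z)"
      "(x \<oplus>\<^bsub>S\<^esub> y) \<otimes>\<^bsub>S\<^esub> z = (x \<otimes>\<^bsub>S\<^esub> z) \<oplus>\<^bsub>S\<^esub> (y \<otimes>\<^bsub>S\<^esub> z)"
      "\<one>\<^bsub>S\<^esub> \<otimes>\<^bsub>S\<^esub> x = x"
    if "x \<in> carrier S" "y \<in> carrier S" "z \<in> carrier S" for x y z
    subgoal using tr[OF m(2) that] by simp
    subgoal using tr[OF m(4) that] by simp
    subgoal using tr[OF m(5) that] by simp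
    subgoal using tr[OF m(7) that] by simp
    done
  show ?thesis
  proof (rule cringI)
    show "abelian_group S"
    proof (rule abelian_groupI)
      fix x assume "x \<in> carrier S"
      then show "\<exists>y\<in>carrier S. y \<oplus>\<^bsub>S\<^esub> x = \<zero>\<^bsub>S\<^esub>" using ax(4) by blast
    qed (rule cl(1) cl(3)[OF a a] ax(1,2,3); assumption?)+
    show "comm_monoid S"
      by (rule comm_monoidI) (rule cl(2) cl(4)[OF a a] mx(1,2,4); assumption?)+
  qed (rule mx(3))
qed

section \<open>Ultrafilters and the theorem of Los\<close>

text \<open>The equivalence is what the negation step of Los needs. It includes properness: for the
  constantly false \<open>P\<close> it says that \<open>F\<close> is not \<open>bot\<close>.\<close>

definition ultra :: "'i filter \<Rightarrow> bool" where
  "ultra F \<longleftrightarrow> (\<forall>P. (\<forall>\<^sub>F i in F. \<not> P i) \<longleftrightarrow> \<not> (\<forall>\<^sub>F i in F. P i))"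

text \<open>Finer filters are smaller, so ultrafilters are the minimal proper filters and Zorn's
  lemma is used for the reversed order. If \<open>P\<close> is not eventual, restricting a minimal
  \<open>U\<close> to the complement of \<open>P\<close> gives a proper filter, hence
  \<open>U\<close> itself.\<close>

lemma ultra_below:
  assumes "F \<noteq> bot"
  obtains U where "U \<le> F" "ultra U"
proof -
  let ?A = "{G. G \<le> F \<and> G \<noteq> bot}" and ?r = "\<lambda>G H :: 'a filter. H \<le> G"
  have "\<exists>U\<in>?A. \<forall>G\<in>?A. G \<le> U \<longrightarrow> G = U"
  proof (rule predicate_Zorn)
    show "partial_order_on ?A (relation_of ?r ?A)"
      by (rule partial_order_on_relation_ofI) auto
    fix C assume C: "C \<in> Chains (relation_of ?r ?A)"
    show "\<exists>u\<in>?A. \<forall>a\<in>C. u \<le> a"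
    proof (cases "C = {}")
      case True
      with assms show ?thesis by auto
    next
      case False
      have CA: "C \<subseteq> ?A" using C unfolding Chains_def relation_of_def by blast
      \<comment> \<open>Two members of a chain are comparable, so an event of \<open>Inf C\<close>
        is already an event of some member; properness thus passes to the infimum.\<close>
      have "\<exists>x\<in>C. x \<le> inf a b" if "a \<in> C" "b \<in> C" for a b
        using C that unfolding Chains_def relation_of_def by (auto simp: le_inf_iff)
      then have "eventually P (Inf C) \<longleftrightarrow> (\<exists>b\<in>C. eventually P b)" for P
        by (intro eventually_Inf_base[OF False])
      then have "Inf C \<noteq> bot" using CA by (auto simp: trivial_limit_def)
      moreover have "Inf C \<le> F" using CA False by (auto intro: Inf_lower2)
      ultimately show ?thesis by (auto intro: Inf_lower)
    qed
  qed
  then obtain U where U: "U \<le> F" "U \<noteq> bot" "\<And>G. G \<le> U \<Longrightarrow> G \<noteq> bot \<Longrightarrow> G = U"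
    by (auto intro: order_trans)
  have "(\<forall>\<^sub>F i in U. \<not> P i) \<longleftrightarrow> \<not> (\<forall>\<^sub>F i in U. P i)" for P
  proof
    assume "\<forall>\<^sub>F i in U. \<not> P i"
    with U(2) show "\<not> (\<forall>\<^sub>F i in U. P i)"
      using eventually_conj[of P U "\<lambda>i. \<not> P i"] by (auto simp: trivial_limit_def)
  next
    assume "\<not> (\<forall>\<^sub>F i in U. P i)"
    then have "inf U (principal {i. \<not> P i}) \<noteq> bot"
      by (auto simp: trivial_limit_def eventually_inf_principal)
    then have "inf U (principal {i. \<not> P i}) = U" by (intro U(3)) auto
    then show "\<forall>\<^sub>F i in U. \<not> P i"
      by (metis (mono_tags, lifting) eventually_inf_principal eventually_mono always_eventually mem_Collect_eq)
  qed
  with U(1) show ?thesis using that unfolding ultra_def by blast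
qed

lemma ultra_const: "ultra F \<Longrightarrow> (\<forall>\<^sub>F i in F. P) \<longleftrightarrow> P"
  unfolding ultra_def by (drule spec[of _ "\<lambda>_. P"]) (cases P; simp)

text \<open>The default \<open>m\<close> keeps the chosen family in \<open>M\<close> at every index
  and not just eventually, as \<open>left_total\<close> and \<open>right_total\<close> require
  below.\<close>

lemma ultra_ex:
  assumes "M \<noteq> {}" and ev: "\<forall>\<^sub>F i in F. \<exists>a\<in>M. P i a"
  obtains a where "\<And>i. a i \<in> M" "\<forall>\<^sub>F i in F. P i (a i)"
proof -
  obtain m where m: "m \<in> M" using assms by blast
  let ?a = "\<lambda>i. if \<exists>a\<in>M. P i a then SOME a. a \<in> M \<and> P i a else m"
  have a: "?a i \<in> M \<and> ((\<exists>a\<in>M. P i a) \<longrightarrow> P i (?a i))" for i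
    using m someI_ex[of "\<lambda>a. a \<in> M \<and> P i a"] by auto
  then have "\<forall>\<^sub>F i in F. P i (?a i)" using ev by (auto elim: eventually_mono)
  with a show ?thesis using that[of ?a] by blast
qed

text \<open>The theorem of Los on ultrapowers combined with the invariance of truth under isomorphism:
  \<open>Rel\<close> induces an isomorphism between the ultrapowers of \<open>M\<close> and of \<open>N\<close>.\<close>

locale ultrapower_iso =
  fixes F :: "'i filter" and M :: "'a set" and N :: "'b set"
    and teval :: "(nat \<Rightarrow> 'a) \<Rightarrow> 't \<Rightarrow> 'a" and teval' :: "(nat \<Rightarrow> 'b) \<Rightarrow> 't \<Rightarrow> 'b"
    and Rel :: "('i \<Rightarrow> 'a) \<Rightarrow> ('i \<Rightarrow> 'b) \<Rightarrow> bool"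
  assumes ultra: "ultra F"
    and nonempty: "M \<noteq> {}" "N \<noteq> {}"
    and Rel_in: "Rel g h \<Longrightarrow> g i \<in> M" "Rel g h \<Longrightarrow> h i \<in> N"
    and left_total: "(\<And>i. g i \<in> M) \<Longrightarrow> \<exists>h. Rel g h"
    and right_total: "(\<And>i. h i \<in> N) \<Longrightarrow> \<exists>g. Rel g h"
    and Rel_term: "(\<And>v. Rel (\<lambda>i. e i v) (\<lambda>i. e' i v)) \<Longrightarrow>
      Rel (\<lambda>i. teval (e i) t) (\<lambda>i. teval' (e' i) t)"
    and Rel_eq: "Rel g h \<Longrightarrow> Rel g' h' \<Longrightarrow> (\<forall>\<^sub>F i in F. g i = g' i) \<longleftrightarrow> (\<forall>\<^sub>F i in F. h i = h' i)"
begin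

text \<open>The family \<open>e i\<close> represents one assignment in the ultrapower. Negation uses
  that \<open>F\<close> is an ultrafilter; for a quantifier, witnesses are chosen index by index and
  moved to the other side by totality of \<open>Rel\<close>.\<close>

lemma holds_iff:
  "(\<And>v. Rel (\<lambda>i. e i v) (\<lambda>i. e' i v)) \<Longrightarrow>
     (\<forall>\<^sub>F i in F. holds M teval (e i) \<phi>) \<longleftrightarrow> (\<forall>\<^sub>F i in F. holds N teval' (e' i) \<phi>)"
proof (induction \<phi> arbitrary: e e')
  case (FEq s t)
  then show ?case using Rel_eq[OF Rel_term Rel_term, of e e' e e' s t] by simp
next
  case (FNeg \<phi>)
  then show ?case using ultra by (simp add: ultra_def)
next
  case (FConj \<phi> \<psi>)
  show ?case
    using FConj.IH(1)[OF FConj.prems] FConj.IH(2)[OF FConj.prems] by (simp add: eventually_conj_iff)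
next
  case (FEx v \<phi>)
  have IH: "(\<forall>\<^sub>F i in F. holds M teval ((e i)(v := a i)) \<phi>) \<longleftrightarrow>
      (\<forall>\<^sub>F i in F. holds N teval' ((e' i)(v := b i)) \<phi>)" if "Rel a b" for a b
  proof (rule FEx.IH)
    fix w show "Rel (\<lambda>i. ((e i)(v := a i)) w) (\<lambda>i. ((e' i)(v := b i)) w)"
      using FEx.prems[of w] that by (cases "w = v") simp_all
  qed
  show ?case
  proof
    assume "\<forall>\<^sub>F i in F. holds M teval (e i) (FEx v \<phi>)"
    then obtain a where a: "\<And>i. a i \<in> M" "\<forall>\<^sub>F i in F. holds M teval ((e i)(v := a i)) \<phi>"
      using ultra_ex[OF nonempty(1), of "\<lambda>i a. holds M teval ((e i)(v := a)) \<phi>" F] by auto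
    obtain b where b: "Rel a b" using left_total a(1) by blast
    have "\<forall>\<^sub>F i in F. holds N teval' ((e' i)(v := b i)) \<phi>" using IH[OF b] a(2) by blast
    then show "\<forall>\<^sub>F i in F. holds N teval' (e' i) (FEx v \<phi>)"
      unfolding holds.simps by (rule eventually_mono) (use Rel_in(2)[OF b] in blast)
  next
    assume "\<forall>\<^sub>F i in F. holds N teval' (e' i) (FEx v \<phi>)"
    then obtain b where b: "\<And>i. b i \<in> N" "\<forall>\<^sub>F i in F. holds N teval' ((e' i)(v := b i)) \<phi>"
      using ultra_ex[OF nonempty(2), of "\<lambda>i a. holds N teval' ((e' i)(v := a)) \<phi>" F] by auto
    obtain a where a: "Rel a b" using right_total b(1) by blast
    have "\<forall>\<^sub>F i in F. holds M teval ((e i)(v := a i)) \<phi>" using IH[OF a] b(2) by blast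
    then show "\<forall>\<^sub>F i in F. holds M teval (e i) (FEx v \<phi>)"
      unfolding holds.simps by (rule eventually_mono) (use Rel_in(1)[OF a] in blast)
  qed
qed

text \<open>Truth at a constant family is truth in the structure itself. The related family on the
  other side need not be constant, but \<open>\<phi>\<close> holds there at every index by
  assumption.\<close>

lemma models_iff:
  "(\<forall>e. range e \<subseteq> M \<longrightarrow> holds M teval e \<phi>) \<longleftrightarrow> (\<forall>e. range e \<subseteq> N \<longrightarrow> holds N teval' e \<phi>)"
proof (intro iffI allI impI)
  fix e' :: "nat \<Rightarrow> 'b" assume M: "\<forall>e. range e \<subseteq> M \<longrightarrow> holds M teval e \<phi>" and e': "range e' \<subseteq> N"
  have "\<exists>g. Rel g (\<lambda>_. e' v)" for v by (rule right_total) (rule range_subsetD[OF e'])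
  then obtain g where g: "\<And>v. Rel (g v) (\<lambda>_. e' v)" by metis
  have "holds M teval (\<lambda>v. g v i) \<phi>" for i
    by (rule M[rule_format]) (use Rel_in(1)[OF g] in \<open>simp add: image_subset_iff\<close>)
  then have "\<forall>\<^sub>F i in F. holds N teval' e' \<phi>"
    by (subst holds_iff[of "\<lambda>i v. g v i", symmetric]) (simp_all add: g)
  then show "holds N teval' e' \<phi>" using ultra_const[OF ultra] by simp
next
  fix e :: "nat \<Rightarrow> 'a" assume N: "\<forall>e. range e \<subseteq> N \<longrightarrow> holds N teval' e \<phi>" and e: "range e \<subseteq> M"
  have "\<exists>h. Rel (\<lambda>_. e v) h" for v by (rule left_total) (rule range_subsetD[OF e])
  then obtain h where h: "\<And>v. Rel (\<lambda>_. e v) (h v)" by metis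
  have "holds N teval' (\<lambda>v. h v i) \<phi>" for i
    by (rule N[rule_format]) (use Rel_in(2)[OF h] in \<open>simp add: image_subset_iff\<close>)
  then have "\<forall>\<^sub>F i in F. holds M teval e \<phi>"
    by (subst holds_iff[of _ "\<lambda>i v. h v i"]) (simp_all add: h)
  then show "holds M teval e \<phi>" using ultra_const[OF ultra] by simp
qed

end

section \<open>Triangular matrices over a commutative ring\<close>

lemma (in abelian_monoid) finsum_eq_single:
  assumes "finite A" "i \<in> A" "f i \<in> carrier G" "\<And>k. k \<in> A \<Longrightarrow> k \<noteq> i \<Longrightarrow> f k = \<zero>"
  shows "finsum G f A = f i"
proof -
  have "finsum G f A = (\<Oplus>k\<in>A. if i = k then (\<lambda>_. f i) k else \<zero>)"
    by (rule finsum_cong') (use assms in auto)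
  also have "\<dots> = f i" by (rule finsum_singleton) (use assms in auto)
  finally show ?thesis .
qed

locale matrices_over_cring = cring R for R (structure) + fixes n :: nat
begin

definition diag_of :: "(nat \<Rightarrow> 'a) \<Rightarrow> 'a mat" where
  "diag_of d = mat n n (\<lambda>(i, j). if i = j then d i else \<zero>)"

abbreviation \<MM> where "\<MM> \<equiv> matrix_monoid R n"
abbreviation \<TT> where "\<TT> \<equiv> T_group R n"
abbreviation \<UU> where "\<UU> \<equiv> UT_group R n"

lemma mem_MM: "M \<in> carrier \<MM> \<longleftrightarrow> M \<in> carrier_mat n n \<and> (\<forall>i<n. \<forall>j<n. M $$ (i, j) \<in> carrier R)"
  unfolding matrix_monoid_def elements_mat_def by force

lemma MM_entry: "M \<in> carrier \<MM> \<Longrightarrow> i < n \<Longrightarrow> j < n \<Longrightarrow> M $$ (i, j) \<in> carrier R"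
  by (simp add: mem_MM)

lemma MM_eqI:
  assumes "M \<in> carrier \<MM>" "N \<in> carrier \<MM>"
    and "\<And>i j. i < n \<Longrightarrow> j < n \<Longrightarrow> M $$ (i, j) = N $$ (i, j)"
  shows "M = N"
  by (rule eq_matI) (use assms in \<open>auto simp: mem_MM\<close>)

lemma MM_mult: "i < n \<Longrightarrow> j < n \<Longrightarrow>
    (M \<otimes>\<^bsub>\<MM>\<^esub> N) $$ (i, j) = (\<Oplus>k\<in>{..<n}. M $$ (i, k) \<otimes> N $$ (k, j))"
  by (simp add: matrix_monoid_def)

lemma MM_one: "i < n \<Longrightarrow> j < n \<Longrightarrow> \<one>\<^bsub>\<MM>\<^esub> $$ (i, j) = (if i = j then \<one> else \<zero>)"
  by (simp add: matrix_monoid_def)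

lemma MM_one_diag: "\<one>\<^bsub>\<MM>\<^esub> = diag_of (\<lambda>_. \<one>)"
  by (simp add: matrix_monoid_def diag_of_def)

lemma MM_mult_closed [intro]:
  assumes "M \<in> carrier \<MM>" "N \<in> carrier \<MM>" shows "M \<otimes>\<^bsub>\<MM>\<^esub> N \<in> carrier \<MM>"
  unfolding mem_MM
proof (intro conjI allI impI)
  show "M \<otimes>\<^bsub>\<MM>\<^esub> N \<in> carrier_mat n n" by (simp add: matrix_monoid_def)
  fix i j assume "i < n" "j < n"
  then show "(M \<otimes>\<^bsub>\<MM>\<^esub> N) $$ (i, j) \<in> carrier R"
    using assms by (auto simp: MM_mult mem_MM intro!: finsum_closed)
qed

lemma diag_of_entry: "i < n \<Longrightarrow> j < n \<Longrightarrow> diag_of d $$ (i, j) = (if i = j then d i else \<zero>)"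
  by (simp add: diag_of_def)

lemma diag_of_MM: "(\<And>i. i < n \<Longrightarrow> d i \<in> carrier R) \<Longrightarrow> diag_of d \<in> carrier \<MM>"
  by (auto simp: mem_MM diag_of_entry) (simp add: diag_of_def)

lemma mult_diag_right:
  assumes "M \<in> carrier \<MM>" "\<And>i. i < n \<Longrightarrow> d i \<in> carrier R" "i < n" "j < n"
  shows "(M \<otimes>\<^bsub>\<MM>\<^esub> diag_of d) $$ (i, j) = M $$ (i, j) \<otimes> d j"
proof -
  have "(M \<otimes>\<^bsub>\<MM>\<^esub> diag_of d) $$ (i, j) = M $$ (i, j) \<otimes> diag_of d $$ (j, j)"
    unfolding MM_mult[OF assms(3,4)]
    by (rule finsum_eq_single) (use assms in \<open>auto simp: mem_MM diag_of_entry\<close>)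
  with assms show ?thesis by (simp add: diag_of_entry)
qed

lemma mult_diag_left:
  assumes "M \<in> carrier \<MM>" "\<And>i. i < n \<Longrightarrow> d i \<in> carrier R" "i < n" "j < n"
  shows "(diag_of d \<otimes>\<^bsub>\<MM>\<^esub> M) $$ (i, j) = d i \<otimes> M $$ (i, j)"
proof -
  have "(diag_of d \<otimes>\<^bsub>\<MM>\<^esub> M) $$ (i, j) = diag_of d $$ (i, i) \<otimes> M $$ (i, j)"
    unfolding MM_mult[OF assms(3,4)]
    by (rule finsum_eq_single) (use assms in \<open>auto simp: mem_MM diag_of_entry\<close>)
  with assms show ?thesis by (simp add: diag_of_entry)
qed

sublocale MM: monoid \<MM>
proof (rule monoidI)
  show one: "\<one>\<^bsub>\<MM>\<^esub> \<in> carrier \<MM>" unfolding MM_one_diag by (rule diag_of_MM) simp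
  fix L assume L: "L \<in> carrier \<MM>"
  show "\<one>\<^bsub>\<MM>\<^esub> \<otimes>\<^bsub>\<MM>\<^esub> L = L"
    by (rule MM_eqI) (use L one in \<open>auto simp: MM_one_diag mult_diag_left MM_entry\<close>)
  show "L \<otimes>\<^bsub>\<MM>\<^esub> \<one>\<^bsub>\<MM>\<^esub> = L"
    by (rule MM_eqI) (use L one in \<open>auto simp: MM_one_diag mult_diag_right MM_entry\<close>)
  fix M N assume M: "M \<in> carrier \<MM>" and N: "N \<in> carrier \<MM>"
  show "L \<otimes>\<^bsub>\<MM>\<^esub> M \<in> carrier \<MM>" using L M by (rule MM_mult_closed)
  show "L \<otimes>\<^bsub>\<MM>\<^esub> M \<otimes>\<^bsub>\<MM>\<^esub> N = L \<otimes>\<^bsub>\<MM>\<^esub> (M \<otimes>\<^bsub>\<MM>\<^esub> N)"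
  proof (rule MM_eqI)
    fix i j assume ij: "i < n" "j < n"
    have "(L \<otimes>\<^bsub>\<MM>\<^esub> M \<otimes>\<^bsub>\<MM>\<^esub> N) $$ (i, j) =
        (\<Oplus>k\<in>{..<n}. (\<Oplus>l\<in>{..<n}. L $$ (i, l) \<otimes> M $$ (l, k)) \<otimes> N $$ (k, j))"
      unfolding MM_mult[OF ij]
      by (rule finsum_cong) (use ij in \<open>auto simp: MM_mult simp_implies_def Pi_def
        MM_entry[OF L] MM_entry[OF M] MM_entry[OF N] intro!: finsum_closed m_closed\<close>)
    also have "\<dots> = (\<Oplus>k\<in>{..<n}. \<Oplus>l\<in>{..<n}. L $$ (i, l) \<otimes> M $$ (l, k) \<otimes> N $$ (k, j))"
      by (rule finsum_cong) (use ij in \<open>auto simp: simp_implies_def Pi_def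
        MM_entry[OF L] MM_entry[OF M] MM_entry[OF N] intro!: finsum_closed m_closed finsum_ldistr\<close>)
    also have "\<dots> = (\<Oplus>l\<in>{..<n}. \<Oplus>k\<in>{..<n}. L $$ (i, l) \<otimes> M $$ (l, k) \<otimes> N $$ (k, j))"
      by (rule finsum_finsum_swap) (use ij in \<open>auto simp:
        MM_entry[OF L] MM_entry[OF M] MM_entry[OF N] intro!: m_closed\<close>)
    also have "\<dots> = (\<Oplus>l\<in>{..<n}. L $$ (i, l) \<otimes> (\<Oplus>k\<in>{..<n}. M $$ (l, k) \<otimes> N $$ (k, j)))"
    proof -
      have "(\<Oplus>k\<in>{..<n}. L $$ (i, l) \<otimes> M $$ (l, k) \<otimes> N $$ (k, j)) =
          L $$ (i, l) \<otimes> (\<Oplus>k\<in>{..<n}. M $$ (l, k) \<otimes> N $$ (k, j))" if "l \<in> {..<n}" for l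
        using that ij
        by (subst finsum_rdistr) (auto simp: Pi_def MM_entry[OF L] MM_entry[OF M] MM_entry[OF N]
          m_assoc intro!: finsum_cong' m_closed)
      then show ?thesis
        by (intro finsum_cong) (use ij in \<open>auto simp: simp_implies_def Pi_def
          MM_entry[OF L] MM_entry[OF M] MM_entry[OF N] intro!: finsum_closed m_closed\<close>)
    qed
    also have "\<dots> = (L \<otimes>\<^bsub>\<MM>\<^esub> (M \<otimes>\<^bsub>\<MM>\<^esub> N)) $$ (i, j)"
      unfolding MM_mult[OF ij]
      by (rule finsum_cong) (use ij in \<open>auto simp: MM_mult simp_implies_def Pi_def
        MM_entry[OF L] MM_entry[OF M] MM_entry[OF N] intro!: finsum_closed m_closed\<close>)
    finally show "(L \<otimes>\<^bsub>\<MM>\<^esub> M \<otimes>\<^bsub>\<MM>\<^esub> N) $$ (i, j) = (L \<otimes>\<^bsub>\<MM>\<^esub> (M \<otimes>\<^bsub>\<MM>\<^esub> N)) $$ (i, j)" .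
  qed (use L M N in auto)
qed


definition upper where "upper M \<longleftrightarrow> (\<forall>i<n. \<forall>j<i. M $$ (i, j) = \<zero>)"

text \<open>The term with index \<open>k\<close> in the entry at \<open>(i, j)\<close> can be
  nonzero only for \<open>i \<le> k \<le> j\<close>: there is no such \<open>k\<close> below the
  diagonal and exactly one on it.\<close>

lemma upper_mult:
  assumes "M \<in> carrier \<MM>" "N \<in> carrier \<MM>" "upper M" "upper N"
  shows "upper (M \<otimes>\<^bsub>\<MM>\<^esub> N)"
    and "i < n \<Longrightarrow> (M \<otimes>\<^bsub>\<MM>\<^esub> N) $$ (i, i) = M $$ (i, i) \<otimes> N $$ (i, i)"
proof -
  have 0: "M $$ (i, k) \<otimes> N $$ (k, j) = \<zero>"
    if "i < n" "k < n" "j < n" "k < i \<or> j < k" for i j k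
    using that assms by (auto simp: upper_def MM_entry)
  show "upper (M \<otimes>\<^bsub>\<MM>\<^esub> N)"
    unfolding upper_def
  proof (intro allI impI)
    fix i j assume "i < n" "j < i"
    then show "(M \<otimes>\<^bsub>\<MM>\<^esub> N) $$ (i, j) = \<zero>"
      by (subst MM_mult) (auto intro!: add.finprod_one_eqI 0)
  qed
  show "(M \<otimes>\<^bsub>\<MM>\<^esub> N) $$ (i, i) = M $$ (i, i) \<otimes> N $$ (i, i)" if "i < n"
    unfolding MM_mult[OF that that]
    by (rule finsum_eq_single) (use assms that in \<open>auto simp: MM_entry intro!: 0\<close>)
qed

text \<open>The rows of the inverse are determined from the last one upwards.\<close>

lemma upper_inverse:
  assumes M: "M \<in> carrier \<MM>" and N: "N \<in> carrier \<MM>" and "upper M"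
    and MN: "M \<otimes>\<^bsub>\<MM>\<^esub> N = \<one>\<^bsub>\<MM>\<^esub>"
  shows "upper N" and "i < n \<Longrightarrow> M $$ (i, i) \<otimes> N $$ (i, i) = \<one>"
proof -
  have *: "M $$ (i, i) \<otimes> N $$ (i, i) = \<one> \<and> (\<forall>j<i. N $$ (i, j) = \<zero>)" if "i < n" for i
    using that
  proof (induction "n - i" arbitrary: i rule: less_induct)
    case less
    have N0: "N $$ (k, j) = \<zero>" if "i < k" "k < n" "j < k" for j k
      using less.hyps[of k] that less.prems by auto
    \<comment> \<open>Only the term with \<open>k = i\<close> survives: those with
      \<open>k < i\<close> vanish because \<open>M\<close> is upper triangular, those with
      \<open>k > i\<close> because row \<open>k\<close> of \<open>N\<close> is already known to
      vanish left of the diagonal.\<close>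
    have eq: "M $$ (i, i) \<otimes> N $$ (i, j) = (if i = j then \<one> else \<zero>)" if "j \<le> i" for j
    proof -
      have "M $$ (i, k) \<otimes> N $$ (k, j) = \<zero>" if "k < n" "k \<noteq> i" for k
      proof (cases "k < i")
        case True
        with \<open>upper M\<close> less.prems that \<open>j \<le> i\<close> show ?thesis
          using MM_entry[OF N] by (auto simp: upper_def)
      next
        case False
        then show ?thesis
          using N0[of k j] that \<open>j \<le> i\<close> less.prems MM_entry[OF M] by auto
      qed
      then have "(M \<otimes>\<^bsub>\<MM>\<^esub> N) $$ (i, j) = M $$ (i, i) \<otimes> N $$ (i, j)"
        using less.prems that MM_entry[OF M] MM_entry[OF N]
        by (subst MM_mult) (auto intro!: finsum_eq_single)
      then show ?thesis using MN less.prems that by (simp add: MM_one)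
    qed
    \<comment> \<open>\<open>eq\<close> for the diagonal makes \<open>N $$ (i, i)\<close> the
      inverse of \<open>M $$ (i, i)\<close>, and multiplying by it cancels that entry.\<close>
    have "N $$ (i, j) = \<zero>" if "j < i" for j
    proof -
      have c: "N $$ (i, i) \<in> carrier R" "M $$ (i, i) \<in> carrier R" "N $$ (i, j) \<in> carrier R"
        using less.prems that MM_entry[OF M] MM_entry[OF N] by auto
      have "N $$ (i, j) = (M $$ (i, i) \<otimes> N $$ (i, i)) \<otimes> N $$ (i, j)"
        using eq[of i] c by simp
      also have "\<dots> = N $$ (i, i) \<otimes> (M $$ (i, i) \<otimes> N $$ (i, j))"
        using c by (simp add: m_ac)
      also have "\<dots> = \<zero>" using eq[of j] that c by simp
      finally show ?thesis .
    qed
    with eq[of i] show ?case by simp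
  qed
  show "upper N" using * by (auto simp: upper_def)
  show "i < n \<Longrightarrow> M $$ (i, i) \<otimes> N $$ (i, i) = \<one>" using * by blast
qed

lemma TT_simps [simp]: "M \<otimes>\<^bsub>\<TT>\<^esub> N = M \<otimes>\<^bsub>\<MM>\<^esub> N" "\<one>\<^bsub>\<TT>\<^esub> = \<one>\<^bsub>\<MM>\<^esub>"
  by (simp_all add: T_group_def GL_def units_of_def)

lemma mem_TT: "M \<in> carrier \<TT> \<longleftrightarrow> M \<in> Units \<MM> \<and> upper M"
  by (simp add: T_group_def GL_def units_of_def upper_def)

lemma mem_TT_iff:
  "M \<in> carrier \<TT> \<longleftrightarrow> M \<in> carrier \<MM> \<and> upper M \<and>
     (\<exists>N\<in>carrier \<MM>. M \<otimes>\<^bsub>\<MM>\<^esub> N = \<one>\<^bsub>\<MM>\<^esub> \<and> N \<otimes>\<^bsub>\<MM>\<^esub> M = \<one>\<^bsub>\<MM>\<^esub>)"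
  by (auto simp: mem_TT Units_def)

lemma TT_MM: "M \<in> carrier \<TT> \<Longrightarrow> M \<in> carrier \<MM>" and TT_upper: "M \<in> carrier \<TT> \<Longrightarrow> upper M"
  by (auto simp: mem_TT_iff)

lemma GL_group: "group (GL R n)"
  unfolding GL_def by (rule MM.units_group)

text \<open>The group is cut out of \<open>GL\<close> by a condition on entries; that inverting
  preserves it is \<open>upper_inverse\<close>.\<close>

lemma TT_subgroup: "subgroup (carrier \<TT>) (GL R n)"
proof -
  interpret GL: group "GL R n" by (rule GL_group)
  have GLs: "carrier (GL R n) = Units \<MM>" "\<And>M N. M \<otimes>\<^bsub>GL R n\<^esub> N = M \<otimes>\<^bsub>\<MM>\<^esub> N"
      "\<one>\<^bsub>GL R n\<^esub> = \<one>\<^bsub>\<MM>\<^esub>"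
    by (auto simp: GL_def units_of_def)
  show ?thesis
  proof (rule GL.subgroupI)
    show "carrier \<TT> \<subseteq> carrier (GL R n)" by (auto simp: mem_TT GLs)
    have "upper \<one>\<^bsub>\<MM>\<^esub>" by (auto simp: upper_def MM_one)
    then show "carrier \<TT> \<noteq> {}" using mem_TT by auto
    fix M assume M: "M \<in> carrier \<TT>"
    have inv: "inv\<^bsub>GL R n\<^esub> M = inv\<^bsub>\<MM>\<^esub> M"
      using M by (simp add: GL_def MM.units_of_inv mem_TT)
    have "M \<otimes>\<^bsub>\<MM>\<^esub> inv\<^bsub>\<MM>\<^esub> M = \<one>\<^bsub>\<MM>\<^esub>" "inv\<^bsub>\<MM>\<^esub> M \<in> carrier \<MM>"
      using M by (auto simp: mem_TT)
    then show "inv\<^bsub>GL R n\<^esub> M \<in> carrier \<TT>"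
      using M upper_inverse(1)[of M "inv\<^bsub>\<MM>\<^esub> M"] by (auto simp: inv mem_TT)
    fix N assume "N \<in> carrier \<TT>"
    with M show "M \<otimes>\<^bsub>GL R n\<^esub> N \<in> carrier \<TT>"
      using upper_mult(1)[of M N] by (auto simp: GLs mem_TT)
  qed
qed

sublocale TT: group \<TT>
proof -
  have "\<TT> = (GL R n)\<lparr>carrier := carrier \<TT>\<rparr>" by (simp add: T_group_def)
  with subgroup.subgroup_is_group[OF TT_subgroup GL_group] show "group \<TT>" by simp
qed

lemma TT_inv: "M \<in> carrier \<TT> \<Longrightarrow> inv\<^bsub>GL R n\<^esub> M = inv\<^bsub>\<TT>\<^esub> M"
  using group.m_inv_consistent[OF GL_group TT_subgroup] by (simp add: T_group_def)

lemma TT_mult_diag_entry: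
  "M \<in> carrier \<TT> \<Longrightarrow> N \<in> carrier \<TT> \<Longrightarrow> i < n \<Longrightarrow>
     (M \<otimes>\<^bsub>\<MM>\<^esub> N) $$ (i, i) = M $$ (i, i) \<otimes> N $$ (i, i)"
  by (rule upper_mult(2)) (auto intro: TT_MM TT_upper)

lemma TT_diag_Units:
  assumes "M \<in> carrier \<TT>" "i < n" shows "M $$ (i, i) \<in> Units R"
proof -
  obtain N where N: "N \<in> carrier \<MM>" "M \<otimes>\<^bsub>\<MM>\<^esub> N = \<one>\<^bsub>\<MM>\<^esub>"
    using assms by (auto simp: mem_TT_iff)
  then have "M $$ (i, i) \<otimes> N $$ (i, i) = \<one>"
    using upper_inverse(2)[of M N] assms TT_MM TT_upper by blast
  moreover have "M $$ (i, i) \<in> carrier R" "N $$ (i, i) \<in> carrier R"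
    using assms N(1) by (auto intro: MM_entry TT_MM)
  ultimately show ?thesis
    using m_comm[of "M $$ (i, i)" "N $$ (i, i)"] by (auto simp: Units_def)
qed

lemma diag_of_mult:
  assumes "\<And>i. i < n \<Longrightarrow> d i \<in> carrier R" "\<And>i. i < n \<Longrightarrow> d' i \<in> carrier R"
  shows "diag_of d \<otimes>\<^bsub>\<MM>\<^esub> diag_of d' = diag_of (\<lambda>i. d i \<otimes> d' i)"
  by (rule MM_eqI) (use assms in \<open>auto simp: mult_diag_right diag_of_entry diag_of_MM\<close>)

lemma diag_of_cong: "(\<And>i. i < n \<Longrightarrow> d i = d' i) \<Longrightarrow> diag_of d = diag_of d'"
  unfolding diag_of_def by (rule eq_matI) auto

lemma diag_of_TT:
  assumes "\<And>i. i < n \<Longrightarrow> d i \<in> Units R" shows "diag_of d \<in> carrier \<TT>"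
proof -
  have "diag_of d \<otimes>\<^bsub>\<MM>\<^esub> diag_of (\<lambda>i. inv d i) = \<one>\<^bsub>\<MM>\<^esub>"
      "diag_of (\<lambda>i. inv d i) \<otimes>\<^bsub>\<MM>\<^esub> diag_of d = \<one>\<^bsub>\<MM>\<^esub>"
    using assms by (simp_all add: diag_of_mult MM_one_diag Units_closed cong: diag_of_cong)
  moreover have "upper (diag_of d)" by (auto simp: upper_def diag_of_entry)
  ultimately show ?thesis
    using assms diag_of_MM[of d] diag_of_MM[of "\<lambda>i. inv d i"]
    by (auto simp: mem_TT_iff intro!: bexI[of _ "diag_of (\<lambda>i. inv d i)"])
qed

definition scalar_mat :: "'a \<Rightarrow> 'a mat" where
  "scalar_mat z = diag_of (\<lambda>_. z)"

lemma scalar_mat_TT: "z \<in> Units R \<Longrightarrow> scalar_mat z \<in> carrier \<TT>"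
  unfolding scalar_mat_def by (rule diag_of_TT)

lemma scalar_mat_mult:
  "z \<in> carrier R \<Longrightarrow> w \<in> carrier R \<Longrightarrow> scalar_mat z \<otimes>\<^bsub>\<MM>\<^esub> scalar_mat w = scalar_mat (z \<otimes> w)"
  by (simp add: scalar_mat_def diag_of_mult)

lemma scalar_mat_commute:
  assumes "z \<in> carrier R" "M \<in> carrier \<MM>"
  shows "scalar_mat z \<otimes>\<^bsub>\<MM>\<^esub> M = M \<otimes>\<^bsub>\<MM>\<^esub> scalar_mat z"
proof (rule MM_eqI)
  show "scalar_mat z \<otimes>\<^bsub>\<MM>\<^esub> M \<in> carrier \<MM>" "M \<otimes>\<^bsub>\<MM>\<^esub> scalar_mat z \<in> carrier \<MM>"
    using assms by (auto simp: scalar_mat_def diag_of_MM)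
  fix i j assume "i < n" "j < n"
  with assms show "(scalar_mat z \<otimes>\<^bsub>\<MM>\<^esub> M) $$ (i, j) = (M \<otimes>\<^bsub>\<MM>\<^esub> scalar_mat z) $$ (i, j)"
    unfolding scalar_mat_def
    by (subst mult_diag_left, simp_all, subst mult_diag_right, simp_all) (rule m_comm; simp add: MM_entry)
qed

end

section \<open>Torsion-free abelian groups, isolators and complements\<close>

definition torsion_free :: "('a, 'm) monoid_scheme \<Rightarrow> bool" where
  "torsion_free G \<longleftrightarrow> (\<forall>x\<in>carrier G. \<forall>m::nat. 0 < m \<longrightarrow> x [^]\<^bsub>G\<^esub> m = \<one>\<^bsub>G\<^esub> \<longrightarrow> x = \<one>\<^bsub>G\<^esub>)"

text \<open>For a subgroup \<open>H\<close> of an abelian group this says that the quotient by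
  \<open>H\<close> is torsion-free; the formulation through powers avoids forming the
  quotient.\<close>

definition isolated :: "('a, 'm) monoid_scheme \<Rightarrow> 'a set \<Rightarrow> bool" where
  "isolated G H \<longleftrightarrow> (\<forall>x\<in>carrier G. \<forall>m::nat. 0 < m \<longrightarrow> x [^]\<^bsub>G\<^esub> m \<in> H \<longrightarrow> x \<in> H)"

lemma set_multI: "h \<in> H \<Longrightarrow> k \<in> K \<Longrightarrow> h \<otimes>\<^bsub>G\<^esub> k \<in> H <#>\<^bsub>G\<^esub> K"
  unfolding set_mult_def by blast

lemma set_multE:
  assumes "x \<in> H <#>\<^bsub>G\<^esub> K"
  obtains h k where "h \<in> H" "k \<in> K" "x = h \<otimes>\<^bsub>G\<^esub> k"
  using assms unfolding set_mult_def by blast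

lemma (in group) subgroup_nat_pow: "subgroup H G \<Longrightarrow> x \<in> H \<Longrightarrow> x [^] (k :: nat) \<in> H"
  by (induction k) (simp_all add: subgroup.one_closed subgroup.m_closed)

lemma (in comm_group) torsion_free_int:
  assumes "torsion_free G" "x \<in> carrier G" "x [^] (j::int) = \<one>" "j \<noteq> 0"
  shows "x = \<one>"
proof -
  have *: "x [^] k = \<one>" if "j = int k \<or> j = - int k" for k
    using that
  proof
    assume "j = int k"
    with assms(3) show ?thesis by (simp only: int_pow_int)
  next
    assume "j = - int k"
    with assms(2,3) have "inv (x [^] k) = \<one>" by (simp only: int_pow_neg_int)
    then have "inv (inv (x [^] k)) = \<one>" by (simp only: inv_one)
    then show ?thesis using assms(2) by simp
  qed
  have "x [^] nat \<bar>j\<bar> = \<one>" by (rule *) linarith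
  moreover have "0 < nat \<bar>j\<bar>" using assms(4) by simp
  ultimately show ?thesis using assms(1,2) unfolding torsion_free_def by blast
qed

text \<open>\<open>{y. y\<^sup>m \<in> \<langle>x\<rangle>}\<close> is cyclic: a generator is a root of the least positive power of \<open>x\<close> that
  is an \<open>m\<close>-th power.\<close>

lemma (in comm_group) cyclic_roots:
  assumes tf: "torsion_free G" and x: "x \<in> carrier G" and m: "0 < (m::nat)"
  obtains x' and r :: nat where "x' \<in> carrier G" "0 < r" "x' [^] r = x"
    and "\<And>y i::int. y \<in> carrier G \<Longrightarrow> y [^] m = x [^] i \<Longrightarrow> \<exists>j::int. y = x' [^] j"
proof -
  let ?P = "\<lambda>j::nat. 0 < j \<and> (\<exists>y\<in>carrier G. y [^] m = x [^] j)"
  define j where "j = (LEAST j. ?P j)"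
  have "?P m" using x m by blast
  then have "?P j" unfolding j_def by (rule LeastI)
  then obtain x' where x': "x' \<in> carrier G" "x' [^] m = x [^] j" and j: "0 < j" by blast
  \<comment> \<open>Division with remainder: the \<open>i\<close> for which \<open>x [^] i\<close>
    is an \<open>m\<close>-th power form a subgroup of the integers, and \<open>j\<close> generates
    it. Roots are unique in a torsion-free group, so \<open>y\<close> is the power of
    \<open>x'\<close> given by the quotient.\<close>
  have key: "i mod int j = 0 \<and> y = x' [^] (i div int j)"
    if y: "y \<in> carrier G" and eq: "y [^] m = x [^] (i::int)" for y i
  proof -
    define q s where "q = i div int j" and "s = i mod int j"
    define z where "z = y \<otimes> inv (x' [^] q)"
    have z: "z \<in> carrier G" using y x' by (simp add: z_def)
    have "(x' [^] q) [^] int m = (x' [^] int m) [^] q"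
      using x' by (simp only: int_pow_pow mult.commute)
    also have "\<dots> = x [^] (int j * q)"
      using x' x by (simp only: int_pow_int) (metis int_pow_int int_pow_pow)
    finally have "z [^] int m = x [^] i \<otimes> inv (x [^] (int j * q))"
      using y x' eq by (simp only: z_def int_pow_distrib int_pow_inv int_pow_closed inv_closed)
        (simp only: int_pow_int)
    also have "\<dots> = x [^] s"
      using x by (simp only: int_pow_diff[symmetric]) (simp add: s_def q_def minus_mult_div_eq_mod)
    finally have zm: "z [^] m = x [^] s" by (simp only: int_pow_int)
    have s: "0 \<le> s" "s < int j" using j by (auto simp: s_def)
    have "nat s = 0"
    proof (rule ccontr)
      assume "nat s \<noteq> 0"
      moreover have "z [^] m = x [^] nat s" using zm s by (metis int_pow_int nat_0_le)
      ultimately have "?P (nat s)" using z by auto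
      then have "j \<le> nat s" unfolding j_def by (rule Least_le)
      with s show False by simp
    qed
    with s have s0: "s = 0" by simp
    with zm have "z [^] m = \<one>" by simp
    with tf z m have "z = \<one>" unfolding torsion_free_def by blast
    then have "y = x' [^] q"
      using y x' unfolding z_def by (metis int_pow_closed inv_closed inv_equality inv_inv)
    with s0 show ?thesis by (simp add: q_def s_def)
  qed
  \<comment> \<open>\<open>x\<close> is itself an \<open>m\<close>-th root of
    \<open>x [^] m\<close>; hence \<open>j\<close> divides \<open>m\<close>, and \<open>x\<close> is
    a power of \<open>x'\<close> with exponent \<open>m div j\<close>.\<close>
  define r where "r = m div j"
  have "int m mod int j = 0 \<and> x = x' [^] (int m div int j)"
    using key[OF x, of "int m"] by (simp add: int_pow_int)
  then have dvd: "j dvd m" and "x = x' [^] int r"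
    by (auto simp: r_def zdiv_int simp flip: zmod_int)
  then have "x' [^] r = x" by (simp add: int_pow_int)
  moreover have "0 < r" using dvd m j by (auto simp: r_def dvd_def)
  ultimately show ?thesis using that[of x' r] x'(1) key by blast
qed

text \<open>The isolator of a cyclic subgroup is the union of an increasing sequence of cyclic subgroups.\<close>

lemma (in comm_group) isolator_chain:
  assumes tf: "torsion_free G" and e0: "e0 \<in> carrier G"
  obtains e and r :: "nat \<Rightarrow> nat" where "e 0 = e0" "\<And>k. e k \<in> carrier G" "\<And>k. 0 < r k"
    "\<And>k. e (Suc k) [^] r k = e k"
    "\<And>y (m::nat) k (i::int). y \<in> carrier G \<Longrightarrow> 0 < m \<Longrightarrow> y [^] m = e k [^] i \<Longrightarrow>
       \<exists>k' (j::int). y = e k' [^] j"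
proof -
  \<comment> \<open>Stage \<open>k\<close> adjoins the roots of exponent \<open>Suc k\<close>; the
    shift keeps the exponent positive.\<close>
  let ?Q = "\<lambda>k x x' (r::nat). 0 < r \<and> x' [^] r = x \<and>
      (\<forall>y (i::int). y \<in> carrier G \<longrightarrow> y [^] Suc k = x [^] i \<longrightarrow> (\<exists>j::int. y = x' [^] j))"
  have "\<exists>e. \<forall>k. (e k \<in> carrier G \<and> (k = 0 \<longrightarrow> e k = e0)) \<and> (\<exists>r. ?Q k (e k) (e (Suc k)) r)"
  proof (rule dependent_nat_choice)
    show "\<exists>x. x \<in> carrier G \<and> ((0::nat) = 0 \<longrightarrow> x = e0)" using e0 by blast
    fix x and k :: nat assume "x \<in> carrier G \<and> (k = 0 \<longrightarrow> x = e0)"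
    then show "\<exists>x'. (x' \<in> carrier G \<and> (Suc k = 0 \<longrightarrow> x' = e0)) \<and> (\<exists>r. ?Q k x x' r)"
      by (metis cyclic_roots[OF tf, of x "Suc k"] nat.distinct(1) zero_less_Suc)
  qed
  then obtain e where e: "\<And>k. e k \<in> carrier G" "e 0 = e0" and "\<And>k. \<exists>r. ?Q k (e k) (e (Suc k)) r"
    by blast
  then obtain r where r: "\<And>k. 0 < r k" "\<And>k. e (Suc k) [^] (r k :: nat) = e k"
      and Q: "\<And>k y (i::int). y \<in> carrier G \<Longrightarrow> y [^] Suc k = e k [^] i \<Longrightarrow> \<exists>j::int. y = e (Suc k) [^] j"
    by metis
  have R: "\<exists>t::nat. 0 < t \<and> e k [^] t = e 0" for k
  proof (induction k)
    case 0
    show ?case using e e0 by (intro exI[of _ 1]) simp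
  next
    case (Suc k)
    then obtain t :: nat where "0 < t" "e k [^] t = e 0" by blast
    then show ?case using r[of k] e by (intro exI[of _ "r k * t"]) (simp flip: nat_pow_pow)
  qed
  have "\<exists>k' (j::int). y = e k' [^] j"
    if y: "y \<in> carrier G" and m: "0 < (m::nat)" and eq: "y [^] m = e k [^] (i::int)" for y m k i
  proof -
    \<comment> \<open>Stage \<open>m - 1\<close>, which deals with the exponent \<open>m\<close>,
      may precede stage \<open>k\<close>. So the equation is raised to the power \<open>t\<close>,
      which turns its right side into a power of \<open>e 0\<close> and hence of every
      \<open>e l\<close>; stage \<open>l\<close> with \<open>Suc l = m * t\<close> then
      applies.\<close>
    obtain t :: nat where t: "0 < t" "e k [^] t = e 0" using R by blast
    obtain l where l: "m * t = Suc l" using m t(1) by (metis gr0_implies_Suc nat_0_less_mult_iff)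
    obtain u :: nat where u: "e l [^] u = e 0" using R by blast
    have "y [^] Suc l = (y [^] m) [^] t" using y by (simp only: l[symmetric] nat_pow_pow)
    also have "\<dots> = (e k [^] i) [^] int t" by (simp only: eq int_pow_int)
    also have "\<dots> = (e k [^] int t) [^] i" using e by (simp only: int_pow_pow mult.commute)
    also have "\<dots> = (e l [^] int u) [^] i" by (simp only: int_pow_int t u)
    also have "\<dots> = e l [^] (int u * i)" using e by (simp only: int_pow_pow)
    finally show ?thesis using Q[OF y] by blast
  qed
  with that[of e r] e r show ?thesis by blast
qed


text \<open>That the equations for the \<open>a k\<close> are solvable expresses that \<open>A / N\<close> is cotorsion.\<close>

lemma (in comm_group) enlarge_complement:
  assumes sub: "subgroup S G" "subgroup A G" and "N \<subseteq> S" "S \<inter> A \<subseteq> N"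
    and solve: "\<And>(r :: nat \<Rightarrow> nat) \<alpha>. (\<And>k. 0 < r k) \<Longrightarrow> (\<And>k. \<alpha> k \<in> A) \<Longrightarrow>
      \<exists>a. (\<forall>k. a k \<in> A) \<and> (\<forall>k. \<exists>\<nu>\<in>N. a (Suc k) [^] r k = a k \<otimes> \<alpha> k \<otimes> \<nu>)"
    and iso: "isolated G (S <#> A)" and e0: "e0 \<in> carrier G" "e0 \<notin> S <#> A"
  obtains S' where "subgroup S' G" "S \<subseteq> S'" "S' \<inter> A \<subseteq> N" "isolated G (S' <#> A)" "e0 \<in> S' <#> A"
proof -
  \<comment> \<open>The quotient \<open>Q\<close> by \<open>W\<close> is torsion-free by isolation,
    so the isolator in \<open>Q\<close> of the image of \<open>e0\<close> is a union of a chain of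
    cyclic groups. This chain is lifted to \<open>G\<close>.\<close>
  define W where "W = S <#> A"
  have W: "subgroup W G" unfolding W_def by (rule mult_subgroups) (use sub in auto)
  then interpret W: normal W G by (rule subgroup_imp_normal)
  define Q where "Q = G Mod W"
  define p where "p x = W #> x" for x
  interpret Q: comm_group Q unfolding Q_def by (rule abelian_FactGroup[OF W])
  interpret p: group_hom G Q p
    unfolding group_hom_def group_hom_axioms_def p_def Q_def
    using W.r_coset_hom_Mod is_group W.factorgroup_is_group by simp
  have ker: "p x = \<one>\<^bsub>Q\<^esub> \<longleftrightarrow> x \<in> W" if "x \<in> carrier G" for x
    using that coset_join1[OF _ that W] coset_join2[OF that W] W.subset by (auto simp: p_def Q_def)
  have kerD: "x \<in> W" if "p x = \<one>\<^bsub>Q\<^esub>" "x \<in> carrier G" for x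
    using that ker by blast
  have surj: "\<exists>x\<in>carrier G. p x = y" if "y \<in> carrier Q" for y
    using that by (auto simp: Q_def p_def carrier_FactGroup)
  have S: "x \<in> carrier G" "x \<in> W" "p x = \<one>\<^bsub>Q\<^esub>" if "x \<in> S" for x
  proof -
    show 1: "x \<in> carrier G" by (rule subgroup.mem_carrier[OF sub(1) that])
    have "x \<otimes> \<one> \<in> W" unfolding W_def using that subgroup.one_closed[OF sub(2)] by (rule set_multI)
    with 1 show 2: "x \<in> W" by simp
    show "p x = \<one>\<^bsub>Q\<^esub>" using ker 1 2 by simp
  qed
  have A: "x \<in> carrier G" "p x = \<one>\<^bsub>Q\<^esub>" if "x \<in> A" for x
  proof -
    show 1: "x \<in> carrier G" by (rule subgroup.mem_carrier[OF sub(2) that])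
    have "\<one> \<otimes> x \<in> W" unfolding W_def using subgroup.one_closed[OF sub(1)] that by (rule set_multI)
    with 1 have "x \<in> W" by simp
    then show "p x = \<one>\<^bsub>Q\<^esub>" using ker 1 by simp
  qed
  have tf: "torsion_free Q"
    unfolding torsion_free_def
  proof (intro ballI allI impI)
    fix y and m :: nat assume "y \<in> carrier Q" and m: "0 < m" "y [^]\<^bsub>Q\<^esub> m = \<one>\<^bsub>Q\<^esub>"
    then obtain x where x: "x \<in> carrier G" "y = p x" using surj by blast
    then have "x [^] m \<in> W" using m ker[of "x [^] m"] by (simp add: p.hom_nat_pow)
    then have "x \<in> W" using iso x m unfolding isolated_def W_def by blast
    then show "y = \<one>\<^bsub>Q\<^esub>" using ker x by simp
  qed
  obtain d and r :: "nat \<Rightarrow> nat" where d: "d 0 = p e0" "\<And>k. d k \<in> carrier Q"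
      "\<And>k. d (Suc k) [^]\<^bsub>Q\<^esub> r k = d k" and r: "\<And>k. 0 < r k"
      and cyc: "\<And>y (m::nat) k (i::int). y \<in> carrier Q \<Longrightarrow> 0 < m \<Longrightarrow> y [^]\<^bsub>Q\<^esub> m = d k [^]\<^bsub>Q\<^esub> i \<Longrightarrow>
        \<exists>k' (j::int). y = d k' [^]\<^bsub>Q\<^esub> j"
    using Q.isolator_chain[OF tf p.hom_closed[OF e0(1)]] by metis
  have "\<exists>x\<in>carrier G. p x = d k" for k using surj d(2) by blast
  then obtain e where e: "\<And>k. e k \<in> carrier G" "\<And>k. p (e k) = d k" by metis
  \<comment> \<open>The relations of the chain hold in \<open>Q\<close> only; their lifts carry an
    error in \<open>W\<close>, which splits into \<open>s k\<close> in \<open>S\<close> and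
    \<open>\<alpha> k\<close> in \<open>A\<close>.\<close>
  have "\<exists>s\<in>S. \<exists>\<alpha>\<in>A. e (Suc k) [^] r k = e k \<otimes> s \<otimes> \<alpha>" for k
  proof -
    have "p (inv (e k) \<otimes> e (Suc k) [^] r k) = \<one>\<^bsub>Q\<^esub>"
      using e d by (simp add: p.hom_nat_pow)
    then have "inv (e k) \<otimes> e (Suc k) [^] r k \<in> W" by (rule kerD) (use e in simp)
    then obtain s \<alpha> where s: "s \<in> S" "\<alpha> \<in> A" and eq: "inv (e k) \<otimes> e (Suc k) [^] r k = s \<otimes> \<alpha>"
      unfolding W_def by (rule set_multE)
    have "e (Suc k) [^] r k = e k \<otimes> (inv (e k) \<otimes> e (Suc k) [^] r k)"
      using e by (simp add: m_assoc[symmetric])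
    also have "\<dots> = e k \<otimes> s \<otimes> \<alpha>" unfolding eq using e S(1) A(1) s by (simp add: m_assoc)
    finally show ?thesis using s by blast
  qed
  then obtain s \<alpha> where s: "\<And>k. s k \<in> S" and \<alpha>: "\<And>k. \<alpha> k \<in> A"
      and es: "\<And>k. e (Suc k) [^] r k = e k \<otimes> s k \<otimes> \<alpha> k" by metis
  have "\<exists>a. (\<forall>k. a k \<in> A) \<and> (\<forall>k. \<exists>\<nu>\<in>N. a (Suc k) [^] r k = a k \<otimes> \<alpha> k \<otimes> \<nu>)"
    by (rule solve) (rule r, rule \<alpha>)
  then obtain a \<nu> where a: "\<And>k. a k \<in> A" and \<nu>: "\<And>k. \<nu> k \<in> N"
      and as: "\<And>k. a (Suc k) [^] r k = a k \<otimes> \<alpha> k \<otimes> \<nu> k" by metis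
  have \<nu>S: "\<nu> k \<in> S" for k using \<nu> \<open>N \<subseteq> S\<close> by blast
  \<comment> \<open>Dividing by the solution \<open>a k\<close> absorbs the errors
    \<open>\<alpha> k\<close>: as \<open>N\<close> is contained in \<open>S\<close>, the
    \<open>c k\<close> satisfy the relations of the chain modulo \<open>S\<close> alone.\<close>
  define c where "c k = e k \<otimes> inv (a k)" for k
  have c: "c k \<in> carrier G" "p (c k) = d k" for k
    using e a A d by (simp_all add: c_def)
  have ac: "(u \<otimes> v \<otimes> w) \<otimes> (u' \<otimes> w' \<otimes> v') = (u \<otimes> u') \<otimes> (v \<otimes> v') \<otimes> (w \<otimes> w')"
    if "u \<in> carrier G" "v \<in> carrier G" "w \<in> carrier G" "u' \<in> carrier G" "v' \<in> carrier G" "w' \<in> carrier G"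
    for u v w u' v' w' using that by (simp add: m_ac)
  have cr: "\<exists>\<sigma>\<in>S. c (Suc k) [^] r k = c k \<otimes> \<sigma>" for k
  proof
    show "s k \<otimes> inv (\<nu> k) \<in> S"
      using s \<nu>S sub(1) by (simp add: subgroup.m_closed subgroup.m_inv_closed)
    have "c (Suc k) [^] r k = e (Suc k) [^] r k \<otimes> inv (a (Suc k) [^] r k)"
      using e a A by (simp add: c_def pow_mult_distrib m_comm nat_pow_inv)
    also have "\<dots> = (e k \<otimes> s k \<otimes> \<alpha> k) \<otimes> (inv (a k) \<otimes> inv (\<alpha> k) \<otimes> inv (\<nu> k))"
      using e s \<alpha> a \<nu>S S(1) A(1) by (simp add: es as inv_mult)
    also have "\<dots> = (e k \<otimes> inv (a k)) \<otimes> (s k \<otimes> inv (\<nu> k)) \<otimes> (\<alpha> k \<otimes> inv (\<alpha> k))"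
      using e[of k] s[of k] \<alpha>[of k] a[of k] \<nu>S[of k] S(1) A(1) by (intro ac) simp_all
    also have "\<dots> = c k \<otimes> (s k \<otimes> inv (\<nu> k))"
      using e(1)[of k] S(1)[OF s, of k] A(1)[OF a, of k] S(1)[OF \<nu>S, of k] A(1)[OF \<alpha>, of k]
      by (simp add: c_def)
    finally show "c (Suc k) [^] r k = c k \<otimes> (s k \<otimes> inv (\<nu> k))" .
  qed
  have mono: "\<exists>t::nat. 0 < t \<and> (\<exists>\<sigma>\<in>S. c k = c (k + l) [^] t \<otimes> \<sigma>)" for k l
  proof (induction l)
    case 0
    show ?case
      using c subgroup.one_closed[OF sub(1)] by (intro exI[of _ "1::nat"] conjI bexI[of _ \<one>]) simp_all
  next
    case (Suc l)
    then obtain t :: nat and \<sigma> where t: "0 < t" "\<sigma> \<in> S" "c k = c (k + l) [^] t \<otimes> \<sigma>" by blast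
    obtain \<tau> where \<tau>: "\<tau> \<in> S" "c (Suc (k + l)) [^] r (k + l) = c (k + l) \<otimes> \<tau>" using cr by blast
    then have "c (k + l) = c (Suc (k + l)) [^] r (k + l) \<otimes> inv \<tau>"
      using c S(1) by (simp add: m_assoc)
    then have "c k = (c (Suc (k + l)) [^] r (k + l) \<otimes> inv \<tau>) [^] t \<otimes> \<sigma>" using t(3) by simp
    also have "\<dots> = c (k + Suc l) [^] (r (k + l) * t) \<otimes> (inv \<tau> [^] t \<otimes> \<sigma>)"
      using c S(1) t(2) \<tau>(1) by (simp add: pow_mult_distrib m_comm nat_pow_pow m_assoc)
    finally have "c k = c (k + Suc l) [^] (r (k + l) * t) \<otimes> (inv \<tau> [^] t \<otimes> \<sigma>)" .
    moreover have "inv \<tau> [^] t \<otimes> \<sigma> \<in> S"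
      using sub(1) t \<tau> by (simp add: subgroup.m_closed subgroup.m_inv_closed subgroup_nat_pow)
    ultimately show ?case using r[of "k + l"] t(1) by (metis nat_0_less_mult_iff)
  qed
  \<comment> \<open>By \<open>mono\<close> each \<open>c k\<close> is a power of any later one
    modulo \<open>S\<close>, so the subgroup generated by \<open>S\<close> and all
    \<open>c k\<close> is an increasing union; \<open>up\<close> moves two of its elements to a
    common stage.\<close>
  define S' where "S' = {x. \<exists>k (j::int). \<exists>\<sigma>\<in>S. x = c k [^] j \<otimes> \<sigma>}"
  have S'I: "c k [^] j \<otimes> \<sigma> \<in> S'" if "\<sigma> \<in> S" for k \<sigma> and j :: int
    using that unfolding S'_def by blast
  have up: "\<exists>(i::int). \<exists>\<tau>\<in>S. c k [^] j \<otimes> \<sigma> = c (k + l) [^] i \<otimes> \<tau>" if "\<sigma> \<in> S"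
    for k l \<sigma> and j :: int
  proof -
    obtain t :: nat and \<tau> where t: "\<tau> \<in> S" "c k = c (k + l) [^] t \<otimes> \<tau>" using mono by blast
    have "c k [^] j \<otimes> \<sigma> = (c (k + l) [^] int t \<otimes> \<tau>) [^] j \<otimes> \<sigma>"
      by (subst t(2)) (simp add: int_pow_int)
    also have "\<dots> = c (k + l) [^] (int t * j) \<otimes> (\<tau> [^] j \<otimes> \<sigma>)"
      using c S(1) t(1) that by (simp add: int_pow_distrib int_pow_pow m_assoc del: int_pow_int)
    finally show ?thesis
      using sub(1) t(1) that by (metis subgroup.m_closed subgroup_int_pow_closed)
  qed
  have subS': "subgroup S' G"
  proof (rule subgroupI)
    show "S' \<subseteq> carrier G" using c S(1) by (auto simp: S'_def)
    show "S' \<noteq> {}" using S'I subgroup.one_closed[OF sub(1)] by blast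
    fix x assume "x \<in> S'"
    then obtain k \<sigma> and j :: int where x: "x = c k [^] j \<otimes> \<sigma>" "\<sigma> \<in> S" unfolding S'_def by blast
    then have "inv x = c k [^] (- j) \<otimes> inv \<sigma>" using c S(1) by (simp add: inv_mult int_pow_neg)
    then show "inv x \<in> S'" using S'I x(2) sub(1) by (simp add: subgroup.m_inv_closed)
    fix y assume "y \<in> S'"
    then obtain l \<tau> and i :: int where y: "y = c l [^] i \<otimes> \<tau>" "\<tau> \<in> S" unfolding S'_def by blast
    obtain j' :: int and \<sigma>' where x': "\<sigma>' \<in> S" "x = c (k + l) [^] j' \<otimes> \<sigma>'"
      using up[OF x(2), of k j l] x(1) by blast
    obtain i' :: int and \<tau>' where y': "\<tau>' \<in> S" "y = c (k + l) [^] i' \<otimes> \<tau>'"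
      using up[OF y(2), of l i k] y(1) by (auto simp: add.commute)
    have "x \<otimes> y = (c (k + l) [^] j' \<otimes> c (k + l) [^] i') \<otimes> (\<sigma>' \<otimes> \<tau>')"
      using x' y' c S(1) by (simp add: m_ac)
    also have "\<dots> = c (k + l) [^] (j' + i') \<otimes> (\<sigma>' \<otimes> \<tau>')" using c by (simp add: int_pow_mult)
    finally show "x \<otimes> y \<in> S'" using S'I x'(1) y'(1) sub(1) by (simp add: subgroup.m_closed)
  qed
  have pS': "p (c k [^] j \<otimes> \<sigma>) = d k [^]\<^bsub>Q\<^esub> j" if "\<sigma> \<in> S" for k \<sigma> and j :: int
    using that S c d by (simp add: p.hom_int_pow)
  have dk: "d k \<noteq> \<one>\<^bsub>Q\<^esub>" for k
  proof (induction k)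
    case 0
    show ?case using d(1) ker[OF e0(1)] e0(2) by (simp add: W_def)
  next
    case (Suc k)
    then show ?case using d(3)[of k] by auto
  qed
  have "S \<subseteq> S'"
  proof
    fix \<sigma> assume "\<sigma> \<in> S"
    then show "\<sigma> \<in> S'" using S'I[of \<sigma> 0 0] S(1) by simp
  qed
  \<comment> \<open>An element of \<open>A\<close> has trivial image in \<open>Q\<close>, where
    \<open>d k\<close> has infinite order; so only the part in \<open>S\<close> is left.\<close>
  moreover have "S' \<inter> A \<subseteq> N"
  proof
    fix x assume "x \<in> S' \<inter> A"
    then obtain k \<sigma> and j :: int where x: "x = c k [^] j \<otimes> \<sigma>" "\<sigma> \<in> S" "x \<in> A"
      unfolding S'_def by blast
    then have "d k [^]\<^bsub>Q\<^esub> j = \<one>\<^bsub>Q\<^esub>" using pS' A by metis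
    then have "j = 0" using Q.torsion_free_int[OF tf d(2)] dk by blast
    then show "x \<in> N" using x S(1) \<open>S \<inter> A \<subseteq> N\<close> by auto
  qed
  \<comment> \<open>The image of \<open>S' <#> A\<close> in \<open>Q\<close> is the union of the
    cyclic groups generated by the \<open>d k\<close>, and \<open>cyc\<close> says that this union
    is closed under roots.\<close>
  moreover have "isolated G (S' <#> A)"
    unfolding isolated_def
  proof (intro ballI allI impI)
    fix y and m :: nat assume y: "y \<in> carrier G" "0 < m" "y [^] m \<in> S' <#> A"
    then obtain k \<sigma> \<beta> and i :: int where eq: "y [^] m = c k [^] i \<otimes> \<sigma> \<otimes> \<beta>" "\<sigma> \<in> S" "\<beta> \<in> A"
      by (elim set_multE) (auto simp: S'_def)
    have "p (y [^] m) = d k [^]\<^bsub>Q\<^esub> i"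
      unfolding eq(1) using p.hom_mult[of "c k [^] i \<otimes> \<sigma>" \<beta>] pS'[OF eq(2)] A[OF eq(3)] c S(1)[OF eq(2)] d
      by simp
    then obtain k' and j :: int where "p y = d k' [^]\<^bsub>Q\<^esub> j"
      using cyc[of "p y" m k i] y by (auto simp: p.hom_nat_pow)
    then have "p (inv (c k' [^] j) \<otimes> y) = \<one>\<^bsub>Q\<^esub>" using c d y by (simp add: p.hom_int_pow)
    then have "inv (c k' [^] j) \<otimes> y \<in> W" by (rule kerD) (use c y in simp)
    then obtain \<tau> \<gamma> where \<tau>: "\<tau> \<in> S" "\<gamma> \<in> A" "inv (c k' [^] j) \<otimes> y = \<tau> \<otimes> \<gamma>"
      unfolding W_def by (rule set_multE)
    have "y = c k' [^] j \<otimes> (inv (c k' [^] j) \<otimes> y)" using c y by (simp add: m_assoc[symmetric])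
    also have "\<dots> = c k' [^] j \<otimes> \<tau> \<otimes> \<gamma>" using \<tau> c S(1) A(1) by (simp add: m_assoc)
    finally show "y \<in> S' <#> A" using set_multI[OF S'I[OF \<tau>(1)] \<tau>(2)] by simp
  qed
  moreover have "e0 \<in> S' <#> A"
  proof -
    have "p (inv (c 0) \<otimes> e0) = \<one>\<^bsub>Q\<^esub>" using c d e0 by simp
    then have "inv (c 0) \<otimes> e0 \<in> W" by (rule kerD) (use c e0 in simp)
    then obtain \<tau> \<gamma> where \<tau>: "\<tau> \<in> S" "\<gamma> \<in> A" "inv (c 0) \<otimes> e0 = \<tau> \<otimes> \<gamma>"
      unfolding W_def by (rule set_multE)
    have "e0 = c 0 \<otimes> (inv (c 0) \<otimes> e0)" using c e0 by (simp add: m_assoc[symmetric])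
    also have "\<dots> = c 0 [^] (1::int) \<otimes> \<tau> \<otimes> \<gamma>" using \<tau> c S(1) A(1) by (simp add: m_assoc)
    finally show ?thesis using set_multI[OF S'I[OF \<tau>(1), of 0 1] \<tau>(2)] by simp
  qed
  ultimately show ?thesis using that subS' by blast
qed

text \<open>\<open>N\<close> holds the elements to be neglected: modulo \<open>N\<close>, a
  complement of \<open>A\<close> is sought that extends \<open>S0\<close>. Isolation is part of the
  condition in Zorn's lemma because it makes the remaining quotient torsion-free, so that
  \<open>enlarge_complement\<close> applies whenever \<open>S <#> A\<close> is not yet
  everything.\<close>

lemma (in comm_group) exists_complement:
  assumes sub: "subgroup S0 G" "subgroup A G" and "N \<subseteq> S0" "S0 \<inter> A \<subseteq> N"
    and solve: "\<And>(r :: nat \<Rightarrow> nat) \<alpha>. (\<And>k. 0 < r k) \<Longrightarrow> (\<And>k. \<alpha> k \<in> A) \<Longrightarrow>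
      \<exists>a. (\<forall>k. a k \<in> A) \<and> (\<forall>k. \<exists>\<nu>\<in>N. a (Suc k) [^] r k = a k \<otimes> \<alpha> k \<otimes> \<nu>)"
    and iso: "isolated G (S0 <#> A)"
  obtains S where "subgroup S G" "S0 \<subseteq> S" "S \<inter> A \<subseteq> N" "S <#> A = carrier G"
proof -
  let ?\<A> = "{S. subgroup S G \<and> S0 \<subseteq> S \<and> S \<inter> A \<subseteq> N \<and> isolated G (S <#> A)}"
  have "\<exists>S\<in>?\<A>. \<forall>Z\<in>?\<A>. S \<subseteq> Z \<longrightarrow> Z = S"
  proof (rule subset_Zorn_nonempty)
    show "?\<A> \<noteq> {}" using assms by blast
    fix C assume "C \<noteq> {}" and C: "subset.chain ?\<A> C"
    then have CA: "\<And>Z. Z \<in> C \<Longrightarrow> Z \<in> ?\<A>" and Clin: "\<And>Z Y. Z \<in> C \<Longrightarrow> Y \<in> C \<Longrightarrow> Z \<subseteq> Y \<or> Y \<subseteq> Z"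
      unfolding subset.chain_def subset_chain_def by blast+
    have "subgroup (\<Union>C) G"
    proof (rule subgroupI)
      show "\<Union>C \<subseteq> carrier G" using CA subgroup.subset by blast
      show "\<Union>C \<noteq> {}" using CA \<open>C \<noteq> {}\<close> subgroup.one_closed by blast
      fix x assume "x \<in> \<Union>C"
      then obtain Y where Y: "Y \<in> C" "x \<in> Y" by blast
      have sY: "subgroup Y G" using CA[OF Y(1)] by simp
      then show "inv x \<in> \<Union>C" using subgroup.m_inv_closed[OF sY Y(2)] Y(1) by blast
      fix y assume "y \<in> \<Union>C"
      then obtain Z where Z: "Z \<in> C" "y \<in> Z" by blast
      have sZ: "subgroup Z G" using CA[OF Z(1)] by simp
      from Clin[OF Y(1) Z(1)] show "x \<otimes> y \<in> \<Union>C"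
      proof
        assume "Y \<subseteq> Z"
        then have "x \<otimes> y \<in> Z" using subgroup.m_closed[OF sZ _ Z(2)] Y(2) by blast
        then show ?thesis using Z(1) by blast
      next
        assume "Z \<subseteq> Y"
        then have "x \<otimes> y \<in> Y" using subgroup.m_closed[OF sY Y(2)] Z(2) by blast
        then show ?thesis using Y(1) by blast
      qed
    qed
    moreover have "S0 \<subseteq> \<Union>C" "\<Union>C \<inter> A \<subseteq> N" using CA \<open>C \<noteq> {}\<close> by blast+
    moreover have "isolated G (\<Union>C <#> A)"
      unfolding isolated_def
    proof (intro ballI allI impI)
      fix x and m :: nat assume x: "x \<in> carrier G" "0 < m" "x [^] m \<in> \<Union>C <#> A"
      then obtain Z where Z: "Z \<in> C" "x [^] m \<in> Z <#> A"
        by (elim set_multE) (auto simp: set_mult_def)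
      then have "x \<in> Z <#> A" using CA[OF Z(1)] x unfolding isolated_def by blast
      then show "x \<in> \<Union>C <#> A" using Z(1) by (auto simp: set_mult_def)
    qed
    ultimately show "\<Union>C \<in> ?\<A>" by blast
  qed
  then obtain S where S: "S \<in> ?\<A>" and max': "\<forall>Z\<in>?\<A>. S \<subseteq> Z \<longrightarrow> Z = S"
    by (rule bexE)
  have max: "Z = S" if "Z \<in> ?\<A>" "S \<subseteq> Z" for Z
    by (rule bspec[OF max' that(1), THEN mp, OF that(2)])
  have "carrier G \<subseteq> S <#> A"
  proof (rule ccontr)
    assume "\<not> carrier G \<subseteq> S <#> A"
    then obtain e0 where e0: "e0 \<in> carrier G" "e0 \<notin> S <#> A" by blast
    have NS: "N \<subseteq> S" using S \<open>N \<subseteq> S0\<close> by blast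
    have sS: "subgroup S G" "S \<inter> A \<subseteq> N" "isolated G (S <#> A)" and S0S: "S0 \<subseteq> S"
      using S by blast+
    show False
    proof (rule enlarge_complement[OF sS(1) sub(2) NS sS(2) _ sS(3) e0])
      fix r :: "nat \<Rightarrow> nat" and \<alpha> :: "nat \<Rightarrow> 'a" assume "\<And>k. 0 < r k" "\<And>k. \<alpha> k \<in> A"
      then show "\<exists>a. (\<forall>k. a k \<in> A) \<and> (\<forall>k. \<exists>\<nu>\<in>N. a (Suc k) [^] r k = a k \<otimes> \<alpha> k \<otimes> \<nu>)"
        by (rule solve)
    next
      fix S' assume S': "subgroup S' G" "S \<subseteq> S'" "S' \<inter> A \<subseteq> N" "isolated G (S' <#> A)" "e0 \<in> S' <#> A"
      then have "S' = S" using S0S by (intro max) auto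
      with S'(5) e0(2) show False by simp
    qed
  qed
  moreover have "S <#> A \<subseteq> carrier G"
    by (rule setmult_subset_G[OF subgroup.subset subgroup.subset[OF sub(2)]]) (use S in simp)
  ultimately show ?thesis by (intro that[of S]) (use S in auto)
qed

section \<open>Interpretation of the triangular group in the ring\<close>

lemma group_term_eval_cong:
  "\<forall>v\<in>group_term_vars t. e v = e' v \<Longrightarrow> group_term_eval G e t = group_term_eval G e' t"
  by (induction t) auto

text \<open>A group variable \<open>v\<close> is interpreted by the entries of a matrix (\<open>b = False\<close>) and of its
  inverse (\<open>b = True\<close>), so that inversion is expressed by terms.\<close>

definition entry_var :: "nat \<Rightarrow> bool \<Rightarrow> nat \<Rightarrow> nat \<Rightarrow> nat" where
  "entry_var v b i j = to_nat (v, b, i, j)"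

lemma entry_var_inject [simp]:
  "entry_var v b i j = entry_var v' b' i' j' \<longleftrightarrow> v = v' \<and> b = b' \<and> i = i' \<and> j = j'"
  by (auto simp: entry_var_def)

primrec sum_term :: "(nat \<Rightarrow> ring_term) \<Rightarrow> nat \<Rightarrow> ring_term" where
  "sum_term f 0 = RZero"
| "sum_term f (Suc k) = RAdd (f k) (sum_term f k)"

definition mult_terms where
  "mult_terms n A B i j = sum_term (\<lambda>k. RMult (A i k) (B k j)) n"

definition one_terms :: "nat \<Rightarrow> nat \<Rightarrow> ring_term" where
  "one_terms i j = (if i = j then ROne else RZero)"

text \<open>The flag selects between the value of a group term and its inverse. Hence
  \<open>GInv\<close> only flips it, and the inverse of a product takes the factors in reverse
  order.\<close>

primrec entry_term :: "nat \<Rightarrow> group_term \<Rightarrow> bool \<Rightarrow> nat \<Rightarrow> nat \<Rightarrow> ring_term" where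
  "entry_term n (GVar v) = (\<lambda>b i j. RVar (entry_var v b i j))"
| "entry_term n GOne = (\<lambda>b. one_terms)"
| "entry_term n (GInv t) = (\<lambda>b. entry_term n t (\<not> b))"
| "entry_term n (GMult s t) = (\<lambda>b.
     if b then mult_terms n (entry_term n t b) (entry_term n s b)
     else mult_terms n (entry_term n s b) (entry_term n t b))"

primrec conj_formula :: "ring_term fo_formula list \<Rightarrow> ring_term fo_formula" where
  "conj_formula [] = FEq RZero RZero"
| "conj_formula (\<phi> # \<phi>s) = FConj \<phi> (conj_formula \<phi>s)"

primrec ex_formula :: "nat list \<Rightarrow> 't fo_formula \<Rightarrow> 't fo_formula" where
  "ex_formula [] \<phi> = \<phi>"
| "ex_formula (v # vs) \<phi> = FEx v (ex_formula vs \<phi>)"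

definition eq_formula where
  "eq_formula n A B = conj_formula [FEq (A i j) (B i j). i \<leftarrow> [0..<n], j \<leftarrow> [0..<n]]"

definition T_formula :: "nat \<Rightarrow> nat \<Rightarrow> ring_term fo_formula" where
  "T_formula n v =
     (let A = \<lambda>b i j. RVar (entry_var v b i j) in
      FConj (eq_formula n (mult_terms n (A False) (A True)) one_terms)
        (FConj (eq_formula n (mult_terms n (A True) (A False)) one_terms)
          (conj_formula [FEq (A False i j) RZero. i \<leftarrow> [0..<n], j \<leftarrow> [0..<i]])))"

definition entry_vars :: "nat \<Rightarrow> nat \<Rightarrow> nat list" where
  "entry_vars n v = [entry_var v b i j. b \<leftarrow> [False, True], i \<leftarrow> [0..<n], j \<leftarrow> [0..<n]]"

text \<open>The guard \<open>T_formula\<close> confines the quantified ring elements to the entries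
  of a triangular matrix and of its inverse, so the block of quantifiers amounts to one quantifier
  over the group.\<close>

primrec T_interp :: "nat \<Rightarrow> group_term fo_formula \<Rightarrow> ring_term fo_formula" where
  "T_interp n (FEq s t) = eq_formula n (entry_term n s False) (entry_term n t False)"
| "T_interp n (FNeg \<phi>) = FNeg (T_interp n \<phi>)"
| "T_interp n (FConj \<phi> \<psi>) = FConj (T_interp n \<phi>) (T_interp n \<psi>)"
| "T_interp n (FEx v \<phi>) = ex_formula (entry_vars n v) (FConj (T_formula n v) (T_interp n \<phi>))"

lemma set_entry_vars: "set (entry_vars n v) = {entry_var v b i j | b i j. i < n \<and> j < n}"
proof -
  have "set (entry_vars n v) = (\<Union>b\<in>{False, True}. \<Union>i<n. \<Union>j<n. {entry_var v b i j})"
    by (auto simp: entry_vars_def)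
  then show ?thesis by (auto simp: UNIV_bool[symmetric])
qed

lemma holds_conj_formula [simp]:
  "holds M (ring_term_eval R) e (conj_formula \<phi>s) \<longleftrightarrow>
     (\<forall>\<phi>\<in>set \<phi>s. holds M (ring_term_eval R) e \<phi>)"
  by (induction \<phi>s) auto

lemma holds_eq_formula:
  "holds M (ring_term_eval R) e (eq_formula n A B) \<longleftrightarrow>
     (\<forall>i<n. \<forall>j<n. ring_term_eval R e (A i j) = ring_term_eval R e (B i j))"
  by (auto simp: eq_formula_def)

lemma holds_ex_formula:
  "holds M teval e (ex_formula vs \<phi>) \<longleftrightarrow>
     (\<exists>e'. (\<forall>v. v \<notin> set vs \<longrightarrow> e' v = e v) \<and> (\<forall>v\<in>set vs. e' v \<in> M) \<and> holds M teval e' \<phi>)"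
proof (induction vs arbitrary: e)
  case Nil
  have "e' = e" if "\<forall>v. e' v = e v" for e' using that by (rule_tac ext) simp
  then show ?case by auto
next
  case (Cons v vs)
  show ?case
  proof
    assume "holds M teval e (ex_formula (v # vs) \<phi>)"
    then obtain a e' where a: "a \<in> M" "\<forall>w. w \<notin> set vs \<longrightarrow> e' w = (e(v := a)) w"
        and e': "\<forall>w\<in>set vs. e' w \<in> M" "holds M teval e' \<phi>"
      by (auto simp: Cons.IH)
    \<comment> \<open>If \<open>v\<close> occurs again in \<open>vs\<close>, an inner quantifier
      overrides \<open>a\<close>, and the value of \<open>e'\<close> at \<open>v\<close> lies in
      \<open>M\<close> for that reason.\<close>
    then have "e' v \<in> M" by (cases "v \<in> set vs") auto
    then show "\<exists>e'. (\<forall>w. w \<notin> set (v # vs) \<longrightarrow> e' w = e w) \<and>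
        (\<forall>w\<in>set (v # vs). e' w \<in> M) \<and> holds M teval e' \<phi>"
      using a e' by (intro exI[of _ e']) auto
  next
    assume "\<exists>e'. (\<forall>w. w \<notin> set (v # vs) \<longrightarrow> e' w = e w) \<and>
        (\<forall>w\<in>set (v # vs). e' w \<in> M) \<and> holds M teval e' \<phi>"
    then obtain e' where "\<forall>w. w \<notin> set (v # vs) \<longrightarrow> e' w = e w"
        "\<forall>w\<in>set (v # vs). e' w \<in> M" "holds M teval e' \<phi>" by blast
    then show "holds M teval e (ex_formula (v # vs) \<phi>)"
      by (auto simp: Cons.IH intro!: bexI[of _ "e' v"] exI[of _ e'])
  qed
qed

lemma vars_sum_term: "ring_term_vars (sum_term f k) = (\<Union>i<k. ring_term_vars (f i))"
  by (induction k) (auto simp: lessThan_Suc)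

lemma vars_entry_term:
  "i < n \<Longrightarrow> j < n \<Longrightarrow>
     ring_term_vars (entry_term n t b i j) \<subseteq> (\<Union>v\<in>group_term_vars t. set (entry_vars n v))"
proof (induction t arbitrary: b i j)
  case (GVar v)
  then show ?case by (auto simp: set_entry_vars)
next
  case (GMult s t)
  have IH: "ring_term_vars (entry_term n s b i j) \<subseteq> (\<Union>v\<in>group_term_vars (GMult s t). set (entry_vars n v))"
      "ring_term_vars (entry_term n t b i j) \<subseteq> (\<Union>v\<in>group_term_vars (GMult s t). set (entry_vars n v))"
    if "i < n" "j < n" for b i j
    using GMult.IH(1)[OF that, of b] GMult.IH(2)[OF that, of b] by auto
  have "ring_term_vars (entry_term n (GMult s t) b i j) \<subseteq>
      (\<Union>k<n. ring_term_vars (entry_term n s b i k) \<union> ring_term_vars (entry_term n t b k j) \<union>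
             ring_term_vars (entry_term n t b i k) \<union> ring_term_vars (entry_term n s b k j))"
    by (auto simp: mult_terms_def vars_sum_term)
  also have "\<dots> \<subseteq> (\<Union>v\<in>group_term_vars (GMult s t). set (entry_vars n v))"
    by (intro UN_least Un_least IH) (use GMult.prems in auto)
  finally show ?case .
qed (auto simp: one_terms_def)

lemma free_vars_conj_formula [simp]:
  "free_vars ring_term_vars (conj_formula \<phi>s) = (\<Union>\<phi>\<in>set \<phi>s. free_vars ring_term_vars \<phi>)"
  by (induction \<phi>s) auto

lemma free_vars_ex_formula [simp]:
  "free_vars tvars (ex_formula vs \<phi>) = free_vars tvars \<phi> - set vs"
  by (induction vs) auto

lemma free_vars_T_formula: "free_vars ring_term_vars (T_formula n v) \<subseteq> set (entry_vars n v)"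
  by (auto simp: T_formula_def eq_formula_def mult_terms_def vars_sum_term one_terms_def
      set_entry_vars split: if_splits)

text \<open>A sentence about groups becomes a sentence about rings. An arbitrary assignment of ring
  elements need not code matrices of the group, but the truth of a sentence can be tested at one
  that does.\<close>

lemma free_vars_T_interp:
  "free_vars ring_term_vars (T_interp n \<phi>) \<subseteq>
     (\<Union>v\<in>free_vars group_term_vars \<phi>. set (entry_vars n v))"
proof (induction \<phi>)
  case (FEq s t)
  then show ?case using vars_entry_term[of _ n _ s False] vars_entry_term[of _ n _ t False]
    by (fastforce simp: eq_formula_def)
next
  case (FEx v \<phi>)
  then show ?case using free_vars_T_formula[of n v] by auto
qed auto

context matrices_over_cring
begin

definition entry_mat :: "(nat \<Rightarrow> 'a) \<Rightarrow> nat \<Rightarrow> bool \<Rightarrow> 'a mat" where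
  "entry_mat e v b = mat n n (\<lambda>(i, j). e (entry_var v b i j))"

definition codes_T :: "(nat \<Rightarrow> 'a) \<Rightarrow> nat \<Rightarrow> bool" where
  "codes_T e v \<longleftrightarrow> entry_mat e v False \<in> carrier \<MM> \<and> entry_mat e v True \<in> carrier \<MM> \<and>
     entry_mat e v False \<otimes>\<^bsub>\<MM>\<^esub> entry_mat e v True = \<one>\<^bsub>\<MM>\<^esub> \<and>
     entry_mat e v True \<otimes>\<^bsub>\<MM>\<^esub> entry_mat e v False = \<one>\<^bsub>\<MM>\<^esub> \<and> upper (entry_mat e v False)"

lemma entry_mat_dim [simp]: "entry_mat e v b \<in> carrier_mat n n"
  by (simp add: entry_mat_def)

lemma entry_mat_index: "i < n \<Longrightarrow> j < n \<Longrightarrow> entry_mat e v b $$ (i, j) = e (entry_var v b i j)"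
  by (simp add: entry_mat_def)

lemma codes_T_TT:
  assumes "codes_T e v"
  shows "entry_mat e v False \<in> carrier \<TT>" "inv\<^bsub>\<TT>\<^esub> (entry_mat e v False) = entry_mat e v True"
proof -
  show 1: "entry_mat e v False \<in> carrier \<TT>"
    using assms unfolding codes_T_def mem_TT_iff by blast
  have "entry_mat e v True \<in> carrier \<TT>"
    using assms upper_inverse(1)[of "entry_mat e v False" "entry_mat e v True"]
    unfolding codes_T_def mem_TT_iff by blast
  with 1 show "inv\<^bsub>\<TT>\<^esub> (entry_mat e v False) = entry_mat e v True"
    using assms by (intro TT.inv_equality) (auto simp: codes_T_def)
qed

lemma eval_sum_term:
  "(\<And>i. i < k \<Longrightarrow> ring_term_eval R e (f i) \<in> carrier R) \<Longrightarrow>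
     ring_term_eval R e (sum_term f k) = (\<Oplus>i\<in>{..<k}. ring_term_eval R e (f i))"
  by (induction k) (auto simp: lessThan_Suc)

lemma eval_mult_terms:
  assumes "M \<in> carrier \<MM>" "N \<in> carrier \<MM>" "i < n" "j < n"
    and "\<And>i j. i < n \<Longrightarrow> j < n \<Longrightarrow> ring_term_eval R e (A i j) = M $$ (i, j)"
    and "\<And>i j. i < n \<Longrightarrow> j < n \<Longrightarrow> ring_term_eval R e (B i j) = N $$ (i, j)"
  shows "ring_term_eval R e (mult_terms n A B i j) = (M \<otimes>\<^bsub>\<MM>\<^esub> N) $$ (i, j)"
  unfolding mult_terms_def MM_mult[OF assms(3,4)] using assms
  by (subst eval_sum_term) (auto simp: MM_entry intro!: finsum_cong')

lemma eval_one_terms: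
  "i < n \<Longrightarrow> j < n \<Longrightarrow> ring_term_eval R e (one_terms i j) = \<one>\<^bsub>\<MM>\<^esub> $$ (i, j)"
  by (simp add: one_terms_def MM_one)

lemma group_term_eval_TT:
  "\<forall>v. codes_T e v \<Longrightarrow> group_term_eval \<TT> (\<lambda>v. entry_mat e v False) t \<in> carrier \<TT>"
proof (induction t)
  case (GMult s t)
  then show ?case using TT.m_closed by (simp add: TT_simps)
qed (use codes_T_TT(1) TT.one_closed TT.inv_closed in auto)

lemma eval_entry_term:
  assumes "\<forall>v. codes_T e v"
  defines "ev \<equiv> \<lambda>t. group_term_eval \<TT> (\<lambda>v. entry_mat e v False) t"
  shows "i < n \<Longrightarrow> j < n \<Longrightarrow> ring_term_eval R e (entry_term n t b i j) =
      (if b then inv\<^bsub>\<TT>\<^esub> (ev t) else ev t) $$ (i, j)"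
proof (induction t arbitrary: b i j)
  case (GVar v)
  then show ?case using assms(1) by (simp add: ev_def codes_T_TT(2) entry_mat_index)
next
  case GOne
  have "inv\<^bsub>\<TT>\<^esub> \<one>\<^bsub>\<MM>\<^esub> = \<one>\<^bsub>\<MM>\<^esub>" using TT.inv_one by simp
  with GOne show ?case by (simp add: ev_def eval_one_terms)
next
  case (GInv t)
  have "ev t \<in> carrier \<TT>" using group_term_eval_TT assms by auto
  then have "inv\<^bsub>\<TT>\<^esub> (inv\<^bsub>\<TT>\<^esub> (ev t)) = ev t" by simp
  then show ?case using GInv.IH[OF GInv.prems] by (simp add: ev_def)
next
  case (GMult s t)
  have c: "ev s \<in> carrier \<TT>" "ev t \<in> carrier \<TT>" using group_term_eval_TT assms by auto
  then have ci: "inv\<^bsub>\<TT>\<^esub> (ev s) \<in> carrier \<TT>" "inv\<^bsub>\<TT>\<^esub> (ev t) \<in> carrier \<TT>" by auto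
  have "ev (GMult s t) = ev s \<otimes>\<^bsub>\<MM>\<^esub> ev t" by (simp add: ev_def)
  moreover have "inv\<^bsub>\<TT>\<^esub> (ev s \<otimes>\<^bsub>\<MM>\<^esub> ev t) = inv\<^bsub>\<TT>\<^esub> (ev t) \<otimes>\<^bsub>\<MM>\<^esub> inv\<^bsub>\<TT>\<^esub> (ev s)"
    using TT.inv_mult_group[OF c] by simp
  moreover have "ring_term_eval R e (mult_terms n (entry_term n s False) (entry_term n t False) i j)
      = (ev s \<otimes>\<^bsub>\<MM>\<^esub> ev t) $$ (i, j)"
    by (rule eval_mult_terms) (use c GMult TT_MM in auto)
  moreover have "ring_term_eval R e (mult_terms n (entry_term n t True) (entry_term n s True) i j)
      = (inv\<^bsub>\<TT>\<^esub> (ev t) \<otimes>\<^bsub>\<MM>\<^esub> inv\<^bsub>\<TT>\<^esub> (ev s)) $$ (i, j)"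
    by (rule eval_mult_terms) (use ci GMult TT_MM in auto)
  ultimately show ?case by simp
qed

lemma holds_T_formula:
  assumes "entry_mat e v False \<in> carrier \<MM>" "entry_mat e v True \<in> carrier \<MM>"
  shows "holds (carrier R) (ring_term_eval R) e (T_formula n v) \<longleftrightarrow> codes_T e v"
proof -
  have eq: "(\<forall>i<n. \<forall>j<n. (M \<otimes>\<^bsub>\<MM>\<^esub> N) $$ (i, j) = \<one>\<^bsub>\<MM>\<^esub> $$ (i, j)) \<longleftrightarrow> M \<otimes>\<^bsub>\<MM>\<^esub> N = \<one>\<^bsub>\<MM>\<^esub>"
    if "M \<in> carrier \<MM>" "N \<in> carrier \<MM>" for M N
    using MM_eqI[OF MM.m_closed[OF that] MM.one_closed] by auto
  have MM: "entry_mat e v b \<in> carrier \<MM>" for b using assms by (cases b) auto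
  have m: "ring_term_eval R e (mult_terms n (\<lambda>i j. RVar (entry_var v b i j))
        (\<lambda>i j. RVar (entry_var v (\<not> b) i j)) i j) =
      (entry_mat e v b \<otimes>\<^bsub>\<MM>\<^esub> entry_mat e v (\<not> b)) $$ (i, j)" if "i < n" "j < n" for b i j
    by (rule eval_mult_terms[OF MM MM that]) (simp_all add: entry_mat_index)
  have "holds (carrier R) (ring_term_eval R) e (T_formula n v) \<longleftrightarrow>
      (\<forall>i<n. \<forall>j<n. (entry_mat e v False \<otimes>\<^bsub>\<MM>\<^esub> entry_mat e v True) $$ (i, j) = \<one>\<^bsub>\<MM>\<^esub> $$ (i, j)) \<and>
      (\<forall>i<n. \<forall>j<n. (entry_mat e v True \<otimes>\<^bsub>\<MM>\<^esub> entry_mat e v False) $$ (i, j) = \<one>\<^bsub>\<MM>\<^esub> $$ (i, j)) \<and>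
      upper (entry_mat e v False)"
    using m[of _ _ True] m[of _ _ False]
    by (auto simp: T_formula_def Let_def holds_eq_formula eval_one_terms upper_def entry_mat_index)
  with assms show ?thesis by (simp add: codes_T_def eq)
qed

text \<open>The induction keeps the invariant that \<open>e\<close> codes a triangular matrix at
  every variable. A quantifier over \<open>v\<close> changes only the codes of \<open>v\<close>, and
  injectivity of \<open>entry_var\<close> protects the matrices at the other variables.\<close>

lemma holds_T_interp:
  "\<forall>v. codes_T e v \<Longrightarrow> holds (carrier R) (ring_term_eval R) e (T_interp n \<phi>) \<longleftrightarrow>
     holds (carrier \<TT>) (group_term_eval \<TT>) (\<lambda>v. entry_mat e v False) \<phi>"
proof (induction \<phi> arbitrary: e)
  case (FEq s t)
  have c: "group_term_eval \<TT> (\<lambda>v. entry_mat e v False) t \<in> carrier \<MM>" for t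
    using FEq by (intro TT_MM group_term_eval_TT)
  have "holds (carrier R) (ring_term_eval R) e (T_interp n (FEq s t)) \<longleftrightarrow>
      (\<forall>i<n. \<forall>j<n. group_term_eval \<TT> (\<lambda>v. entry_mat e v False) s $$ (i, j) =
                     group_term_eval \<TT> (\<lambda>v. entry_mat e v False) t $$ (i, j))"
    by (simp add: holds_eq_formula eval_entry_term[OF FEq])
  also have "\<dots> \<longleftrightarrow> group_term_eval \<TT> (\<lambda>v. entry_mat e v False) s =
                     group_term_eval \<TT> (\<lambda>v. entry_mat e v False) t"
    using MM_eqI[OF c c] by auto
  finally show ?case by simp
next
  case (FEx v \<phi>)
  show ?case
  proof
    assume "holds (carrier R) (ring_term_eval R) e (T_interp n (FEx v \<phi>))"
    then obtain e' where e': "\<forall>w. w \<notin> set (entry_vars n v) \<longrightarrow> e' w = e w"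
        "\<forall>w\<in>set (entry_vars n v). e' w \<in> carrier R"
        "holds (carrier R) (ring_term_eval R) e' (T_formula n v)"
        "holds (carrier R) (ring_term_eval R) e' (T_interp n \<phi>)"
      by (auto simp: holds_ex_formula)
    have MM: "entry_mat e' v b \<in> carrier \<MM>" for b
      using e'(2) by (auto simp: mem_MM entry_mat_index set_entry_vars)
    have v: "codes_T e' v" using holds_T_formula[OF MM MM] e'(3) by simp
    have other: "entry_mat e' w b = entry_mat e w b" if "w \<noteq> v" for w b
      unfolding entry_mat_def by (rule cong_mat) (use e'(1) that in \<open>auto simp: set_entry_vars\<close>)
    have "\<forall>w. codes_T e' w"
    proof
      fix w show "codes_T e' w"
        using FEx.prems v other[of w] by (cases "w = v") (auto simp: codes_T_def)
    qed
    from FEx.IH[OF this] e'(4)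
    have "holds (carrier \<TT>) (group_term_eval \<TT>) (\<lambda>w. entry_mat e' w False) \<phi>" by simp
    also have "(\<lambda>w. entry_mat e' w False) = (\<lambda>w. entry_mat e w False)(v := entry_mat e' v False)"
      using other by auto
    finally show "holds (carrier \<TT>) (group_term_eval \<TT>) (\<lambda>v. entry_mat e v False) (FEx v \<phi>)"
      unfolding holds.simps using codes_T_TT(1)[OF v] by blast
  next
    assume "holds (carrier \<TT>) (group_term_eval \<TT>) (\<lambda>v. entry_mat e v False) (FEx v \<phi>)"
    then obtain M where M: "M \<in> carrier \<TT>"
        and h: "holds (carrier \<TT>) (group_term_eval \<TT>) ((\<lambda>v. entry_mat e v False)(v := M)) \<phi>"
      by auto
    \<comment> \<open>\<open>from_nat\<close> recovers which entry a code stands for; the codes of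
      \<open>v\<close> receive the entries of \<open>M\<close> and of its inverse, which makes the
      guard true.\<close>
    define e' where "e' c = (case from_nat c :: nat \<times> bool \<times> nat \<times> nat of (w, b, i, j) \<Rightarrow>
        if c \<in> set (entry_vars n v) then (if b then inv\<^bsub>\<TT>\<^esub> M else M) $$ (i, j) else e c)" for c
    have e'v: "e' (entry_var v b i j) = (if b then inv\<^bsub>\<TT>\<^esub> M else M) $$ (i, j)"
      if "i < n" "j < n" for b i j
    proof -
      have "entry_var v b i j \<in> set (entry_vars n v)" using that by (auto simp: set_entry_vars)
      then show ?thesis by (simp add: e'_def entry_var_def)
    qed
    have e'o: "e' c = e c" if "c \<notin> set (entry_vars n v)" for c
      using that by (auto simp: e'_def split: prod.split)
    have Mi: "M \<in> carrier \<MM>" "inv\<^bsub>\<TT>\<^esub> M \<in> carrier \<MM>" "M \<otimes>\<^bsub>\<MM>\<^esub> inv\<^bsub>\<TT>\<^esub> M = \<one>\<^bsub>\<MM>\<^esub>"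
        "inv\<^bsub>\<TT>\<^esub> M \<otimes>\<^bsub>\<MM>\<^esub> M = \<one>\<^bsub>\<MM>\<^esub>" "upper M"
      using M TT.r_inv[OF M] TT.l_inv[OF M] TT.inv_closed[OF M] TT_MM TT_upper by auto
    have mv: "entry_mat e' v b = (if b then inv\<^bsub>\<TT>\<^esub> M else M)" for b
      by (rule MM_eqI) (use Mi in \<open>auto simp: entry_mat_index e'v mem_MM\<close>)
    have other: "entry_mat e' w b = entry_mat e w b" if "w \<noteq> v" for w b
      unfolding entry_mat_def by (rule cong_mat) (use that in \<open>auto simp: set_entry_vars intro!: e'o\<close>)
    have v: "codes_T e' v" using Mi by (simp add: codes_T_def mv)
    have "\<forall>w. codes_T e' w"
    proof
      fix w show "codes_T e' w"
        using FEx.prems v other[of w] by (cases "w = v") (auto simp: codes_T_def)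
    qed
    moreover have "(\<lambda>w. entry_mat e' w False) = (\<lambda>w. entry_mat e w False)(v := M)"
      using other mv by auto
    ultimately have "holds (carrier R) (ring_term_eval R) e' (T_interp n \<phi>)"
      using FEx.IH[of e'] h by simp
    moreover have "holds (carrier R) (ring_term_eval R) e' (T_formula n v)"
      using v by (subst holds_T_formula) (auto simp: codes_T_def)
    moreover have "\<forall>w\<in>set (entry_vars n v). e' w \<in> carrier R"
      using Mi(1,2) by (auto simp: set_entry_vars e'v MM_entry)
    ultimately show "holds (carrier R) (ring_term_eval R) e (T_interp n (FEx v \<phi>))"
      using e'o by (auto simp: holds_ex_formula intro!: exI[of _ e'])
  qed
qed auto

lemma group_models_TT_iff:
  assumes "free_vars group_term_vars \<phi> = {}"
  shows "group_models \<TT> \<phi> \<longleftrightarrow> ring_models R (T_interp n \<phi>)"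
proof -
  \<comment> \<open>This codes the identity matrix at every variable. For a sentence this one
    assignment decides validity on both sides.\<close>
  define e0 where "e0 c = (case from_nat c :: nat \<times> bool \<times> nat \<times> nat of
      (w, b, i, j) \<Rightarrow> if i = j then \<one> else \<zero>)" for c
  have e0: "range e0 \<subseteq> carrier R" by (auto simp: e0_def split: prod.split)
  have "entry_mat e0 v b = \<one>\<^bsub>\<MM>\<^esub>" for v b
    by (auto simp: entry_mat_def matrix_monoid_def e0_def entry_var_def)
  then have c: "\<forall>v. codes_T e0 v" by (auto simp: codes_T_def upper_def MM_one)
  then have e0T: "range (\<lambda>v. entry_mat e0 v False) \<subseteq> carrier \<TT>" using codes_T_TT(1) by auto
  have R: "holds (carrier R) (ring_term_eval R) e (T_interp n \<phi>) \<longleftrightarrow>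
      holds (carrier R) (ring_term_eval R) e0 (T_interp n \<phi>)" for e
    using free_vars_T_interp[of n \<phi>] assms
    by (intro holds_cong[where tvars = ring_term_vars] ring_term_eval_cong) auto
  have T: "holds (carrier \<TT>) (group_term_eval \<TT>) e \<phi> \<longleftrightarrow>
      holds (carrier \<TT>) (group_term_eval \<TT>) (\<lambda>v. entry_mat e0 v False) \<phi>" for e
    using assms by (intro holds_cong[where tvars = group_term_vars] group_term_eval_cong) auto
  show ?thesis
    unfolding group_models_def ring_models_def using holds_T_interp[OF c] R T e0 e0T by blast
qed

end

lemma T_group_elem_equiv:
  assumes "cring R" "cring S" "ring_elem_equiv R S"
  shows "group_elem_equiv (T_group R n) (T_group S n)"
proof -
  interpret R: matrices_over_cring R n using assms by (simp add: matrices_over_cring_def)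
  interpret S: matrices_over_cring S n using assms by (simp add: matrices_over_cring_def)
  show ?thesis
    using assms(3) unfolding group_elem_equiv_def
    by (simp add: R.group_models_TT_iff S.group_models_TT_iff ring_elem_equiv_models)
qed

section \<open>Symmetric cocycles and abelian extensions\<close>

lemma sym_cocyclesD:
  assumes "F \<in> sym_cocycles B A" "x \<in> carrier B" "y \<in> carrier B"
  shows "F x y \<in> carrier A" "F \<one>\<^bsub>B\<^esub> x = \<one>\<^bsub>A\<^esub>" "F x \<one>\<^bsub>B\<^esub> = \<one>\<^bsub>A\<^esub>" "F x y = F y x"
    and "z \<in> carrier B \<Longrightarrow> F (x \<otimes>\<^bsub>B\<^esub> y) z \<otimes>\<^bsub>A\<^esub> F x y = F x (y \<otimes>\<^bsub>B\<^esub> z) \<otimes>\<^bsub>A\<^esub> F y z"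
  using assms unfolding sym_cocycles_def by blast+

text \<open>In \<open>cocycle_ext\<close> a left inverse is easier to exhibit than
  \<open>inv\<close> is to compute.\<close>

lemma (in group) subgroupI_left_inverse:
  assumes "P \<subseteq> carrier G" "\<one> \<in> P" "\<And>x y. x \<in> P \<Longrightarrow> y \<in> P \<Longrightarrow> x \<otimes> y \<in> P"
    and "\<And>x. x \<in> P \<Longrightarrow> \<exists>y\<in>P. y \<otimes> x = \<one>"
  shows "subgroup P G"
proof (rule subgroupI)
  fix x assume x: "x \<in> P"
  then obtain y where y: "y \<in> P" "y \<otimes> x = \<one>" using assms(4) by blast
  have "inv x = y" using x y assms(1) by (intro inv_equality) auto
  with y show "inv x \<in> P" by simp
qed (use assms in auto)

text \<open>The abelian extension with factor set \<open>F\<close>, in the coordinates of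
  \<open>D_group\<close>. Its homomorphic sections correspond to the functions that make
  \<open>F\<close> a coboundary.\<close>

definition cocycle_ext ::
    "('b, 'm) monoid_scheme \<Rightarrow> ('a, 'n) monoid_scheme \<Rightarrow> ('b \<Rightarrow> 'b \<Rightarrow> 'a) \<Rightarrow> ('b \<times> 'a) monoid" where
  "cocycle_ext B A F = \<lparr>carrier = carrier B \<times> carrier A,
     monoid.mult = (\<lambda>(x, z) (y, w). (x \<otimes>\<^bsub>B\<^esub> y, z \<otimes>\<^bsub>A\<^esub> w \<otimes>\<^bsub>A\<^esub> F x y)),
     one = (\<one>\<^bsub>B\<^esub>, \<one>\<^bsub>A\<^esub>)\<rparr>"

lemma cocycle_ext_comm_group:
  assumes "comm_group B" "comm_group A" and F: "F \<in> sym_cocycles B A"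
  shows "comm_group (cocycle_ext B A F)"
proof -
  interpret B: comm_group B by fact
  interpret A: comm_group A by fact
  note F_in = sym_cocyclesD(1)[OF F] and F_one = sym_cocyclesD(2,3)[OF F]
  show ?thesis
  proof (rule comm_groupI)
    fix p q assume p: "p \<in> carrier (cocycle_ext B A F)" and q: "q \<in> carrier (cocycle_ext B A F)"
    show "p \<otimes>\<^bsub>cocycle_ext B A F\<^esub> q \<in> carrier (cocycle_ext B A F)"
      using p q by (auto simp: cocycle_ext_def F_in)
    show "p \<otimes>\<^bsub>cocycle_ext B A F\<^esub> q = q \<otimes>\<^bsub>cocycle_ext B A F\<^esub> p"
      using p q by (auto simp: cocycle_ext_def B.m_comm A.m_comm sym_cocyclesD(4)[OF F])
    fix u assume u: "u \<in> carrier (cocycle_ext B A F)"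
    obtain x z y w v t where [simp]: "p = (x, z)" "q = (y, w)" "u = (v, t)"
      by (cases p, cases q, cases u) blast
    have c: "x \<in> carrier B" "y \<in> carrier B" "v \<in> carrier B" "z \<in> carrier A" "w \<in> carrier A" "t \<in> carrier A"
      using p q u by (auto simp: cocycle_ext_def)
    have "z \<otimes>\<^bsub>A\<^esub> w \<otimes>\<^bsub>A\<^esub> F x y \<otimes>\<^bsub>A\<^esub> t \<otimes>\<^bsub>A\<^esub> F (x \<otimes>\<^bsub>B\<^esub> y) v =
        z \<otimes>\<^bsub>A\<^esub> w \<otimes>\<^bsub>A\<^esub> t \<otimes>\<^bsub>A\<^esub> (F (x \<otimes>\<^bsub>B\<^esub> y) v \<otimes>\<^bsub>A\<^esub> F x y)"
      using c F_in by (simp add: A.m_ac)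
    also have "\<dots> = z \<otimes>\<^bsub>A\<^esub> w \<otimes>\<^bsub>A\<^esub> t \<otimes>\<^bsub>A\<^esub> (F x (y \<otimes>\<^bsub>B\<^esub> v) \<otimes>\<^bsub>A\<^esub> F y v)"
      using sym_cocyclesD(5)[OF F c(1,2,3)] by simp
    also have "\<dots> = z \<otimes>\<^bsub>A\<^esub> (w \<otimes>\<^bsub>A\<^esub> t \<otimes>\<^bsub>A\<^esub> F y v) \<otimes>\<^bsub>A\<^esub> F x (y \<otimes>\<^bsub>B\<^esub> v)"
      using c F_in by (simp add: A.m_ac)
    finally show "p \<otimes>\<^bsub>cocycle_ext B A F\<^esub> q \<otimes>\<^bsub>cocycle_ext B A F\<^esub> u =
        p \<otimes>\<^bsub>cocycle_ext B A F\<^esub> (q \<otimes>\<^bsub>cocycle_ext B A F\<^esub> u)"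
      using c by (simp add: cocycle_ext_def B.m_assoc)
  next
    fix p assume p: "p \<in> carrier (cocycle_ext B A F)"
    obtain x z where [simp]: "p = (x, z)" by (cases p)
    have c: "x \<in> carrier B" "z \<in> carrier A" using p by (auto simp: cocycle_ext_def)
    show "\<one>\<^bsub>cocycle_ext B A F\<^esub> \<otimes>\<^bsub>cocycle_ext B A F\<^esub> p = p"
      using c by (simp add: cocycle_ext_def F_one)
    \<comment> \<open>The value of \<open>F\<close> inside the inverse cancels the one contributed
      by the product.\<close>
    let ?z = "inv\<^bsub>A\<^esub> (z \<otimes>\<^bsub>A\<^esub> F (inv\<^bsub>B\<^esub> x) x)"
    have Fx: "F (inv\<^bsub>B\<^esub> x) x \<in> carrier A" using c F_in by simp
    have "?z \<otimes>\<^bsub>A\<^esub> z \<otimes>\<^bsub>A\<^esub> F (inv\<^bsub>B\<^esub> x) x = ?z \<otimes>\<^bsub>A\<^esub> (z \<otimes>\<^bsub>A\<^esub> F (inv\<^bsub>B\<^esub> x) x)"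
      using c Fx by (simp only: A.m_assoc A.m_closed A.inv_closed)
    also have "\<dots> = \<one>\<^bsub>A\<^esub>" using c Fx by (simp only: A.l_inv A.m_closed)
    finally show "\<exists>q\<in>carrier (cocycle_ext B A F). q \<otimes>\<^bsub>cocycle_ext B A F\<^esub> p = \<one>\<^bsub>cocycle_ext B A F\<^esub>"
      using c Fx by (intro bexI[of _ "(inv\<^bsub>B\<^esub> x, ?z)"]) (simp_all add: cocycle_ext_def)
  qed (simp add: cocycle_ext_def)
qed

section \<open>Sequences modulo a filter\<close>

lemma product_group_UNIV_pow:
  "(e [^]\<^bsub>product_group UNIV (\<lambda>_. K)\<^esub> (k::nat)) i = e i [^]\<^bsub>K\<^esub> k"
  by (induction k) simp_all

lemma product_group_comm_group:
  assumes "comm_group K" shows "comm_group (product_group I (\<lambda>_. K))"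
proof -
  interpret K: comm_group K by fact
  interpret P: group "product_group I (\<lambda>_. K)" by simp
  show ?thesis
    by (rule P.group_comm_groupI) (auto simp: PiE_iff K.m_comm intro!: restrict_ext)
qed

text \<open>The reduced power of \<open>K\<close> along \<open>U\<close> is represented by the group
  of all sequences, without dividing by the eventually trivial ones. The assumption on
  \<open>U\<close> says that it contains all tails of the natural numbers.\<close>

locale comm_group_sequences = K: comm_group K for K :: "('k, 'm) monoid_scheme" +
  fixes U :: "nat filter"
  assumes U: "U \<le> sequentially"
begin

abbreviation \<EE> where "\<EE> \<equiv> product_group (UNIV :: nat set) (\<lambda>_. K)"

sublocale E: comm_group \<EE> by (rule product_group_comm_group) (rule K.comm_group_axioms)

lemma E_mult [simp]: "(e \<otimes>\<^bsub>\<EE>\<^esub> e') i = e i \<otimes>\<^bsub>K\<^esub> e' i" and E_one [simp]: "\<one>\<^bsub>\<EE>\<^esub> i = \<one>\<^bsub>K\<^esub>"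
  by simp_all

lemma mem_E: "e \<in> carrier \<EE> \<longleftrightarrow> (\<forall>i. e i \<in> carrier K)"
  by auto

lemma E_inv: "e \<in> carrier \<EE> \<Longrightarrow> (inv\<^bsub>\<EE>\<^esub> e) i = inv\<^bsub>K\<^esub> (e i)"
  by simp

text \<open>The preimage, in the group of sequences, of the reduced power of \<open>P\<close>; for
  trivial \<open>P\<close> it is the subgroup that the reduced power divides out.\<close>

definition ae_in :: "'k set \<Rightarrow> (nat \<Rightarrow> 'k) set" where
  "ae_in P = {e \<in> carrier \<EE>. \<forall>\<^sub>F i in U. e i \<in> P}"

lemma ae_in_subgroup:
  assumes "subgroup P K" shows "subgroup (ae_in P) \<EE>"
proof (rule E.subgroupI)
  show "ae_in P \<subseteq> carrier \<EE>" by (auto simp: ae_in_def)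
  show "ae_in P \<noteq> {}"
    using subgroup.one_closed[OF assms] E.one_closed by (auto simp: ae_in_def intro!: exI[of _ "\<one>\<^bsub>\<EE>\<^esub>"])
  fix e assume e: "e \<in> ae_in P"
  then have "\<forall>\<^sub>F i in U. inv\<^bsub>K\<^esub> (e i) \<in> P"
    unfolding ae_in_def using subgroup.m_inv_closed[OF assms] by (auto elim: eventually_mono)
  then show "inv\<^bsub>\<EE>\<^esub> e \<in> ae_in P"
    using e E.inv_closed[of e] by (auto simp: ae_in_def simp del: carrier_product_group inv_product_group simp: E_inv)
  fix e' assume e': "e' \<in> ae_in P"
  have "\<forall>\<^sub>F i in U. e i \<otimes>\<^bsub>K\<^esub> e' i \<in> P"
    using e e' subgroup.m_closed[OF assms] unfolding ae_in_def by (auto elim: eventually_elim2)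
  then show "e \<otimes>\<^bsub>\<EE>\<^esub> e' \<in> ae_in P"
    using e e' E.m_closed[of e e'] by (auto simp: ae_in_def)
qed

text \<open>Reduced powers with index set \<open>\<nat>\<close> are cotorsion: in the component \<open>i\<close> one solves the first
  \<open>i\<close> of the equations, starting from \<open>a i = 1\<close> and going down.\<close>

lemma ae_in_cotorsion:
  assumes P: "subgroup P K" and \<alpha>: "\<And>k. \<alpha> k \<in> ae_in P"
  shows "\<exists>a. (\<forall>k. a k \<in> ae_in P) \<and>
    (\<forall>k. \<exists>\<nu>\<in>ae_in {\<one>\<^bsub>K\<^esub>}. a (Suc k) [^]\<^bsub>\<EE>\<^esub> (r k :: nat) = a k \<otimes>\<^bsub>\<EE>\<^esub> \<alpha> k \<otimes>\<^bsub>\<EE>\<^esub> \<nu>)"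
proof -
  have PK: "x \<in> carrier K" if "x \<in> P" for x using subgroup.mem_carrier[OF P that] .
  \<comment> \<open>\<open>\<beta> k\<close> differs from \<open>\<alpha> k\<close> only on a
    negligible set of components and lies in \<open>P\<close> at every component.\<close>
  define \<beta> where "\<beta> k i = (if \<alpha> k i \<in> P then \<alpha> k i else \<one>\<^bsub>K\<^esub>)" for k i
  have \<beta>P: "\<beta> k i \<in> P" for k i using subgroup.one_closed[OF P] by (simp add: \<beta>_def)
  have \<alpha>\<beta>: "\<forall>\<^sub>F i in U. \<beta> k i = \<alpha> k i" for k
    using \<alpha>[of k] unfolding ae_in_def \<beta>_def by (auto elim: eventually_mono)
  \<comment> \<open>\<open>g i d\<close> is the unknown with index \<open>i - d\<close> in component
    \<open>i\<close>. An equation determines the unknown \<open>k\<close> from the unknown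
    \<open>k + 1\<close>, so the recursion runs over the distance \<open>d\<close> from
    \<open>i\<close>.\<close>
  define g where "g i = rec_nat \<one>\<^bsub>K\<^esub> (\<lambda>d x. x [^]\<^bsub>K\<^esub> r (i - Suc d) \<otimes>\<^bsub>K\<^esub> inv\<^bsub>K\<^esub> (\<beta> (i - Suc d) i))" for i
  have gP: "g i d \<in> P" for i d
    by (induction d) (simp_all add: g_def subgroup.one_closed[OF P] subgroup.m_closed[OF P]
      subgroup.m_inv_closed[OF P] K.subgroup_nat_pow[OF P] \<beta>P)
  define a where "a k i = (if k \<le> i then g i (i - k) else \<one>\<^bsub>K\<^esub>)" for k i
  have aP: "a k i \<in> P" for k i using gP subgroup.one_closed[OF P] by (simp add: a_def)
  then have aE: "a k \<in> carrier \<EE>" for k using PK by (simp add: mem_E del: carrier_product_group)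
  have \<alpha>E: "\<alpha> k \<in> carrier \<EE>" for k using \<alpha> by (auto simp: ae_in_def)
  have step: "a (Suc k) i [^]\<^bsub>K\<^esub> r k = a k i \<otimes>\<^bsub>K\<^esub> \<beta> k i" if "k < i" for k i
  proof -
    have "i - k = Suc (i - Suc k)" and "i - Suc (i - Suc k) = k" using that by auto
    then have "a k i = a (Suc k) i [^]\<^bsub>K\<^esub> r k \<otimes>\<^bsub>K\<^esub> inv\<^bsub>K\<^esub> (\<beta> k i)"
      using that by (simp add: a_def g_def)
    then show ?thesis using PK[OF aP, of "Suc k" i] PK[OF \<beta>P, of k i] by (simp add: K.m_assoc)
  qed
  have "\<exists>\<nu>\<in>ae_in {\<one>\<^bsub>K\<^esub>}. a (Suc k) [^]\<^bsub>\<EE>\<^esub> r k = a k \<otimes>\<^bsub>\<EE>\<^esub> \<alpha> k \<otimes>\<^bsub>\<EE>\<^esub> \<nu>" for k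
  proof
    define \<nu> where "\<nu> = inv\<^bsub>\<EE>\<^esub> (a k \<otimes>\<^bsub>\<EE>\<^esub> \<alpha> k) \<otimes>\<^bsub>\<EE>\<^esub> a (Suc k) [^]\<^bsub>\<EE>\<^esub> r k"
    have c: "a k \<otimes>\<^bsub>\<EE>\<^esub> \<alpha> k \<in> carrier \<EE>" "a (Suc k) [^]\<^bsub>\<EE>\<^esub> r k \<in> carrier \<EE>"
      using E.m_closed[OF aE \<alpha>E] E.nat_pow_closed[OF aE] by blast+
    then show "a (Suc k) [^]\<^bsub>\<EE>\<^esub> r k = a k \<otimes>\<^bsub>\<EE>\<^esub> \<alpha> k \<otimes>\<^bsub>\<EE>\<^esub> \<nu>"
      unfolding \<nu>_def by (metis E.inv_solve_left E.inv_closed E.m_closed)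
    have \<nu>E: "\<nu> \<in> carrier \<EE>"
      unfolding \<nu>_def by (rule E.m_closed[OF E.inv_closed[OF c(1)] c(2)])
    \<comment> \<open>Equation \<open>k\<close> is solved in every component beyond
      \<open>k\<close>, hence eventually along \<open>U\<close>.\<close>
    have "\<forall>\<^sub>F i in U. k < i" using filter_leD[OF U] eventually_gt_at_top by blast
    then have "\<forall>\<^sub>F i in U. \<nu> i = \<one>\<^bsub>K\<^esub>"
      using \<alpha>\<beta>[of k]
    proof eventually_elim
      case (elim i)
      have "\<nu> i = inv\<^bsub>K\<^esub> (a k i \<otimes>\<^bsub>K\<^esub> \<alpha> k i) \<otimes>\<^bsub>K\<^esub> (a (Suc k) i [^]\<^bsub>K\<^esub> r k)"
        unfolding \<nu>_def E_mult E_inv[OF c(1)] product_group_UNIV_pow ..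
      also have "\<dots> = inv\<^bsub>K\<^esub> (a k i \<otimes>\<^bsub>K\<^esub> \<beta> k i) \<otimes>\<^bsub>K\<^esub> (a k i \<otimes>\<^bsub>K\<^esub> \<beta> k i)"
        using elim step by simp
      also have "\<dots> = \<one>\<^bsub>K\<^esub>" using PK[OF aP] PK[OF \<beta>P] by (intro K.l_inv K.m_closed)
      finally show ?case .
    qed
    then show "\<nu> \<in> ae_in {\<one>\<^bsub>K\<^esub>}" using \<nu>E by (simp add: ae_in_def del: carrier_product_group)
  qed
  moreover have "\<forall>k. a k \<in> ae_in P" using aE aP by (simp add: ae_in_def del: carrier_product_group)
  ultimately show ?thesis by blast
qed

end

section \<open>Groups twisted by a central cocycle\<close>

text \<open>\<open>\<theta>\<close> identifies \<open>G\<close> with the set \<open>H\<close> with the product \<open>\<iota> (F (\<pi> g) (\<pi> h)) g h\<close>, where \<open>\<iota>\<close> is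
  central and \<open>\<pi> \<circ> \<iota>\<close> trivial.\<close>

locale cocycle_twist =
  A: comm_group A + B: comm_group B + H: group H
  for A :: "('a, 'm1) monoid_scheme" and B :: "('b, 'm2) monoid_scheme"
    and H :: "('h, 'm3) monoid_scheme" +
  fixes G :: "('g, 'm4) monoid_scheme" and F :: "'b \<Rightarrow> 'b \<Rightarrow> 'a"
    and \<iota> :: "'a \<Rightarrow> 'h" and \<pi> :: "'h \<Rightarrow> 'b" and \<theta> :: "'g \<Rightarrow> 'h"
  assumes F: "F \<in> sym_cocycles B A"
    and \<iota>: "\<iota> \<in> hom A H"
    and central: "a \<in> carrier A \<Longrightarrow> h \<in> carrier H \<Longrightarrow> \<iota> a \<otimes>\<^bsub>H\<^esub> h = h \<otimes>\<^bsub>H\<^esub> \<iota> a"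
    and \<pi>: "\<pi> \<in> hom H B"
    and \<pi>\<iota>: "a \<in> carrier A \<Longrightarrow> \<pi> (\<iota> a) = \<one>\<^bsub>B\<^esub>"
    and \<theta>: "bij_betw \<theta> (carrier G) (carrier H)"
    and G_closed: "g \<in> carrier G \<Longrightarrow> g' \<in> carrier G \<Longrightarrow> g \<otimes>\<^bsub>G\<^esub> g' \<in> carrier G" "\<one>\<^bsub>G\<^esub> \<in> carrier G"
    and \<theta>_one: "\<theta> \<one>\<^bsub>G\<^esub> = \<one>\<^bsub>H\<^esub>"
    and \<theta>_mult: "g \<in> carrier G \<Longrightarrow> g' \<in> carrier G \<Longrightarrow>
      \<theta> (g \<otimes>\<^bsub>G\<^esub> g') = \<iota> (F (\<pi> (\<theta> g)) (\<pi> (\<theta> g'))) \<otimes>\<^bsub>H\<^esub> (\<theta> g \<otimes>\<^bsub>H\<^esub> \<theta> g')"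
begin

abbreviation \<KK> where "\<KK> \<equiv> cocycle_ext B A F"

sublocale K: comm_group \<KK>
  by (rule cocycle_ext_comm_group) (rule B.comm_group_axioms A.comm_group_axioms F)+

lemma K_simps: "carrier \<KK> = carrier B \<times> carrier A" "\<one>\<^bsub>\<KK>\<^esub> = (\<one>\<^bsub>B\<^esub>, \<one>\<^bsub>A\<^esub>)"
  "(x, z) \<otimes>\<^bsub>\<KK>\<^esub> (y, w) = (x \<otimes>\<^bsub>B\<^esub> y, z \<otimes>\<^bsub>A\<^esub> w \<otimes>\<^bsub>A\<^esub> F x y)"
  by (simp_all add: cocycle_ext_def)

lemma fst_mult: "fst (p \<otimes>\<^bsub>\<KK>\<^esub> q) = fst p \<otimes>\<^bsub>B\<^esub> fst q"
  by (cases p; cases q) (simp add: K_simps)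

sublocale fst: group_hom \<KK> B fst
  by (unfold_locales) (auto simp: hom_def K_simps fst_mult)

lemma \<iota>_closed: "a \<in> carrier A \<Longrightarrow> \<iota> a \<in> carrier H"
  and \<pi>_closed: "h \<in> carrier H \<Longrightarrow> \<pi> h \<in> carrier B"
  and \<theta>_closed: "g \<in> carrier G \<Longrightarrow> \<theta> g \<in> carrier H"
  and \<iota>_mult: "a \<in> carrier A \<Longrightarrow> a' \<in> carrier A \<Longrightarrow> \<iota> (a \<otimes>\<^bsub>A\<^esub> a') = \<iota> a \<otimes>\<^bsub>H\<^esub> \<iota> a'"
  and \<pi>_mult: "h \<in> carrier H \<Longrightarrow> h' \<in> carrier H \<Longrightarrow> \<pi> (h \<otimes>\<^bsub>H\<^esub> h') = \<pi> h \<otimes>\<^bsub>B\<^esub> \<pi> h'"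
  and \<theta>_inj: "g \<in> carrier G \<Longrightarrow> g' \<in> carrier G \<Longrightarrow> \<theta> g = \<theta> g' \<Longrightarrow> g = g'"
  using \<iota> \<pi> \<theta> by (auto simp: hom_def bij_betw_def inj_on_def)

lemma \<theta>_surj: "h \<in> carrier H \<Longrightarrow> \<exists>g\<in>carrier G. \<theta> g = h"
  using \<theta> by (force simp: bij_betw_def)

lemma F_closed: "x \<in> carrier B \<Longrightarrow> y \<in> carrier B \<Longrightarrow> F x y \<in> carrier A"
  using sym_cocyclesD(1)[OF F] .

lemma F_one: "F \<one>\<^bsub>B\<^esub> \<one>\<^bsub>B\<^esub> = \<one>\<^bsub>A\<^esub>"
  by (rule sym_cocyclesD(2)[OF F B.one_closed B.one_closed])

lemma \<iota>_one: "\<iota> \<one>\<^bsub>A\<^esub> = \<one>\<^bsub>H\<^esub>"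
  by (rule hom_one[OF \<iota>]) (rule A.is_group, rule H.is_group)

lemma \<pi>_one: "\<pi> \<one>\<^bsub>H\<^esub> = \<one>\<^bsub>B\<^esub>"
  by (rule hom_one[OF \<pi>]) (rule H.is_group, rule B.is_group)

text \<open>Read \<open>s = (x, z)\<close> as the value at \<open>x\<close> of a section of
  \<open>\<KK>\<close> over \<open>B\<close>. If that section were a homomorphism, sending
  \<open>h\<close> to the \<open>g\<close> related to it would be an isomorphism from
  \<open>H\<close> to \<open>G\<close>.\<close>

definition related :: "'b \<times> 'a \<Rightarrow> 'g \<Rightarrow> 'h \<Rightarrow> bool" where
  "related s g h \<longleftrightarrow> fst s = \<pi> h \<and> \<theta> g = \<iota> (snd s) \<otimes>\<^bsub>H\<^esub> h"

lemma related_\<pi>: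
  assumes "related s g h" "s \<in> carrier \<KK>" "h \<in> carrier H"
  shows "\<pi> (\<theta> g) = \<pi> h"
proof -
  have "snd s \<in> carrier A" using assms(2) by (auto simp: K_simps)
  then show ?thesis
    using assms by (simp add: related_def \<pi>_mult \<iota>_closed \<pi>\<iota> \<pi>_closed)
qed

text \<open>The twisting factor in the product of \<open>G\<close> is the very cocycle value that
  multiplication in \<open>\<KK>\<close> puts into the second coordinate; centrality of
  \<open>\<iota>\<close> collects these factors in front.\<close>

lemma related_mult:
  assumes r: "related s g h" "related s' g' h'" and s: "s \<in> carrier \<KK>" "s' \<in> carrier \<KK>"
    and g: "g \<in> carrier G" "g' \<in> carrier G" and h: "h \<in> carrier H" "h' \<in> carrier H"
  shows "related (s \<otimes>\<^bsub>\<KK>\<^esub> s') (g \<otimes>\<^bsub>G\<^esub> g') (h \<otimes>\<^bsub>H\<^esub> h')"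
proof -
  obtain z z' where ss: "s = (\<pi> h, z)" "s' = (\<pi> h', z')"
    using r by (cases s; cases s') (simp add: related_def)
  then have z: "z \<in> carrier A" "z' \<in> carrier A" using s by (auto simp: K_simps)
  define c where "c = F (\<pi> h) (\<pi> h')"
  have c: "c \<in> carrier A" using h by (simp add: c_def F_closed \<pi>_closed)
  have "\<theta> (g \<otimes>\<^bsub>G\<^esub> g') = \<iota> c \<otimes>\<^bsub>H\<^esub> ((\<iota> z \<otimes>\<^bsub>H\<^esub> h) \<otimes>\<^bsub>H\<^esub> (\<iota> z' \<otimes>\<^bsub>H\<^esub> h'))"
    using r g by (simp add: \<theta>_mult related_\<pi>[OF r(1) s(1) h(1)] related_\<pi>[OF r(2) s(2) h(2)] c_def)
      (simp add: related_def ss)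
  also have "(\<iota> z \<otimes>\<^bsub>H\<^esub> h) \<otimes>\<^bsub>H\<^esub> (\<iota> z' \<otimes>\<^bsub>H\<^esub> h') = \<iota> z \<otimes>\<^bsub>H\<^esub> (h \<otimes>\<^bsub>H\<^esub> \<iota> z') \<otimes>\<^bsub>H\<^esub> h'"
    using z h by (simp add: H.m_assoc \<iota>_closed)
  also have "\<dots> = \<iota> z \<otimes>\<^bsub>H\<^esub> \<iota> z' \<otimes>\<^bsub>H\<^esub> (h \<otimes>\<^bsub>H\<^esub> h')"
    unfolding central[OF z(2) h(1), symmetric] using z h by (simp add: H.m_assoc \<iota>_closed)
  also have "\<iota> c \<otimes>\<^bsub>H\<^esub> \<dots> = (\<iota> c \<otimes>\<^bsub>H\<^esub> (\<iota> z \<otimes>\<^bsub>H\<^esub> \<iota> z')) \<otimes>\<^bsub>H\<^esub> (h \<otimes>\<^bsub>H\<^esub> h')"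
    using z h c by (simp add: H.m_assoc \<iota>_closed)
  also have "\<iota> c \<otimes>\<^bsub>H\<^esub> (\<iota> z \<otimes>\<^bsub>H\<^esub> \<iota> z') = \<iota> (z \<otimes>\<^bsub>A\<^esub> z' \<otimes>\<^bsub>A\<^esub> c)"
    using z c by (simp add: \<iota>_mult[symmetric] A.m_comm)
  finally show ?thesis
    using h by (simp add: related_def ss K_simps c_def \<pi>_mult)
qed

text \<open>For \<open>s\<close> over the right element of \<open>B\<close>, multiplication by
  \<open>\<iota> (snd s)\<close> is invertible, so here and in \<open>related_right\<close> one of
  \<open>g\<close> and \<open>h\<close> yields the other.\<close>

lemma related_left:
  assumes "g \<in> carrier G" "s \<in> carrier \<KK>" "fst s = \<pi> (\<theta> g)"
  shows "\<exists>h\<in>carrier H. related s g h"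
proof
  have z: "snd s \<in> carrier A" "inv\<^bsub>A\<^esub> (snd s) \<in> carrier A" using assms(2) by (auto simp: K_simps)
  have "\<iota> (snd s) \<otimes>\<^bsub>H\<^esub> \<iota> (inv\<^bsub>A\<^esub> (snd s)) = \<one>\<^bsub>H\<^esub>"
    using z by (simp add: \<iota>_mult[symmetric] \<iota>_one)
  then show "related s g (\<iota> (inv\<^bsub>A\<^esub> (snd s)) \<otimes>\<^bsub>H\<^esub> \<theta> g)"
    using assms z by (simp add: related_def H.m_assoc[symmetric] \<iota>_closed \<theta>_closed \<pi>_mult \<pi>\<iota> \<pi>_closed)
  show "\<iota> (inv\<^bsub>A\<^esub> (snd s)) \<otimes>\<^bsub>H\<^esub> \<theta> g \<in> carrier H"
    using assms z by (simp add: \<iota>_closed \<theta>_closed)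
qed

lemma related_right:
  assumes "h \<in> carrier H" "s \<in> carrier \<KK>" "fst s = \<pi> h"
  shows "\<exists>g\<in>carrier G. related s g h"
proof -
  have "snd s \<in> carrier A" using assms(2) by (auto simp: K_simps)
  then show ?thesis
    using \<theta>_surj[of "\<iota> (snd s) \<otimes>\<^bsub>H\<^esub> h"] assms(1,3) by (simp add: related_def \<iota>_closed)
qed

lemma related_one: "related \<one>\<^bsub>\<KK>\<^esub> \<one>\<^bsub>G\<^esub> \<one>\<^bsub>H\<^esub>"
  by (simp add: related_def K_simps \<pi>_one \<iota>_one \<theta>_one)

lemma related_one_imp: "related \<one>\<^bsub>\<KK>\<^esub> g h \<Longrightarrow> h = \<one>\<^bsub>H\<^esub> \<Longrightarrow> g \<in> carrier G \<Longrightarrow> g = \<one>\<^bsub>G\<^esub>"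
  by (intro \<theta>_inj) (simp_all add: G_closed related_def K_simps \<iota>_one \<theta>_one)

text \<open>A left inverse stands in for \<open>inv\<close>, since \<open>G\<close> is not known to
  be a group at this point.\<close>

lemma related_inverse:
  assumes "related s g h" "s \<in> carrier \<KK>" "g \<in> carrier G" "h \<in> carrier H"
  obtains g' where "g' \<in> carrier G" "related (inv\<^bsub>\<KK>\<^esub> s) g' (inv\<^bsub>H\<^esub> h)" "g' \<otimes>\<^bsub>G\<^esub> g = \<one>\<^bsub>G\<^esub>"
proof -
  have "fst (inv\<^bsub>\<KK>\<^esub> s) = inv\<^bsub>B\<^esub> (fst s)" using assms(2) by (rule fst.hom_inv)
  also have "\<dots> = inv\<^bsub>B\<^esub> (\<pi> h)" using assms(1) by (simp add: related_def)
  also have "\<dots> = \<pi> (inv\<^bsub>H\<^esub> h)"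
    using assms(4) by (intro B.inv_equality) (simp_all add: \<pi>_closed \<pi>_mult[symmetric] \<pi>_one)
  finally obtain g' where g': "g' \<in> carrier G" "related (inv\<^bsub>\<KK>\<^esub> s) g' (inv\<^bsub>H\<^esub> h)"
    using related_right[of "inv\<^bsub>H\<^esub> h" "inv\<^bsub>\<KK>\<^esub> s"] assms by auto
  have "related (inv\<^bsub>\<KK>\<^esub> s \<otimes>\<^bsub>\<KK>\<^esub> s) (g' \<otimes>\<^bsub>G\<^esub> g) (inv\<^bsub>H\<^esub> h \<otimes>\<^bsub>H\<^esub> h)"
    by (rule related_mult) (use g' assms in simp_all)
  then have "g' \<otimes>\<^bsub>G\<^esub> g = \<one>\<^bsub>G\<^esub>"
    using assms g' by (intro related_one_imp) (simp_all add: G_closed)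
  with that g' show ?thesis by blast
qed

text \<open>The group laws are pulled back from \<open>\<KK>\<close> and \<open>H\<close>: each
  \<open>g\<close> is related to \<open>\<theta> g\<close> through \<open>\<pi> (\<theta> g)\<close>
  paired with the identity, \<open>related\<close> is multiplicative, and \<open>\<theta>\<close> is
  injective.\<close>

sublocale G: group G
proof (rule groupI)
  have triv: "related (\<pi> (\<theta> g), \<one>\<^bsub>A\<^esub>) g (\<theta> g)" "(\<pi> (\<theta> g), \<one>\<^bsub>A\<^esub>) \<in> carrier \<KK>"
    if "g \<in> carrier G" for g
    using that by (simp_all add: related_def K_simps \<iota>_one \<theta>_closed \<pi>_closed)
  fix x assume x: "x \<in> carrier G"
  show "\<exists>y\<in>carrier G. y \<otimes>\<^bsub>G\<^esub> x = \<one>\<^bsub>G\<^esub>"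
    using related_inverse[OF triv[OF x] x \<theta>_closed[OF x]] by blast
  have "related (\<one>\<^bsub>\<KK>\<^esub> \<otimes>\<^bsub>\<KK>\<^esub> (\<pi> (\<theta> x), \<one>\<^bsub>A\<^esub>)) (\<one>\<^bsub>G\<^esub> \<otimes>\<^bsub>G\<^esub> x) (\<one>\<^bsub>H\<^esub> \<otimes>\<^bsub>H\<^esub> \<theta> x)"
    by (rule related_mult[OF related_one triv(1)[OF x]]) (use x triv(2) in \<open>simp_all add: G_closed \<theta>_closed\<close>)
  then have "\<theta> (\<one>\<^bsub>G\<^esub> \<otimes>\<^bsub>G\<^esub> x) = \<theta> x"
    using x triv by (simp add: related_def \<theta>_closed \<iota>_one)
  then show "\<one>\<^bsub>G\<^esub> \<otimes>\<^bsub>G\<^esub> x = x" using x by (intro \<theta>_inj) (simp_all add: G_closed)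
  fix y z assume yz: "y \<in> carrier G" "z \<in> carrier G"
  note m = related_mult triv G_closed \<theta>_closed K.m_closed H.m_closed
  have "related ((\<pi> (\<theta> x), \<one>\<^bsub>A\<^esub>) \<otimes>\<^bsub>\<KK>\<^esub> (\<pi> (\<theta> y), \<one>\<^bsub>A\<^esub>) \<otimes>\<^bsub>\<KK>\<^esub> (\<pi> (\<theta> z), \<one>\<^bsub>A\<^esub>))
      (x \<otimes>\<^bsub>G\<^esub> y \<otimes>\<^bsub>G\<^esub> z) (\<theta> x \<otimes>\<^bsub>H\<^esub> \<theta> y \<otimes>\<^bsub>H\<^esub> \<theta> z)"
    using x yz by (intro m)
  moreover have "related ((\<pi> (\<theta> x), \<one>\<^bsub>A\<^esub>) \<otimes>\<^bsub>\<KK>\<^esub> ((\<pi> (\<theta> y), \<one>\<^bsub>A\<^esub>) \<otimes>\<^bsub>\<KK>\<^esub> (\<pi> (\<theta> z), \<one>\<^bsub>A\<^esub>)))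
      (x \<otimes>\<^bsub>G\<^esub> (y \<otimes>\<^bsub>G\<^esub> z)) (\<theta> x \<otimes>\<^bsub>H\<^esub> (\<theta> y \<otimes>\<^bsub>H\<^esub> \<theta> z))"
    using x yz by (intro m)
  ultimately have "\<theta> (x \<otimes>\<^bsub>G\<^esub> y \<otimes>\<^bsub>G\<^esub> z) = \<theta> (x \<otimes>\<^bsub>G\<^esub> (y \<otimes>\<^bsub>G\<^esub> z))"
    using x yz by (simp add: related_def K.m_assoc[OF triv(2) triv(2) triv(2)] H.m_assoc \<theta>_closed)
  then show "x \<otimes>\<^bsub>G\<^esub> y \<otimes>\<^bsub>G\<^esub> z = x \<otimes>\<^bsub>G\<^esub> (y \<otimes>\<^bsub>G\<^esub> z)"
    using x yz by (intro \<theta>_inj) (simp_all add: G_closed)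
qed (simp_all add: G_closed)

lemma related_inv:
  assumes "related s g h" "s \<in> carrier \<KK>" "g \<in> carrier G" "h \<in> carrier H"
  shows "related (inv\<^bsub>\<KK>\<^esub> s) (inv\<^bsub>G\<^esub> g) (inv\<^bsub>H\<^esub> h)"
proof -
  obtain g' where g': "g' \<in> carrier G" "related (inv\<^bsub>\<KK>\<^esub> s) g' (inv\<^bsub>H\<^esub> h)" "g' \<otimes>\<^bsub>G\<^esub> g = \<one>\<^bsub>G\<^esub>"
    using related_inverse[OF assms] .
  have "inv\<^bsub>G\<^esub> g = g'" using G.inv_equality[OF g'(3) assms(3) g'(1)] .
  with g' show ?thesis by simp
qed

end

text \<open>Splitting the ultrapower of \<open>1 \<rightarrow> A \<rightarrow> cocycle_ext B A F \<rightarrow> B \<rightarrow> 1\<close> makes the ultrapower of \<open>F\<close>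
  a coboundary, and hence the ultrapowers of \<open>G\<close> and \<open>H\<close> isomorphic.\<close>

theorem (in cocycle_twist) twist_elem_equiv:
  assumes T: "subgroup T B" "isolated B T"
    and \<phi>: "\<And>x. x \<in> T \<Longrightarrow> \<phi> x \<in> carrier A"
      "\<And>x y. x \<in> T \<Longrightarrow> y \<in> T \<Longrightarrow> \<phi> (x \<otimes>\<^bsub>B\<^esub> y) = F x y \<otimes>\<^bsub>A\<^esub> \<phi> x \<otimes>\<^bsub>A\<^esub> \<phi> y"
  shows "group_elem_equiv G H"
proof -
  obtain U :: "nat filter" where U: "U \<le> sequentially" "ultra U"
    using ultra_below[of sequentially] by auto
  interpret S: comm_group_sequences \<KK> U by unfold_locales (rule U(1))
  have TB: "x \<in> carrier B" if "x \<in> T" for x using subgroup.mem_carrier[OF T(1) that] .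
  \<comment> \<open>\<open>PA\<close> is the kernel of \<open>fst\<close>. \<open>PT\<close> is the
    graph of \<open>\<phi>\<close>, that is, the given splitting over \<open>T\<close>; the equation
    for \<open>\<phi>\<close> says that this graph is closed under products.\<close>
  define PA where "PA = {\<one>\<^bsub>B\<^esub>} \<times> carrier A"
  define PT where "PT = {(x, \<phi> x) | x. x \<in> T}"
  have PA: "subgroup PA \<KK>"
  proof (rule K.subgroupI_left_inverse)
    fix p assume "p \<in> PA"
    then show "\<exists>q\<in>PA. q \<otimes>\<^bsub>\<KK>\<^esub> p = \<one>\<^bsub>\<KK>\<^esub>"
      by (auto simp: PA_def K_simps F_one intro!: bexI[of _ "inv\<^bsub>A\<^esub> snd p"])
  qed (auto simp: PA_def K_simps F_one)
  have \<phi>1: "\<phi> \<one>\<^bsub>B\<^esub> = \<one>\<^bsub>A\<^esub>"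
  proof -
    have 1: "\<one>\<^bsub>B\<^esub> \<in> T" using subgroup.one_closed[OF T(1)] .
    have "\<phi> \<one>\<^bsub>B\<^esub> = \<phi> \<one>\<^bsub>B\<^esub> \<otimes>\<^bsub>A\<^esub> \<phi> \<one>\<^bsub>B\<^esub>"
      using \<phi>(2)[OF 1 1] \<phi>(1)[OF 1] sym_cocyclesD(2)[OF F, of "\<one>\<^bsub>B\<^esub>" "\<one>\<^bsub>B\<^esub>"] by simp
    then show ?thesis using \<phi>(1)[OF 1] A.l_cancel_one by metis
  qed
  have PT: "subgroup PT \<KK>"
  proof (rule K.subgroupI_left_inverse)
    show "PT \<subseteq> carrier \<KK>" using \<phi>(1) TB by (auto simp: PT_def K_simps)
    show "\<one>\<^bsub>\<KK>\<^esub> \<in> PT" using subgroup.one_closed[OF T(1)] \<phi>1 by (auto simp: PT_def K_simps)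
    have closed: "(x, \<phi> x) \<otimes>\<^bsub>\<KK>\<^esub> (y, \<phi> y) = (x \<otimes>\<^bsub>B\<^esub> y, \<phi> (x \<otimes>\<^bsub>B\<^esub> y))" if "x \<in> T" "y \<in> T" for x y
      using that \<phi> TB F_closed by (simp add: K_simps A.m_ac)
    show "p \<otimes>\<^bsub>\<KK>\<^esub> q \<in> PT" if "p \<in> PT" "q \<in> PT" for p q
      using that closed subgroup.m_closed[OF T(1)] by (auto simp: PT_def)
    fix p assume "p \<in> PT"
    then obtain x where x: "x \<in> T" "p = (x, \<phi> x)" by (auto simp: PT_def)
    have ix: "inv\<^bsub>B\<^esub> x \<in> T" using subgroup.m_inv_closed[OF T(1) x(1)] .
    then have "(inv\<^bsub>B\<^esub> x, \<phi> (inv\<^bsub>B\<^esub> x)) \<otimes>\<^bsub>\<KK>\<^esub> p = \<one>\<^bsub>\<KK>\<^esub>"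
      using x TB[OF x(1)] by (simp add: closed \<phi>1 K_simps(2))
    with ix show "\<exists>q\<in>PT. q \<otimes>\<^bsub>\<KK>\<^esub> p = \<one>\<^bsub>\<KK>\<^esub>" by (auto simp: PT_def)
  qed
  have PAT: "PT \<inter> PA \<subseteq> {\<one>\<^bsub>\<KK>\<^esub>}" using \<phi>1 by (auto simp: PT_def PA_def K_simps)
  \<comment> \<open>Over \<open>T\<close>, an element of \<open>\<KK>\<close> is a point of the
    graph times an element of \<open>PA\<close>. Membership in the product is thus a matter of first
    coordinates, and isolation of \<open>T\<close> in \<open>B\<close> carries over to it.\<close>
  have fst_E: "e \<in> S.ae_in PT <#>\<^bsub>S.\<EE>\<^esub> S.ae_in PA"
    if e: "e \<in> carrier S.\<EE>" and ev: "\<forall>\<^sub>F i in U. fst (e i) \<in> T" for e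
  proof -
    define s where "s i = (if fst (e i) \<in> T then (fst (e i), \<phi> (fst (e i))) else \<one>\<^bsub>\<KK>\<^esub>)" for i
    have sPT: "s i \<in> PT" for i
      using subgroup.one_closed[OF PT] by (auto simp: s_def PT_def)
    have sE: "s \<in> carrier S.\<EE>" using subgroup.mem_carrier[OF PT sPT] by (simp add: S.mem_E del: carrier_product_group)
    define a where "a = inv\<^bsub>S.\<EE>\<^esub> s \<otimes>\<^bsub>S.\<EE>\<^esub> e"
    have aE: "a \<in> carrier S.\<EE>" unfolding a_def by (rule S.E.m_closed[OF S.E.inv_closed[OF sE] e])
    have "\<forall>\<^sub>F i in U. a i \<in> PA"
      using ev
    proof eventually_elim
      case (elim i)
      have c: "s i \<in> carrier \<KK>" "e i \<in> carrier \<KK>" using sE e by auto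
      have "fst (a i) = inv\<^bsub>B\<^esub> (fst (s i)) \<otimes>\<^bsub>B\<^esub> fst (e i)"
        unfolding a_def S.E_mult S.E_inv[OF sE] fst_mult fst.hom_inv[OF c(1)] ..
      also have "\<dots> = \<one>\<^bsub>B\<^esub>" using elim TB by (simp add: s_def)
      finally show ?case using aE by (cases "a i") (auto simp: PA_def K_simps PiE_iff dest!: spec[of _ i])
    qed
    then have "a \<in> S.ae_in PA" using aE by (simp add: S.ae_in_def del: carrier_product_group)
    moreover have "s \<in> S.ae_in PT" using sE sPT by (simp add: S.ae_in_def del: carrier_product_group)
    moreover have "e = s \<otimes>\<^bsub>S.\<EE>\<^esub> a"
      unfolding a_def using S.E.m_assoc[OF sE S.E.inv_closed[OF sE] e] S.E.r_inv[OF sE] S.E.l_one[OF e] by metis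
    ultimately show ?thesis using set_multI by metis
  qed
  have iso: "isolated S.\<EE> (S.ae_in PT <#>\<^bsub>S.\<EE>\<^esub> S.ae_in PA)"
    unfolding isolated_def
  proof (intro ballI allI impI)
    fix e and m :: nat
    assume e: "e \<in> carrier S.\<EE>" and m: "0 < m" and "e [^]\<^bsub>S.\<EE>\<^esub> m \<in> S.ae_in PT <#>\<^bsub>S.\<EE>\<^esub> S.ae_in PA"
    then obtain s a where s: "s \<in> S.ae_in PT" and a: "a \<in> S.ae_in PA" and eq: "e [^]\<^bsub>S.\<EE>\<^esub> m = s \<otimes>\<^bsub>S.\<EE>\<^esub> a"
      by (elim set_multE)
    have "\<forall>\<^sub>F i in U. s i \<in> PT" "\<forall>\<^sub>F i in U. a i \<in> PA" using s a by (simp_all add: S.ae_in_def)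
    then have "\<forall>\<^sub>F i in U. fst (e i) \<in> T"
    proof eventually_elim
      case (elim i)
      have ei: "e i \<in> carrier \<KK>" using e by auto
      have "fst (e i) [^]\<^bsub>B\<^esub> m = fst ((e [^]\<^bsub>S.\<EE>\<^esub> m) i)"
        unfolding product_group_UNIV_pow by (rule fst.hom_nat_pow[OF ei, symmetric])
      also have "\<dots> = fst (s i) \<otimes>\<^bsub>B\<^esub> fst (a i)" unfolding eq S.E_mult fst_mult ..
      also have "\<dots> \<in> T" using elim TB by (auto simp: PT_def PA_def)
      finally show ?case using T(2) m fst.hom_closed[OF ei] unfolding isolated_def by blast
    qed
    with e show "e \<in> S.ae_in PT <#>\<^bsub>S.\<EE>\<^esub> S.ae_in PA" by (rule fst_E)
  qed
  have NS: "S.ae_in {\<one>\<^bsub>\<KK>\<^esub>} \<subseteq> S.ae_in PT"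
    using subgroup.one_closed[OF PT] by (auto simp: S.ae_in_def elim: eventually_mono)
  have SN: "S.ae_in PT \<inter> S.ae_in PA \<subseteq> S.ae_in {\<one>\<^bsub>\<KK>\<^esub>}"
  proof
    fix e assume e: "e \<in> S.ae_in PT \<inter> S.ae_in PA"
    then have "\<forall>\<^sub>F i in U. e i \<in> PT" "\<forall>\<^sub>F i in U. e i \<in> PA" by (simp_all add: S.ae_in_def)
    then have "\<forall>\<^sub>F i in U. e i = \<one>\<^bsub>\<KK>\<^esub>" by eventually_elim (use PAT in blast)
    with e show "e \<in> S.ae_in {\<one>\<^bsub>\<KK>\<^esub>}" by (simp add: S.ae_in_def)
  qed
  \<comment> \<open>Up to eventually trivial sequences, \<open>Y\<close> is a complement of the
    ultrapower of \<open>A\<close>, so \<open>fst\<close> maps it isomorphically onto the ultrapower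
    of \<open>B\<close>: \<open>lift_fst\<close> is surjectivity and \<open>unique\<close> is
    injectivity.\<close>
  obtain Y where Y: "subgroup Y S.\<EE>" "S.ae_in PT \<subseteq> Y" "Y \<inter> S.ae_in PA \<subseteq> S.ae_in {\<one>\<^bsub>\<KK>\<^esub>}"
      "Y <#>\<^bsub>S.\<EE>\<^esub> S.ae_in PA = carrier S.\<EE>"
    using S.E.exists_complement[OF S.ae_in_subgroup[OF PT] S.ae_in_subgroup[OF PA] NS SN
        S.ae_in_cotorsion[OF PA] iso] by blast
  have YK: "s i \<in> carrier \<KK>" if "s \<in> Y" for s i
    using subgroup.mem_carrier[OF Y(1) that] by auto
  have lift_fst: "\<exists>s\<in>Y. \<forall>\<^sub>F i in U. fst (s i) = x i" if x: "\<And>i. x i \<in> carrier B" for x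
  proof -
    have "(\<lambda>i. (x i, \<one>\<^bsub>A\<^esub>)) \<in> Y <#>\<^bsub>S.\<EE>\<^esub> S.ae_in PA"
      unfolding Y(4) using x by (simp add: S.mem_E K_simps del: carrier_product_group)
    then obtain s a where s: "s \<in> Y" and a: "a \<in> S.ae_in PA" and eq: "(\<lambda>i. (x i, \<one>\<^bsub>A\<^esub>)) = s \<otimes>\<^bsub>S.\<EE>\<^esub> a"
      by (elim set_multE)
    have fst_eq: "fst (s i) \<otimes>\<^bsub>B\<^esub> fst (a i) = x i" for i
      using fun_cong[OF eq, of i] by (metis S.E_mult fst_conv fst_mult)
    have "\<forall>\<^sub>F i in U. a i \<in> PA" using a by (simp add: S.ae_in_def)
    then have "\<forall>\<^sub>F i in U. fst (s i) = x i"
    proof eventually_elim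
      case (elim i)
      then have "fst (a i) = \<one>\<^bsub>B\<^esub>" by (auto simp: PA_def)
      then show ?case using fst_eq[of i] fst.hom_closed[OF YK[OF s]] by simp
    qed
    with s show ?thesis by blast
  qed
  have unique: "\<forall>\<^sub>F i in U. s i = s' i"
    if s: "s \<in> Y" "s' \<in> Y" and ev: "\<forall>\<^sub>F i in U. fst (s i) = fst (s' i)" for s s'
  proof -
    have sE: "s \<in> carrier S.\<EE>" "s' \<in> carrier S.\<EE>" using subgroup.mem_carrier[OF Y(1)] s by blast+
    define d where "d = s \<otimes>\<^bsub>S.\<EE>\<^esub> inv\<^bsub>S.\<EE>\<^esub> s'"
    have dX: "d \<in> Y" unfolding d_def using s subgroup.m_closed[OF Y(1)] subgroup.m_inv_closed[OF Y(1)] by blast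
    have di: "d i = s i \<otimes>\<^bsub>\<KK>\<^esub> inv\<^bsub>\<KK>\<^esub> (s' i)" for i unfolding d_def S.E_mult S.E_inv[OF sE(2)] ..
    have "\<forall>\<^sub>F i in U. d i \<in> PA"
      using ev
    proof eventually_elim
      case (elim i)
      have "fst (d i) = \<one>\<^bsub>B\<^esub>"
        unfolding di fst_mult fst.hom_inv[OF YK[OF s(2)]] elim
        using fst.hom_closed[OF YK[OF s(2)]] by simp
      then show ?case using YK[OF dX, of i] by (cases "d i") (simp add: PA_def K_simps)
    qed
    then have "d \<in> S.ae_in PA"
      using subgroup.mem_carrier[OF Y(1) dX] by (simp add: S.ae_in_def del: carrier_product_group)
    then have "d \<in> S.ae_in {\<one>\<^bsub>\<KK>\<^esub>}" using Y(3) dX by blast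
    then have "\<forall>\<^sub>F i in U. d i = \<one>\<^bsub>\<KK>\<^esub>" by (simp add: S.ae_in_def)
    then show ?thesis
    proof eventually_elim
      case (elim i)
      then show ?case
        unfolding di using YK[OF s(1), of i] YK[OF s(2), of i]
        by (metis K.inv_closed K.inv_equality K.inv_inv)
    qed
  qed
  \<comment> \<open>\<open>Y\<close> plays the part of a homomorphic section over the ultrapower of
    \<open>B\<close>; \<open>Rel\<close> is the isomorphism induced by it, as a relation between
    representing sequences.\<close>
  define Rel where "Rel g h \<longleftrightarrow> (\<forall>i. g i \<in> carrier G) \<and> (\<forall>i. h i \<in> carrier H) \<and>
    (\<exists>s\<in>Y. \<forall>\<^sub>F i in U. related (s i) (g i) (h i))" for g h
  have Rel_mult: "Rel (\<lambda>i. g i \<otimes>\<^bsub>G\<^esub> g' i) (\<lambda>i. h i \<otimes>\<^bsub>H\<^esub> h' i)" if R: "Rel g h" "Rel g' h'" for g g' h h'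
  proof -
    have c: "g i \<in> carrier G" "g' i \<in> carrier G" "h i \<in> carrier H" "h' i \<in> carrier H" for i
      using that by (auto simp: Rel_def)
    obtain s s' where s: "s \<in> Y" "s' \<in> Y"
      and r: "\<forall>\<^sub>F i in U. related (s i) (g i) (h i)" "\<forall>\<^sub>F i in U. related (s' i) (g' i) (h' i)"
      using R unfolding Rel_def by blast
    from r have "\<forall>\<^sub>F i in U. related ((s \<otimes>\<^bsub>S.\<EE>\<^esub> s') i) (g i \<otimes>\<^bsub>G\<^esub> g' i) (h i \<otimes>\<^bsub>H\<^esub> h' i)"
      by eventually_elim (unfold S.E_mult, rule related_mult[OF _ _ YK[OF s(1)] YK[OF s(2)] c])
    moreover have "s \<otimes>\<^bsub>S.\<EE>\<^esub> s' \<in> Y" using subgroup.m_closed[OF Y(1) s] .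
    ultimately show ?thesis unfolding Rel_def using c G.m_closed H.m_closed by blast
  qed
  have Rel_inv: "Rel (\<lambda>i. inv\<^bsub>G\<^esub> g i) (\<lambda>i. inv\<^bsub>H\<^esub> h i)" if R: "Rel g h" for g h
  proof -
    have c: "g i \<in> carrier G" "h i \<in> carrier H" for i using that by (auto simp: Rel_def)
    obtain s where s: "s \<in> Y" and r: "\<forall>\<^sub>F i in U. related (s i) (g i) (h i)"
      using R unfolding Rel_def by blast
    have "(inv\<^bsub>S.\<EE>\<^esub> s) i = inv\<^bsub>\<KK>\<^esub> (s i)" for i
      using subgroup.mem_carrier[OF Y(1) s] by (rule S.E_inv)
    then have "\<forall>\<^sub>F i in U. related ((inv\<^bsub>S.\<EE>\<^esub> s) i) (inv\<^bsub>G\<^esub> g i) (inv\<^bsub>H\<^esub> h i)"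
      using r by (auto elim!: eventually_mono simp del: inv_product_group intro!: related_inv YK[OF s] c)
    moreover have "inv\<^bsub>S.\<EE>\<^esub> s \<in> Y" using subgroup.m_inv_closed[OF Y(1) s] .
    ultimately show ?thesis unfolding Rel_def using c G.inv_closed H.inv_closed by blast
  qed
  have Rel_one: "Rel (\<lambda>_. \<one>\<^bsub>G\<^esub>) (\<lambda>_. \<one>\<^bsub>H\<^esub>)"
    unfolding Rel_def using related_one subgroup.one_closed[OF Y(1)] G.one_closed H.one_closed
    by (auto intro!: bexI[of _ "\<one>\<^bsub>S.\<EE>\<^esub>"])
  interpret ultrapower_iso U "carrier G" "carrier H" "group_term_eval G" "group_term_eval H" Rel
  proof
    show "ultra U" by (rule U)
    show "carrier G \<noteq> {}" "carrier H \<noteq> {}" using G.one_closed H.one_closed by blast+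
    show "g i \<in> carrier G" "h i \<in> carrier H" if "Rel g h" for g h i using that by (auto simp: Rel_def)
    show "\<exists>h. Rel g h" if g: "\<And>i. g i \<in> carrier G" for g
    proof -
      obtain s where s: "s \<in> Y" and ev: "\<forall>\<^sub>F i in U. fst (s i) = \<pi> (\<theta> (g i))"
        using lift_fst[of "\<lambda>i. \<pi> (\<theta> (g i))"] g \<pi>_closed \<theta>_closed by blast
      have "\<forall>\<^sub>F i in U. \<exists>h\<in>carrier H. related (s i) (g i) h"
        using ev by (rule eventually_mono) (rule related_left[OF g YK[OF s]])
      then obtain h where "\<And>i. h i \<in> carrier H" "\<forall>\<^sub>F i in U. related (s i) (g i) (h i)"
        using ultra_ex[of "carrier H" "\<lambda>i h. related (s i) (g i) h" U] H.one_closed by blast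
      then show ?thesis unfolding Rel_def using s g by blast
    qed
    show "\<exists>g. Rel g h" if h: "\<And>i. h i \<in> carrier H" for h
    proof -
      obtain s where s: "s \<in> Y" and ev: "\<forall>\<^sub>F i in U. fst (s i) = \<pi> (h i)"
        using lift_fst[of "\<lambda>i. \<pi> (h i)"] h \<pi>_closed by blast
      have "\<forall>\<^sub>F i in U. \<exists>g\<in>carrier G. related (s i) g (h i)"
        using ev by (rule eventually_mono) (rule related_right[OF h YK[OF s]])
      then obtain g where "\<And>i. g i \<in> carrier G" "\<forall>\<^sub>F i in U. related (s i) (g i) (h i)"
        using ultra_ex[of "carrier G" "\<lambda>i g. related (s i) g (h i)" U] G.one_closed by blast
      then show ?thesis unfolding Rel_def using s h by blast
    qed
    show "Rel (\<lambda>i. group_term_eval G (e i) t) (\<lambda>i. group_term_eval H (e' i) t)"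
      if "\<And>v. Rel (\<lambda>i. e i v) (\<lambda>i. e' i v)" for e e' t
      by (induction t) (simp_all add: that Rel_one Rel_inv Rel_mult)
    show "(\<forall>\<^sub>F i in U. g i = g' i) \<longleftrightarrow> (\<forall>\<^sub>F i in U. h i = h' i)" if R: "Rel g h" "Rel g' h'" for g h g' h'
    proof -
      have c: "g i \<in> carrier G" "g' i \<in> carrier G" "h i \<in> carrier H" "h' i \<in> carrier H" for i
        using that by (auto simp: Rel_def)
      obtain s s' where s: "s \<in> Y" "s' \<in> Y"
        and r: "\<forall>\<^sub>F i in U. related (s i) (g i) (h i)" "\<forall>\<^sub>F i in U. related (s' i) (g' i) (h' i)"
        using R unfolding Rel_def by blast
      \<comment> \<open>Eventual equality on one side makes the first coordinates of
        \<open>s\<close> and \<open>s'\<close> agree eventually; \<open>unique\<close> then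
        identifies \<open>s\<close> with \<open>s'\<close>, and with that the other side.\<close>
      show ?thesis
      proof
        assume "\<forall>\<^sub>F i in U. h i = h' i"
        with r have "\<forall>\<^sub>F i in U. fst (s i) = fst (s' i)"
          by eventually_elim (simp add: related_def)
        from unique[OF s this] r \<open>\<forall>\<^sub>F i in U. h i = h' i\<close> show "\<forall>\<^sub>F i in U. g i = g' i"
          by eventually_elim (rule \<theta>_inj[OF c(1,2)], simp add: related_def)
      next
        assume "\<forall>\<^sub>F i in U. g i = g' i"
        with r have "\<forall>\<^sub>F i in U. fst (s i) = fst (s' i)"
        proof eventually_elim
          case (elim i)
          have "\<pi> (h i) = \<pi> (h' i)"
            using related_\<pi>[OF elim(1) YK[OF s(1)] c(3)] related_\<pi>[OF elim(2) YK[OF s(2)] c(4)] elim(3) by simp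
          with elim show ?case by (simp add: related_def)
        qed
        from unique[OF s this] r \<open>\<forall>\<^sub>F i in U. g i = g' i\<close> show "\<forall>\<^sub>F i in U. h i = h' i"
        proof eventually_elim
          case (elim i)
          have "snd (s' i) \<in> carrier A" using YK[OF s(2), of i] by (auto simp: K_simps)
          with elim c[of i] show ?case by (simp add: related_def \<iota>_closed)
        qed
      qed
    qed
  qed
  show ?thesis unfolding group_elem_equiv_def group_models_def using models_iff by blast
qed

section \<open>Cocycles that are coboundaries on torsion\<close>

text \<open>On \<open>T\<close> the projection to \<open>F\<close> is trivial, so \<open>f1\<close>
  contributes \<open>1\<close> and \<open>f\<close> is the product of the two coboundaries
  \<open>g\<close> and \<open>f2\<close>, whose trivialising functions are multiplied.
  \<open>T\<close> is isolated: if a power of \<open>t u\<close> lies in \<open>T\<close>, then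
  \<open>u\<close> is a torsion element of the torsion-free \<open>F\<close>.\<close>

lemma CoT_trivial_on_torsion:
  assumes "comm_group A" "comm_group B" "CoT A B f"
  obtains T \<phi> where "subgroup T A" "isolated A T" "\<And>x. x \<in> T \<Longrightarrow> \<phi> x \<in> carrier B"
    "\<And>x y. x \<in> T \<Longrightarrow> y \<in> T \<Longrightarrow> \<phi> (x \<otimes>\<^bsub>A\<^esub> y) = f x y \<otimes>\<^bsub>B\<^esub> \<phi> x \<otimes>\<^bsub>B\<^esub> \<phi> y"
proof -
  interpret A: comm_group A by fact
  interpret B: comm_group B by fact
  obtain T F f1 f2 g where split: "torsion_splitting A T F"
      and f1: "f1 \<in> sym_cocycles (A\<lparr>carrier := F\<rparr>) B" and f2: "coboundary (A\<lparr>carrier := T\<rparr>) B f2"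
      and g: "coboundary A B g"
      and f: "\<And>x y. x \<in> carrier A \<Longrightarrow> y \<in> carrier A \<Longrightarrow> f x y = g x y \<otimes>\<^bsub>B\<^esub>
        (f1 (proj_right A T F x) (proj_right A T F y) \<otimes>\<^bsub>B\<^esub> f2 (proj_left A T F x) (proj_left A T F y))"
    using assms(3) unfolding CoT_def cohomologous_def by blast
  have T: "subgroup T A" and F: "subgroup F A"
      and Tt: "\<And>x. x \<in> T \<Longrightarrow> \<exists>m::nat. m > 0 \<and> x [^]\<^bsub>A\<^esub> m = \<one>\<^bsub>A\<^esub>"
      and Ff: "\<And>x m. x \<in> F \<Longrightarrow> (m::nat) > 0 \<Longrightarrow> x [^]\<^bsub>A\<^esub> m = \<one>\<^bsub>A\<^esub> \<Longrightarrow> x = \<one>\<^bsub>A\<^esub>"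
      and bij: "bij_betw (\<lambda>(t, u). t \<otimes>\<^bsub>A\<^esub> u) (T \<times> F) (carrier A)"
    using split unfolding torsion_splitting_def iso_def by auto
  have TA: "x \<in> carrier A" if "x \<in> T" for x using subgroup.mem_carrier[OF T that] .
  have FA: "x \<in> carrier A" if "x \<in> F" for x using subgroup.mem_carrier[OF F that] .
  have "inv_into (T \<times> F) (\<lambda>(t, u). t \<otimes>\<^bsub>A\<^esub> u) x = (x, \<one>\<^bsub>A\<^esub>)" if "x \<in> T" for x
    using inv_into_f_f[OF bij_betw_imp_inj_on[OF bij], of "(x, \<one>\<^bsub>A\<^esub>)"]
      that TA[OF that] subgroup.one_closed[OF F] by simp
  then have proj: "proj_left A T F x = x" "proj_right A T F x = \<one>\<^bsub>A\<^esub>" if "x \<in> T" for x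
    using that by (simp_all add: proj_left_def proj_right_def)
  have f11: "f1 \<one>\<^bsub>A\<^esub> \<one>\<^bsub>A\<^esub> = \<one>\<^bsub>B\<^esub>"
    using sym_cocyclesD(2)[OF f1, of "\<one>\<^bsub>A\<^esub>" "\<one>\<^bsub>A\<^esub>"] subgroup.one_closed[OF F] by simp
  have gB: "g x y \<in> carrier B" if "x \<in> carrier A" "y \<in> carrier A" for x y
    using g by (intro sym_cocyclesD(1)[of g A B] that) (simp add: coboundary_def)
  have f2B: "f2 x y \<in> carrier B" if "x \<in> T" "y \<in> T" for x y
    using f2 that by (intro sym_cocyclesD(1)[of f2 "A\<lparr>carrier := T\<rparr>" B]) (simp_all add: coboundary_def)
  obtain \<psi> where \<psi>: "\<psi> \<in> carrier A \<rightarrow> carrier B"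
      and \<psi>m: "\<And>x y. x \<in> carrier A \<Longrightarrow> y \<in> carrier A \<Longrightarrow> \<psi> (x \<otimes>\<^bsub>A\<^esub> y) = g x y \<otimes>\<^bsub>B\<^esub> \<psi> x \<otimes>\<^bsub>B\<^esub> \<psi> y"
    using g unfolding coboundary_def by blast
  obtain \<chi> where \<chi>: "\<chi> \<in> T \<rightarrow> carrier B"
      and \<chi>m: "\<And>x y. x \<in> T \<Longrightarrow> y \<in> T \<Longrightarrow> \<chi> (x \<otimes>\<^bsub>A\<^esub> y) = f2 x y \<otimes>\<^bsub>B\<^esub> \<chi> x \<otimes>\<^bsub>B\<^esub> \<chi> y"
    using f2 unfolding coboundary_def by auto
  have "\<psi> (x \<otimes>\<^bsub>A\<^esub> y) \<otimes>\<^bsub>B\<^esub> \<chi> (x \<otimes>\<^bsub>A\<^esub> y) =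
      f x y \<otimes>\<^bsub>B\<^esub> (\<psi> x \<otimes>\<^bsub>B\<^esub> \<chi> x) \<otimes>\<^bsub>B\<^esub> (\<psi> y \<otimes>\<^bsub>B\<^esub> \<chi> y)" if xy: "x \<in> T" "y \<in> T" for x y
  proof -
    have c: "\<psi> x \<in> carrier B" "\<psi> y \<in> carrier B" "\<chi> x \<in> carrier B" "\<chi> y \<in> carrier B"
        "g x y \<in> carrier B" "f2 x y \<in> carrier B"
      using \<psi> \<chi> xy TA gB f2B by auto
    have "f x y = g x y \<otimes>\<^bsub>B\<^esub> f2 x y" using f[OF TA TA, OF xy] xy c by (simp add: proj f11)
    with c show ?thesis by (simp add: \<psi>m[OF TA TA, OF xy] \<chi>m[OF xy] B.m_ac)
  qed
  moreover have "\<psi> x \<otimes>\<^bsub>B\<^esub> \<chi> x \<in> carrier B" if "x \<in> T" for x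
    using that \<psi> \<chi> TA by (intro B.m_closed) (auto simp: Pi_def)
  moreover have "isolated A T"
    unfolding isolated_def
  proof (intro ballI allI impI)
    fix x and m :: nat assume x: "x \<in> carrier A" and m: "0 < m" "x [^]\<^bsub>A\<^esub> m \<in> T"
    obtain t u where tu: "t \<in> T" "u \<in> F" "x = t \<otimes>\<^bsub>A\<^esub> u"
      using bij_betw_imp_surj_on[OF bij] x by force
    have "u [^]\<^bsub>A\<^esub> m = inv\<^bsub>A\<^esub> (t [^]\<^bsub>A\<^esub> m) \<otimes>\<^bsub>A\<^esub> x [^]\<^bsub>A\<^esub> m"
      using TA[OF tu(1)] FA[OF tu(2)] by (simp add: tu(3) A.pow_mult_distrib A.m_comm A.m_assoc[symmetric])
    also have "\<dots> \<in> T"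
      using subgroup.m_closed[OF T subgroup.m_inv_closed[OF T A.subgroup_nat_pow[OF T tu(1)]] m(2)] .
    finally obtain k :: nat where k: "k > 0" "(u [^]\<^bsub>A\<^esub> m) [^]\<^bsub>A\<^esub> k = \<one>\<^bsub>A\<^esub>" using Tt by blast
    then have "u = \<one>\<^bsub>A\<^esub>"
      using Ff[OF tu(2), of "m * k"] m(1) FA[OF tu(2)] by (simp add: A.nat_pow_pow)
    with tu TA show "x \<in> T" by simp
  qed
  ultimately show ?thesis
    by (intro that[of T "\<lambda>x. \<psi> x \<otimes>\<^bsub>B\<^esub> \<chi> x"] T) simp_all
qed

lemma product_group_pow:
  "i \<in> I \<Longrightarrow> (x [^]\<^bsub>product_group I (\<lambda>_. K)\<^esub> (k::nat)) i = x i [^]\<^bsub>K\<^esub> k"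
  by (induction k) simp_all

locale product_cocycle = A: comm_group A for A :: "('a, 'm) monoid_scheme" +
  fixes I :: "'i set" and f :: "'i \<Rightarrow> 'a \<Rightarrow> 'a \<Rightarrow> 'a"
  assumes I: "finite I" and f: "i \<in> I \<Longrightarrow> f i \<in> sym_cocycles A A"
begin

abbreviation \<BB> where "\<BB> \<equiv> product_group I (\<lambda>_. A)"

definition prod_cocycle where "prod_cocycle x y = (\<Otimes>\<^bsub>A\<^esub>i\<in>I. f i (x i) (y i))"

lemma prod_cocycle: "prod_cocycle \<in> sym_cocycles \<BB> A"
proof -
  note f_in = sym_cocyclesD(1)[OF f]
  have B: "x i \<in> carrier A" if "x \<in> carrier \<BB>" "i \<in> I" for x i using that by auto
  show ?thesis
    unfolding sym_cocycles_def
  proof (intro CollectI conjI ballI)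
    fix x y assume x: "x \<in> carrier \<BB>" and y: "y \<in> carrier \<BB>"
    have fi: "(\<lambda>i. f i (x i) (y i)) \<in> I \<rightarrow> carrier A" using f_in B[OF x] B[OF y] by auto
    show "prod_cocycle x y \<in> carrier A" unfolding prod_cocycle_def using fi by (rule A.finprod_closed)
    show "prod_cocycle x y = prod_cocycle y x"
      unfolding prod_cocycle_def using fi sym_cocyclesD(4)[OF f B[OF x] B[OF y]]
      by (intro A.finprod_cong') (auto simp: f_in B[OF x] B[OF y])
    fix z assume z: "z \<in> carrier \<BB>"
    have fs: "(\<lambda>i. f i (x i \<otimes>\<^bsub>A\<^esub> y i) (z i)) \<in> I \<rightarrow> carrier A"
        "(\<lambda>i. f i (x i) (y i \<otimes>\<^bsub>A\<^esub> z i)) \<in> I \<rightarrow> carrier A" "(\<lambda>i. f i (y i) (z i)) \<in> I \<rightarrow> carrier A"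
      using f_in B[OF x] B[OF y] B[OF z] by auto
    have "prod_cocycle (x \<otimes>\<^bsub>\<BB>\<^esub> y) z \<otimes>\<^bsub>A\<^esub> prod_cocycle x y =
        (\<Otimes>\<^bsub>A\<^esub>i\<in>I. f i (x i \<otimes>\<^bsub>A\<^esub> y i) (z i)) \<otimes>\<^bsub>A\<^esub> (\<Otimes>\<^bsub>A\<^esub>i\<in>I. f i (x i) (y i))"
      unfolding prod_cocycle_def
      by (intro arg_cong2[where f = "monoid.mult A"] A.finprod_cong' refl) (use fs in auto)
    also have "\<dots> = (\<Otimes>\<^bsub>A\<^esub>i\<in>I. f i (x i \<otimes>\<^bsub>A\<^esub> y i) (z i) \<otimes>\<^bsub>A\<^esub> f i (x i) (y i))"
      using fs fi by (simp add: A.finprod_multf)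
    also have "\<dots> = (\<Otimes>\<^bsub>A\<^esub>i\<in>I. f i (x i) (y i \<otimes>\<^bsub>A\<^esub> z i) \<otimes>\<^bsub>A\<^esub> f i (y i) (z i))"
      by (intro A.finprod_cong' refl sym_cocyclesD(5)[OF f]) (use fs B[OF x] B[OF y] B[OF z] in auto)
    also have "\<dots> = (\<Otimes>\<^bsub>A\<^esub>i\<in>I. f i (x i) (y i \<otimes>\<^bsub>A\<^esub> z i)) \<otimes>\<^bsub>A\<^esub> (\<Otimes>\<^bsub>A\<^esub>i\<in>I. f i (y i) (z i))"
      using fs by (simp add: A.finprod_multf)
    also have "\<dots> = prod_cocycle x (y \<otimes>\<^bsub>\<BB>\<^esub> z) \<otimes>\<^bsub>A\<^esub> prod_cocycle y z"
      unfolding prod_cocycle_def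
      by (intro arg_cong2[where f = "monoid.mult A"] A.finprod_cong' refl) (use fs in auto)
    finally show "prod_cocycle (x \<otimes>\<^bsub>\<BB>\<^esub> y) z \<otimes>\<^bsub>A\<^esub> prod_cocycle x y =
        prod_cocycle x (y \<otimes>\<^bsub>\<BB>\<^esub> z) \<otimes>\<^bsub>A\<^esub> prod_cocycle y z" .
  next
    fix x assume x: "x \<in> carrier \<BB>"
    show "prod_cocycle \<one>\<^bsub>\<BB>\<^esub> x = \<one>\<^bsub>A\<^esub>" "prod_cocycle x \<one>\<^bsub>\<BB>\<^esub> = \<one>\<^bsub>A\<^esub>"
      unfolding prod_cocycle_def
      using sym_cocyclesD(2)[OF f B[OF x] B[OF x]] sym_cocyclesD(3)[OF f B[OF x] B[OF x]]
      by (auto intro!: A.finprod_one_eqI)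
  qed
qed

text \<open>The data of the factors are combined componentwise: \<open>T\<close> is the product of
  their subgroups and \<open>\<phi>\<close> the product of their trivialising functions. Isolation
  can be tested componentwise because powers are.\<close>

lemma prod_cocycle_trivial:
  assumes "\<And>i. i \<in> I \<Longrightarrow> CoT A A (f i)"
  obtains T \<phi> where "subgroup T \<BB>" "isolated \<BB> T" "\<And>x. x \<in> T \<Longrightarrow> \<phi> x \<in> carrier A"
    "\<And>x y. x \<in> T \<Longrightarrow> y \<in> T \<Longrightarrow>
       \<phi> (x \<otimes>\<^bsub>\<BB>\<^esub> y) = prod_cocycle x y \<otimes>\<^bsub>A\<^esub> \<phi> x \<otimes>\<^bsub>A\<^esub> \<phi> y"
proof -
  let ?Q = "\<lambda>i S \<psi>. subgroup S A \<and> isolated A S \<and> (\<forall>x\<in>S. \<psi> x \<in> carrier A) \<and>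
      (\<forall>x\<in>S. \<forall>y\<in>S. \<psi> (x \<otimes>\<^bsub>A\<^esub> y) = f i x y \<otimes>\<^bsub>A\<^esub> \<psi> x \<otimes>\<^bsub>A\<^esub> \<psi> y)"
  have ex: "\<forall>i\<in>I. \<exists>S \<psi>. ?Q i S \<psi>"
  proof
    fix i assume "i \<in> I"
    from CoT_trivial_on_torsion[OF A.comm_group_axioms A.comm_group_axioms assms[OF this]]
    show "\<exists>S \<psi>. ?Q i S \<psi>" by metis
  qed
  obtain S where "\<forall>i\<in>I. \<exists>\<psi>. ?Q i (S i) \<psi>" using bchoice[OF ex] by (rule exE)
  from bchoice[OF this] obtain \<psi> where Q: "\<forall>i\<in>I. ?Q i (S i) (\<psi> i)" by (rule exE)
  have S: "subgroup (S i) A" "isolated A (S i)"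
      and \<psi>: "x \<in> S i \<Longrightarrow> \<psi> i x \<in> carrier A"
      and \<psi>m: "x \<in> S i \<Longrightarrow> y \<in> S i \<Longrightarrow> \<psi> i (x \<otimes>\<^bsub>A\<^esub> y) = f i x y \<otimes>\<^bsub>A\<^esub> \<psi> i x \<otimes>\<^bsub>A\<^esub> \<psi> i y"
    if "i \<in> I" for i x y
    using bspec[OF Q that] by simp_all
  interpret B: comm_group \<BB> by (rule product_group_comm_group) (rule A.comm_group_axioms)
  define T where "T = PiE I S"
  define \<phi> where "\<phi> x = (\<Otimes>\<^bsub>A\<^esub>i\<in>I. \<psi> i (x i))" for x
  have SA: "x \<in> carrier A" if "i \<in> I" "x \<in> S i" for i x using subgroup.mem_carrier[OF S(1)] that by blast
  have TB: "T \<subseteq> carrier \<BB>" unfolding T_def carrier_product_group by (rule PiE_mono) (use SA in blast)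
  have "subgroup T \<BB>"
  proof (rule B.subgroupI)
    show "T \<subseteq> carrier \<BB>" by (rule TB)
    have "\<one>\<^bsub>\<BB>\<^esub> \<in> T" using subgroup.one_closed[OF S(1)] by (auto simp: T_def)
    then show "T \<noteq> {}" by blast
    fix x assume x: "x \<in> T"
    with TB have xB: "x \<in> (\<Pi>\<^sub>E i\<in>I. carrier A)" by auto
    show "inv\<^bsub>\<BB>\<^esub> x \<in> T"
      using x subgroup.m_inv_closed[OF S(1)] by (simp add: inv_product_group[OF xB] T_def PiE_iff)
    fix y assume "y \<in> T"
    with x show "x \<otimes>\<^bsub>\<BB>\<^esub> y \<in> T"
      using subgroup.m_closed[OF S(1)] by (simp add: T_def PiE_iff)
  qed
  moreover have "isolated \<BB> T"
    unfolding isolated_def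
  proof (intro ballI allI impI)
    fix x and m :: nat assume x: "x \<in> carrier \<BB>" and m: "0 < m" "x [^]\<^bsub>\<BB>\<^esub> m \<in> T"
    have "x i \<in> S i" if i: "i \<in> I" for i
    proof -
      have "x i [^]\<^bsub>A\<^esub> m \<in> S i" using m(2) i product_group_pow[OF i, where x = x and K = A and k = m] by (auto simp: T_def PiE_iff)
      moreover have "x i \<in> carrier A" using x i by auto
      ultimately show ?thesis using S(2)[OF i] m(1) unfolding isolated_def by blast
    qed
    with x show "x \<in> T" by (auto simp: T_def PiE_iff)
  qed
  moreover have Ti: "x i \<in> S i" if "x \<in> T" "i \<in> I" for x i using that by (auto simp: T_def)
  moreover have "\<phi> x \<in> carrier A" if "x \<in> T" for x
    unfolding \<phi>_def by (rule A.finprod_closed) (use \<psi> Ti[OF that] in auto)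
  moreover have "\<phi> (x \<otimes>\<^bsub>\<BB>\<^esub> y) = prod_cocycle x y \<otimes>\<^bsub>A\<^esub> \<phi> x \<otimes>\<^bsub>A\<^esub> \<phi> y"
    if x: "x \<in> T" and y: "y \<in> T" for x y
  proof -
    have c: "(\<lambda>i. f i (x i) (y i)) \<in> I \<rightarrow> carrier A" "(\<lambda>i. \<psi> i (x i)) \<in> I \<rightarrow> carrier A"
        "(\<lambda>i. \<psi> i (y i)) \<in> I \<rightarrow> carrier A"
      using \<psi> Ti x y SA sym_cocyclesD(1)[OF f] by auto
    have "\<phi> (x \<otimes>\<^bsub>\<BB>\<^esub> y) = (\<Otimes>\<^bsub>A\<^esub>i\<in>I. f i (x i) (y i) \<otimes>\<^bsub>A\<^esub> \<psi> i (x i) \<otimes>\<^bsub>A\<^esub> \<psi> i (y i))"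
      unfolding \<phi>_def by (intro A.finprod_cong' refl) (use c \<psi>m Ti[OF x] Ti[OF y] in auto)
    also have "\<dots> = prod_cocycle x y \<otimes>\<^bsub>A\<^esub> \<phi> x \<otimes>\<^bsub>A\<^esub> \<phi> y"
    proof -
      have "(\<lambda>i. f i (x i) (y i) \<otimes>\<^bsub>A\<^esub> \<psi> i (x i)) \<in> I \<rightarrow> carrier A"
        using c by (auto simp: Pi_def)
      with c show ?thesis unfolding \<phi>_def prod_cocycle_def by (simp add: A.finprod_multf)
    qed
    finally show ?thesis .
  qed
  ultimately show ?thesis by (intro that[of T \<phi>]) simp_all
qed

end

section \<open>The deformed group as a twist of the triangular group\<close>

context matrices_over_cring
begin

abbreviation \<AA> where "\<AA> \<equiv> units_of R"
abbreviation \<BB> where "\<BB> \<equiv> product_group {..<n - 1} (\<lambda>_. units_of R)"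

sublocale UR: comm_group \<AA> by (rule units_comm_group)

lemma UR_simps [simp]: "carrier \<AA> = Units R" "x \<otimes>\<^bsub>\<AA>\<^esub> y = x \<otimes> y" "\<one>\<^bsub>\<AA>\<^esub> = \<one>"
  by (simp_all add: units_of_def)

lemma mem_UU: "u \<in> carrier \<UU> \<longleftrightarrow> u \<in> carrier \<TT> \<and> (\<forall>i<n. u $$ (i, i) = \<one>)"
  by (simp add: UT_group_def)

lemma UU_simps: "M \<otimes>\<^bsub>\<UU>\<^esub> N = M \<otimes>\<^bsub>\<MM>\<^esub> N" "\<one>\<^bsub>\<UU>\<^esub> = \<one>\<^bsub>\<MM>\<^esub>"
  by (simp_all add: UT_group_def)

lemma TT_diag_TT_inv:
  assumes "M \<in> carrier \<TT>" "i < n"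
  shows "M $$ (i, i) \<otimes> (inv\<^bsub>\<TT>\<^esub> M) $$ (i, i) = \<one>"
  using TT_mult_diag_entry[OF assms(1) TT.inv_closed[OF assms(1)] assms(2)] TT.r_inv[OF assms(1)] assms(2)
  by (simp add: MM_one)

lemma div_mult_div:
  assumes "a \<in> Units R" "b \<in> Units R" "c \<in> Units R" "d \<in> Units R"
  shows "(a \<otimes> b) \<otimes> inv (c \<otimes> d) = (a \<otimes> inv c) \<otimes> (b \<otimes> inv d)"
proof -
  have "(c \<otimes> d) \<otimes> (inv c \<otimes> inv d) = (c \<otimes> inv c) \<otimes> (d \<otimes> inv d)"
    using assms by (simp only: m_ac Units_closed Units_inv_closed m_closed)
  also have "\<dots> = \<one>" using assms by simp
  finally have "inv (c \<otimes> d) = inv c \<otimes> inv d"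
    using assms by (intro comm_inv_char) (simp_all add: Units_closed)
  with assms show ?thesis by (simp add: m_ac Units_closed)
qed

text \<open>The diagonal modulo scalars, in the representative with last entry \<open>1\<close> that
  \<open>diag_last_one\<close> uses; the restriction puts it into the extensional carrier of
  \<open>product_group\<close>.\<close>

definition projective_diag :: "'a mat \<Rightarrow> nat \<Rightarrow> 'a" where
  "projective_diag M = (\<lambda>i\<in>{..<n - 1}. M $$ (i, i) \<otimes> inv (M $$ (n - 1, n - 1)))"

text \<open>A pair \<open>(h, u)\<close> of the semidirect product stands for \<open>u h\<close>,
  with \<open>h\<close> read as a diagonal matrix times a scalar. For trivial cocycles this is the
  isomorphism onto \<open>T_group\<close>.\<close>

definition untwist :: "((nat \<Rightarrow> 'a) \<times> 'a) \<times> 'a mat \<Rightarrow> 'a mat" where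
  "untwist = (\<lambda>((x, z), u). u \<otimes>\<^bsub>\<MM>\<^esub> (diag_last_one R n x \<otimes>\<^bsub>\<MM>\<^esub> scalar_mat z))"

lemma projective_diag_hom:
  assumes "0 < n" shows "projective_diag \<in> hom \<TT> \<BB>"
proof (rule homI)
  fix M assume M: "M \<in> carrier \<TT>"
  show "projective_diag M \<in> carrier \<BB>"
    using TT_diag_Units[OF M] assms by (auto simp: projective_diag_def)
  fix N assume N: "N \<in> carrier \<TT>"
  show "projective_diag (M \<otimes>\<^bsub>\<TT>\<^esub> N) = projective_diag M \<otimes>\<^bsub>\<BB>\<^esub> projective_diag N"
    unfolding projective_diag_def mult_product_group
    by (rule restrict_ext)
      (use assms in \<open>simp add: TT_mult_diag_entry[OF M N] div_mult_div TT_diag_Units[OF M] TT_diag_Units[OF N]\<close>)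
qed

lemma diag_last_one_diag_of: "diag_last_one R n x = diag_of (\<lambda>i. if i < n - 1 then x i else \<one>)"
  unfolding diag_last_one_def diag_of_def by (rule cong_mat) auto

context
  fixes x assumes x: "x \<in> carrier \<BB>"
begin

lemma BB_Units: "i < n - 1 \<Longrightarrow> x i \<in> Units R"
  using x by (auto simp: PiE_iff)

lemma diag_last_one_TT: "diag_last_one R n x \<in> carrier \<TT>"
  unfolding diag_last_one_diag_of by (rule diag_of_TT) (simp add: BB_Units)

lemma diag_last_one_entry:
  "i < n \<Longrightarrow> diag_last_one R n x $$ (i, i) = (if i < n - 1 then x i else \<one>)"
  unfolding diag_last_one_diag_of by (simp add: diag_of_entry)

lemma diag_last_one_mult:
  assumes y: "y \<in> carrier \<BB>"
  shows "diag_last_one R n (x \<otimes>\<^bsub>\<BB>\<^esub> y) = diag_last_one R n x \<otimes>\<^bsub>\<MM>\<^esub> diag_last_one R n y"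
proof -
  have "x i \<in> carrier R" "y i \<in> carrier R" if "i < n - 1" for i
    using x y that Units_closed by (auto simp: PiE_iff)
  then show ?thesis
    unfolding diag_last_one_diag_of
    by (subst diag_of_mult) (auto intro!: diag_of_cong)
qed

lemma untwist_TT:
  "z \<in> Units R \<Longrightarrow> u \<in> carrier \<UU> \<Longrightarrow> untwist ((x, z), u) \<in> carrier \<TT>"
  using TT.m_closed[OF _ TT.m_closed[OF diag_last_one_TT scalar_mat_TT], of u z]
  by (simp add: untwist_def mem_UU)

lemma untwist_entry:
  assumes z: "z \<in> Units R" and u: "u \<in> carrier \<UU>" and i: "i < n"
  shows "untwist ((x, z), u) $$ (i, i) = (if i < n - 1 then x i \<otimes> z else z)"
proof -
  have u': "u \<in> carrier \<TT>" "u $$ (i, i) = \<one>" using u i by (simp_all add: mem_UU)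
  have d: "diag_last_one R n x \<otimes>\<^bsub>\<MM>\<^esub> scalar_mat z \<in> carrier \<TT>"
    using TT.m_closed[OF diag_last_one_TT scalar_mat_TT[OF z]] by simp
  have "scalar_mat z $$ (i, i) = z" using i by (simp add: scalar_mat_def diag_of_entry)
  then show ?thesis
    using i z u' BB_Units[of i] TT_diag_Units[OF d i]
    by (simp add: untwist_def TT_mult_diag_entry[OF u'(1) d i]
      TT_mult_diag_entry[OF diag_last_one_TT scalar_mat_TT[OF z] i] diag_last_one_entry Units_closed)
qed

lemma projective_diag_untwist:
  assumes z: "z \<in> Units R" and u: "u \<in> carrier \<UU>" and n: "0 < n"
  shows "projective_diag (untwist ((x, z), u)) = x"
proof
  fix i show "projective_diag (untwist ((x, z), u)) i = x i"
  proof (cases "i < n - 1")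
    case True
    then show ?thesis
      using n z BB_Units[OF True]
      by (simp add: projective_diag_def untwist_entry[OF z u] m_assoc Units_closed)
  next
    case False
    then show ?thesis using x by (auto simp: projective_diag_def PiE_iff extensional_def)
  qed
qed

end

lemma untwist_inj:
  assumes n: "0 < n" and x: "x \<in> carrier \<BB>" "x' \<in> carrier \<BB>" and z: "z \<in> Units R" "z' \<in> Units R"
    and u: "u \<in> carrier \<UU>" "u' \<in> carrier \<UU>" and eq: "untwist ((x, z), u) = untwist ((x', z'), u')"
  shows "((x, z), u) = ((x', z'), u')"
proof -
  have xx: "x = x'"
    using projective_diag_untwist[OF x(1) z(1) u(1) n] projective_diag_untwist[OF x(2) z(2) u(2) n] eq by simp
  have zz: "z = z'"
    using untwist_entry[OF x(1) z(1) u(1), of "n - 1"] untwist_entry[OF x(2) z(2) u(2), of "n - 1"] eq n by simp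
  have d: "diag_last_one R n x \<otimes>\<^bsub>\<MM>\<^esub> scalar_mat z \<in> carrier \<TT>"
    using TT.m_closed[OF diag_last_one_TT[OF x(1)] scalar_mat_TT[OF z(1)]] by simp
  let ?d = "diag_last_one R n x \<otimes>\<^bsub>\<MM>\<^esub> scalar_mat z"
  have "u \<otimes>\<^bsub>\<TT>\<^esub> ?d = u' \<otimes>\<^bsub>\<TT>\<^esub> ?d" using eq by (simp add: untwist_def xx zz)
  then have "u = u'" by (rule TT.r_cancel) (use u d in \<open>simp_all add: mem_UU\<close>)
  with xx zz show ?thesis by simp
qed

lemma untwist_surj:
  assumes n: "0 < n" and M: "M \<in> carrier \<TT>"
  obtains x z u where "x \<in> carrier \<BB>" "z \<in> Units R" "u \<in> carrier \<UU>" "untwist ((x, z), u) = M"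
proof -
  define x where "x = projective_diag M"
  define z where "z = M $$ (n - 1, n - 1)"
  have x: "x \<in> carrier \<BB>" unfolding x_def using projective_diag_hom[OF n] M by (rule hom_in_carrier)
  have z: "z \<in> Units R" unfolding z_def using TT_diag_Units[OF M] n by simp
  define d where "d = diag_last_one R n x \<otimes>\<^bsub>\<MM>\<^esub> scalar_mat z"
  have d: "d \<in> carrier \<TT>"
    unfolding d_def using TT.m_closed[OF diag_last_one_TT[OF x] scalar_mat_TT[OF z]] by simp
  define u where "u = M \<otimes>\<^bsub>\<TT>\<^esub> inv\<^bsub>\<TT>\<^esub> d"
  have u: "u \<in> carrier \<TT>" unfolding u_def using TT.m_closed[OF M TT.inv_closed[OF d]] .
  have ud: "u \<otimes>\<^bsub>\<TT>\<^esub> d = M"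
    unfolding u_def using TT.m_assoc[OF M TT.inv_closed[OF d] d] TT.l_inv[OF d] TT.r_one[OF M] by (simp del: TT_simps)
  \<comment> \<open>\<open>d\<close> has the diagonal of \<open>M\<close>, which is why dividing by
    it leaves ones on the diagonal of \<open>u\<close>.\<close>
  have dM: "d $$ (i, i) = M $$ (i, i)" if i: "i < n" for i
  proof -
    have Mi: "M $$ (i, i) \<in> carrier R" using TT_diag_Units[OF M i] by (rule Units_closed)
    have "scalar_mat z $$ (i, i) = z" using i by (simp add: scalar_mat_def diag_of_entry)
    then have "d $$ (i, i) = (if i < n - 1 then x i else \<one>) \<otimes> z"
      unfolding d_def TT_mult_diag_entry[OF diag_last_one_TT[OF x] scalar_mat_TT[OF z] i]
      by (simp add: diag_last_one_entry[OF x i])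
    also have "\<dots> = M $$ (i, i)"
    proof (cases "i < n - 1")
      case True
      then have "x i = M $$ (i, i) \<otimes> inv z" by (simp add: x_def projective_diag_def z_def)
      with True show ?thesis using z Mi by (simp add: m_assoc Units_closed)
    next
      case False
      then have "i = n - 1" using i by simp
      then show ?thesis using z by (simp add: z_def Units_closed)
    qed
    finally show ?thesis .
  qed
  have "u $$ (i, i) = \<one>" if i: "i < n" for i
  proof -
    have c: "M $$ (i, i) \<in> Units R" "u $$ (i, i) \<in> Units R" using TT_diag_Units[OF M i] TT_diag_Units[OF u i] .
    have "u $$ (i, i) \<otimes> M $$ (i, i) = M $$ (i, i)"
      using TT_mult_diag_entry[OF u d i] ud dM[OF i] by simp
    then have "u $$ (i, i) \<otimes> M $$ (i, i) \<otimes> inv (M $$ (i, i)) = M $$ (i, i) \<otimes> inv (M $$ (i, i))" by simp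
    then show ?thesis using c by (simp add: m_assoc Units_closed)
  qed
  with u have "u \<in> carrier \<UU>" by (simp add: mem_UU)
  moreover have "untwist ((x, z), u) = M" using ud by (simp add: untwist_def d_def)
  ultimately show ?thesis using that x z by blast
qed

lemma UU_conj:
  assumes d: "d \<in> carrier \<TT>" and v: "v \<in> carrier \<UU>"
  shows "d \<otimes>\<^bsub>\<MM>\<^esub> v \<otimes>\<^bsub>\<MM>\<^esub> inv\<^bsub>\<TT>\<^esub> d \<in> carrier \<UU>"
proof -
  have v': "v \<in> carrier \<TT>" using v by (simp add: mem_UU)
  have di: "inv\<^bsub>\<TT>\<^esub> d \<in> carrier \<TT>" using d by simp
  have dv: "d \<otimes>\<^bsub>\<MM>\<^esub> v \<in> carrier \<TT>" using TT.m_closed[OF d v'] by simp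
  have "(d \<otimes>\<^bsub>\<MM>\<^esub> v \<otimes>\<^bsub>\<MM>\<^esub> inv\<^bsub>\<TT>\<^esub> d) $$ (i, i) = \<one>" if i: "i < n" for i
    unfolding TT_mult_diag_entry[OF dv di i] TT_mult_diag_entry[OF d v' i]
    using v i TT_diag_TT_inv[OF d i] TT_diag_Units[OF d i] by (simp add: mem_UU Units_closed)
  then show ?thesis using TT.m_closed[OF dv di] by (simp add: mem_UU)
qed

lemma UU_mult:
  assumes "u \<in> carrier \<UU>" "v \<in> carrier \<UU>" shows "u \<otimes>\<^bsub>\<MM>\<^esub> v \<in> carrier \<UU>"
  using assms TT.m_closed[of u v] by (simp add: mem_UU TT_mult_diag_entry)

text \<open>The inverse in the conjugation cancels against the diagonal factor of the product, and
  the central scalars are moved to their places. \<open>c\<close> stands for the cocycle value,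
  which comes out as the twisting scalar.\<close>

lemma untwist_mult:
  assumes x: "x \<in> carrier \<BB>" "y \<in> carrier \<BB>" and z: "z \<in> Units R" "w \<in> Units R" "c \<in> Units R"
    and u: "u \<in> carrier \<UU>" "v \<in> carrier \<UU>"
  shows "untwist ((x \<otimes>\<^bsub>\<BB>\<^esub> y, z \<otimes> w \<otimes> c),
      u \<otimes>\<^bsub>\<MM>\<^esub> (diag_last_one R n x \<otimes>\<^bsub>\<MM>\<^esub> v \<otimes>\<^bsub>\<MM>\<^esub> inv\<^bsub>\<TT>\<^esub> (diag_last_one R n x))) =
    scalar_mat c \<otimes>\<^bsub>\<MM>\<^esub> (untwist ((x, z), u) \<otimes>\<^bsub>\<MM>\<^esub> untwist ((y, w), v))"
proof -
  define d e Z W C where "d = diag_last_one R n x" and "e = diag_last_one R n y"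
    and "Z = scalar_mat z" and "W = scalar_mat w" and "C = scalar_mat c"
  have c: "d \<in> carrier \<TT>" "e \<in> carrier \<TT>" "Z \<in> carrier \<TT>" "W \<in> carrier \<TT>" "C \<in> carrier \<TT>"
      "u \<in> carrier \<TT>" "v \<in> carrier \<TT>"
    using diag_last_one_TT[OF x(1)] diag_last_one_TT[OF x(2)] z u
    by (simp_all add: d_def e_def Z_def W_def C_def scalar_mat_TT mem_UU)
  have central: "Z \<otimes>\<^bsub>\<TT>\<^esub> M = M \<otimes>\<^bsub>\<TT>\<^esub> Z" "C \<otimes>\<^bsub>\<TT>\<^esub> M = M \<otimes>\<^bsub>\<TT>\<^esub> C" if "M \<in> carrier \<TT>" for M
    using scalar_mat_commute[of _ M] z TT_MM[OF that] by (simp_all add: Z_def C_def Units_closed)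
  have s: "scalar_mat (z \<otimes> w \<otimes> c) = Z \<otimes>\<^bsub>\<TT>\<^esub> W \<otimes>\<^bsub>\<TT>\<^esub> C"
    using z by (simp add: Z_def W_def C_def scalar_mat_mult Units_closed)
  have "u \<otimes>\<^bsub>\<TT>\<^esub> (d \<otimes>\<^bsub>\<TT>\<^esub> v \<otimes>\<^bsub>\<TT>\<^esub> inv\<^bsub>\<TT>\<^esub> d) \<otimes>\<^bsub>\<TT>\<^esub> ((d \<otimes>\<^bsub>\<TT>\<^esub> e) \<otimes>\<^bsub>\<TT>\<^esub> (Z \<otimes>\<^bsub>\<TT>\<^esub> W \<otimes>\<^bsub>\<TT>\<^esub> C)) =
      u \<otimes>\<^bsub>\<TT>\<^esub> d \<otimes>\<^bsub>\<TT>\<^esub> v \<otimes>\<^bsub>\<TT>\<^esub> (inv\<^bsub>\<TT>\<^esub> d \<otimes>\<^bsub>\<TT>\<^esub> d) \<otimes>\<^bsub>\<TT>\<^esub> e \<otimes>\<^bsub>\<TT>\<^esub> Z \<otimes>\<^bsub>\<TT>\<^esub> W \<otimes>\<^bsub>\<TT>\<^esub> C"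
    using c by (simp only: TT.m_assoc TT.m_closed TT.inv_closed)
  also have "\<dots> = (u \<otimes>\<^bsub>\<TT>\<^esub> d) \<otimes>\<^bsub>\<TT>\<^esub> ((v \<otimes>\<^bsub>\<TT>\<^esub> e) \<otimes>\<^bsub>\<TT>\<^esub> Z) \<otimes>\<^bsub>\<TT>\<^esub> W \<otimes>\<^bsub>\<TT>\<^esub> C"
    using c by (simp only: TT.l_inv TT.r_one TT.m_assoc TT.m_closed)
  also have "\<dots> = (u \<otimes>\<^bsub>\<TT>\<^esub> d) \<otimes>\<^bsub>\<TT>\<^esub> (Z \<otimes>\<^bsub>\<TT>\<^esub> (v \<otimes>\<^bsub>\<TT>\<^esub> e)) \<otimes>\<^bsub>\<TT>\<^esub> W \<otimes>\<^bsub>\<TT>\<^esub> C"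
    using central(1)[of "v \<otimes>\<^bsub>\<TT>\<^esub> e"] c by (simp only: TT.m_closed)
  also have "\<dots> = (u \<otimes>\<^bsub>\<TT>\<^esub> (d \<otimes>\<^bsub>\<TT>\<^esub> Z) \<otimes>\<^bsub>\<TT>\<^esub> (v \<otimes>\<^bsub>\<TT>\<^esub> (e \<otimes>\<^bsub>\<TT>\<^esub> W))) \<otimes>\<^bsub>\<TT>\<^esub> C"
    using c by (simp only: TT.m_assoc TT.m_closed)
  also have "\<dots> = C \<otimes>\<^bsub>\<TT>\<^esub> (u \<otimes>\<^bsub>\<TT>\<^esub> (d \<otimes>\<^bsub>\<TT>\<^esub> Z) \<otimes>\<^bsub>\<TT>\<^esub> (v \<otimes>\<^bsub>\<TT>\<^esub> (e \<otimes>\<^bsub>\<TT>\<^esub> W)))"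
    using central(2) c by (simp only: TT.m_closed)
  finally show ?thesis
    unfolding untwist_def prod.case diag_last_one_mult[OF x] s
    by (simp only: TT_simps d_def e_def Z_def W_def C_def)
qed

theorem T_deformed_elem_equiv:
  assumes n: "0 < n" and f: "\<And>i. i < n - 1 \<Longrightarrow> f i \<in> sym_cocycles \<AA> \<AA>"
    and CoT: "\<And>i. i < n - 1 \<Longrightarrow> CoT \<AA> \<AA> (f i)"
  shows "group_elem_equiv (T_deformed R n f) \<TT>"
proof -
  interpret P: product_cocycle \<AA> "{..<n - 1}" f
    by unfold_locales (use f in auto)
  have D: "D_group R n f = cocycle_ext \<BB> \<AA> P.prod_cocycle"
    unfolding D_group_def cocycle_ext_def Let_def P.prod_cocycle_def by simp
  let ?G = "T_deformed R n f"
  have G_carrier: "carrier ?G = (carrier \<BB> \<times> Units R) \<times> carrier \<UU>"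
    by (simp add: T_deformed_def semidirect_product_def D cocycle_ext_def)
  have G_one: "\<one>\<^bsub>?G\<^esub> = ((\<one>\<^bsub>\<BB>\<^esub>, \<one>), \<one>\<^bsub>\<MM>\<^esub>)"
    by (simp add: T_deformed_def semidirect_product_def D cocycle_ext_def UU_simps)
  have G_mult: "((x, z), u) \<otimes>\<^bsub>?G\<^esub> ((y, w), v) = ((x \<otimes>\<^bsub>\<BB>\<^esub> y, z \<otimes> w \<otimes> P.prod_cocycle x y),
      u \<otimes>\<^bsub>\<MM>\<^esub> (diag_last_one R n x \<otimes>\<^bsub>\<MM>\<^esub> v \<otimes>\<^bsub>\<MM>\<^esub> inv\<^bsub>\<TT>\<^esub> (diag_last_one R n x)))"
    if "x \<in> carrier \<BB>" for x z u y w v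
  proof -
    have "M \<otimes>\<^bsub>GL R n\<^esub> N = M \<otimes>\<^bsub>\<MM>\<^esub> N" for M N by (simp add: GL_def units_of_def)
    then show ?thesis
      using TT_inv[OF diag_last_one_TT[OF that]]
      by (simp add: T_deformed_def semidirect_product_def D cocycle_ext_def UU_simps)
  qed
  have comm_BB: "comm_group \<BB>" by (rule product_group_comm_group) (rule UR.comm_group_axioms)
  have cB: "P.prod_cocycle x y \<in> Units R" if "x \<in> carrier \<BB>" "y \<in> carrier \<BB>" for x y
    using sym_cocyclesD(1)[OF P.prod_cocycle that] by simp
  \<comment> \<open>The cocycle depends only on the diagonals modulo scalars and takes scalar
    values, so it lives on a quotient that its own values do not affect; this is the assumption
    \<open>\<pi>\<iota>\<close> of the locale.\<close>
  interpret cocycle_twist \<AA> \<BB> \<TT> ?G P.prod_cocycle scalar_mat projective_diag untwist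
  proof (intro cocycle_twist.intro cocycle_twist_axioms.intro)
    show "comm_group \<AA>" "comm_group \<BB>" "group \<TT>" "P.prod_cocycle \<in> sym_cocycles \<BB> \<AA>"
      by (rule UR.comm_group_axioms comm_BB TT.is_group P.prod_cocycle)+
    show "scalar_mat \<in> hom \<AA> \<TT>"
      by (rule homI) (simp_all add: scalar_mat_TT scalar_mat_mult Units_closed)
    show "scalar_mat a \<otimes>\<^bsub>\<TT>\<^esub> h = h \<otimes>\<^bsub>\<TT>\<^esub> scalar_mat a" if "a \<in> carrier \<AA>" "h \<in> carrier \<TT>" for a h
      using that by (simp add: scalar_mat_commute TT_MM Units_closed)
    show "projective_diag \<in> hom \<TT> \<BB>" using n by (rule projective_diag_hom)
    show "projective_diag (scalar_mat a) = \<one>\<^bsub>\<BB>\<^esub>" if "a \<in> carrier \<AA>" for a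
      unfolding projective_diag_def one_product_group
      by (rule restrict_ext) (use that n in \<open>simp add: scalar_mat_def diag_of_entry\<close>)
    show "bij_betw untwist (carrier ?G) (carrier \<TT>)"
      unfolding bij_betw_def
    proof
      show "inj_on untwist (carrier ?G)"
      proof (rule inj_onI)
        fix g g' assume "g \<in> carrier ?G" "g' \<in> carrier ?G" and eq: "untwist g = untwist g'"
        then obtain x z u y w v where gg: "g = ((x, z), u)" "g' = ((y, w), v)"
            and x: "x \<in> carrier \<BB>" "y \<in> carrier \<BB>" and z: "z \<in> Units R" "w \<in> Units R"
            and u: "u \<in> carrier \<UU>" "v \<in> carrier \<UU>"
          unfolding G_carrier by (elim SigmaE) simp
        show "g = g'" using eq unfolding gg by (rule untwist_inj[OF n x z u])
      qed
      show "untwist ` carrier ?G = carrier \<TT>"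
      proof
        show "untwist ` carrier ?G \<subseteq> carrier \<TT>" using untwist_TT by (auto simp: G_carrier)
        show "carrier \<TT> \<subseteq> untwist ` carrier ?G"
        proof
          fix M assume "M \<in> carrier \<TT>"
          then obtain x z u where "x \<in> carrier \<BB>" "z \<in> Units R" "u \<in> carrier \<UU>" "untwist ((x, z), u) = M"
            by (rule untwist_surj[OF n])
          then show "M \<in> untwist ` carrier ?G"
            unfolding G_carrier by (intro image_eqI[of _ _ "((x, z), u)"]) simp_all
        qed
      qed
    qed
    have 1: "\<one>\<^bsub>\<BB>\<^esub> \<in> carrier \<BB>" by simp
    have U1: "\<one>\<^bsub>\<MM>\<^esub> \<in> carrier \<UU>" using TT.one_closed by (simp add: mem_UU MM_one)
    then show "\<one>\<^bsub>?G\<^esub> \<in> carrier ?G" using 1 by (simp add: G_one G_carrier)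
    have "diag_last_one R n \<one>\<^bsub>\<BB>\<^esub> = \<one>\<^bsub>\<MM>\<^esub>"
      unfolding diag_last_one_diag_of MM_one_diag by (rule diag_of_cong) simp
    then show "untwist \<one>\<^bsub>?G\<^esub> = \<one>\<^bsub>\<TT>\<^esub>"
      by (simp add: G_one untwist_def scalar_mat_def flip: MM_one_diag)
    fix g g' assume "g \<in> carrier ?G" "g' \<in> carrier ?G"
    then obtain x z u y w v where gg: "g = ((x, z), u)" "g' = ((y, w), v)"
        and x: "x \<in> carrier \<BB>" "y \<in> carrier \<BB>" and z: "z \<in> Units R" "w \<in> Units R"
        and u: "u \<in> carrier \<UU>" "v \<in> carrier \<UU>"
      unfolding G_carrier by (elim SigmaE) simp
    show "g \<otimes>\<^bsub>?G\<^esub> g' \<in> carrier ?G"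
      unfolding gg G_mult[OF x(1)] G_carrier
      using UU_mult[OF u(1) UU_conj[OF diag_last_one_TT[OF x(1)] u(2)]] cB[OF x] z
        comm_BB[THEN comm_group.axioms(2), THEN group.is_monoid, THEN monoid.m_closed, OF x]
      by (simp del: carrier_product_group mult_product_group)
    show "untwist (g \<otimes>\<^bsub>?G\<^esub> g') = scalar_mat (P.prod_cocycle (projective_diag (untwist g))
        (projective_diag (untwist g'))) \<otimes>\<^bsub>\<TT>\<^esub> (untwist g \<otimes>\<^bsub>\<TT>\<^esub> untwist g')"
      unfolding gg G_mult[OF x(1)] projective_diag_untwist[OF x(1) z(1) u(1) n]
        projective_diag_untwist[OF x(2) z(2) u(2) n] TT_simps
      by (rule untwist_mult[OF x z cB[OF x] u])
  qed
  show ?thesis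
  proof (rule P.prod_cocycle_trivial)
    show "CoT \<AA> \<AA> (f i)" if "i \<in> {..<n - 1}" for i using CoT that by simp
  qed (rule twist_elem_equiv)
qed

end

theorem theorem3p17:
  fixes K :: "('k, 'p) ring_scheme" and R :: "('a, 'm) ring_scheme"
    and f :: "nat \<Rightarrow> 'a \<Rightarrow> 'a \<Rightarrow> 'a" and n :: nat
  assumes "n \<ge> 3"
    and "number_field K"
    and "cring R"
    and "ring_elem_equiv R (ring_of_integers K)"
    and "\<And>i. i < n - 1 \<Longrightarrow> f i \<in> sym_cocycles (units_of R) (units_of R)"
    and "\<And>i. i < n - 1 \<Longrightarrow> CoT (units_of R) (units_of R) (f i)"
  shows "group_elem_equiv (T_deformed R n f) (T_group (ring_of_integers K) n)"
proof -
  interpret matrices_over_cring R n by (rule matrices_over_cring.intro[OF assms(3)])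
  have "group_elem_equiv (T_deformed R n f) (T_group R n)"
    by (rule T_deformed_elem_equiv) (use assms(1,5,6) in auto)
  moreover have "group_elem_equiv (T_group R n) (T_group (ring_of_integers K) n)"
    using T_group_elem_equiv[OF assms(3) ring_elem_equiv_cring[OF assms(4,3)] assms(4)] .
  ultimately show ?thesis by (simp add: group_elem_equiv_def)
qed

end
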